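(* Let $\sigma(n)$ denote the smallest size of a conflict collection of planar graphs on $n$ vertices. Then $\sigma(n)\le (3+o(1))\log_2(n)$ as $n\to\infty$; in particular, for all sufficiently large $n$ a conflict collection of $n$-vertex planar graphs of this size exists.
   Context: A straight-line embedding of a planar graph $G$ on a point set $P\subseteq\mathbb{R}^2$ is an injective map from $V(G)$ to $P$ such that drawing each edge $uv$ as the straight segment between the images of $u$ and $v$ yields a crossing-free drawing. A set $\mathcal{G}$ of planar graphs, all on $n$ vertices, is simultaneously embeddable if there is a set $P$ of $n$ points in the plane such that every $G\in\mathcal{G}$ has a straight-line embedding on $P$. A conflict collection is a set of planar graphs, all with the same number of vertices, that is not simultaneously embeddable. $\sigma(n)$ is the minimum size of a conflict collection consisting of $n$-vertex planar graphs. *)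

theory Defs
  imports "HOL-Analysis.Analysis" "HOL-Library.Landau_Symbols" "HOL-Library.Extended_Nat"
    "HOL-Library.Extended_Real"
begin

type_synonym 'a graph = "'a set \<times> 'a set set"

abbreviation verts :: "'a graph \<Rightarrow> 'a set" where "verts \<equiv> fst"
abbreviation edges :: "'a graph \<Rightarrow> 'a set set" where "edges \<equiv> snd"

definition finite_simple_graph :: "'a graph \<Rightarrow> bool" where
  "finite_simple_graph G \<longleftrightarrow>
     finite (verts G) \<and> (\<forall>e\<in>edges G. e \<subseteq> verts G \<and> card e = 2)"

text \<open>
  In a drawing, \<open>p\<close> gives the positions of the vertices and \<open>D\<close> the set of points covered by each
  edge. Two edges may meet only in the position of a common end, and no edge passes through
  the position of a vertex that is not one of its ends (isolated vertices included).
\<close>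
definition crossing_free ::
    "'a graph \<Rightarrow> ('a \<Rightarrow> real ^ 2) \<Rightarrow> ('a set \<Rightarrow> (real ^ 2) set) \<Rightarrow> bool" where
  "crossing_free G p D \<longleftrightarrow>
     inj_on p (verts G) \<and>
     (\<forall>e\<in>edges G. \<forall>f\<in>edges G. e \<noteq> f \<longrightarrow> D e \<inter> D f \<subseteq> p ` (e \<inter> f)) \<and>
     (\<forall>e\<in>edges G. \<forall>w\<in>verts G - e. p w \<notin> D e)"

definition planar :: "'a graph \<Rightarrow> bool" where
  "planar G \<longleftrightarrow>
     finite_simple_graph G \<and>
     (\<exists>(p :: 'a \<Rightarrow> real ^ 2) (\<gamma> :: 'a set \<Rightarrow> real \<Rightarrow> real ^ 2).
        (\<forall>e\<in>edges G. arc (\<gamma> e) \<and> {pathstart (\<gamma> e), pathfinish (\<gamma> e)} = p ` e) \<and>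
        crossing_free G p (\<lambda>e. path_image (\<gamma> e)))"

text \<open>For an edge \<open>e = {u, v}\<close>, the set \<open>convex hull (p ` e)\<close> is \<open>closed_segment (p u) (p v)\<close>.\<close>
definition straight_line_embedding ::
    "'a graph \<Rightarrow> (real ^ 2) set \<Rightarrow> ('a \<Rightarrow> real ^ 2) \<Rightarrow> bool" where
  "straight_line_embedding G P p \<longleftrightarrow>
     p ` verts G \<subseteq> P \<and> crossing_free G p (\<lambda>e. convex hull (p ` e))"

definition simultaneously_embeddable :: "nat \<Rightarrow> 'a graph set \<Rightarrow> bool" where
  "simultaneously_embeddable n \<G> \<longleftrightarrow>
     (\<exists>P :: (real ^ 2) set. finite P \<and> card P = n \<and>
        (\<forall>G\<in>\<G>. \<exists>p. straight_line_embedding G P p))"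

text \<open>
  Taking the vertices to be natural numbers and the collection to be finite does not change the
  minimum size: straight-line embeddability on a point set is invariant under isomorphism, every
  finite graph is isomorphic to one with vertices in \<open>nat\<close>, and there are only finitely many
  isomorphism classes of graphs on \<open>n\<close> vertices.
\<close>
definition conflict_collection :: "nat \<Rightarrow> nat graph set \<Rightarrow> bool" where
  "conflict_collection n \<G> \<longleftrightarrow>
     finite \<G> \<and> (\<forall>G\<in>\<G>. planar G \<and> card (verts G) = n) \<and> \<not> simultaneously_embeddable n \<G>"

text \<open>The value is \<open>\<infinity>\<close> for those \<open>n\<close> (such as small ones) that admit no conflict collection.\<close>
definition \<sigma> :: "nat \<Rightarrow> enat" where
  "\<sigma> n = (INF \<G> \<in> {\<G>. conflict_collection n \<G>}. enat (card \<G>))"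

end

theory Submission imports Defs "HOL-Real_Asymp.Real_Asymp" begin

text \<open>
  The conflict collection consists of stacked triangulations on \<open>{..<n}\<close>, in which each vertex
  \<open>k \<ge> 3\<close> is joined to the corners of a bounded face of the triangulation on the smaller vertices.
  There are \<open>1 \<cdot> 3 \<cdot> 5 \<cdots> (2n - 7)\<close> of them, about \<open>2\<^sup>n n!\<close> up to a polynomial factor. If the
  vertices are placed at labelled points, vertex \<open>k\<close> can only be joined to the corners of the face
  in which its point lies, so at most one of the triangulations is drawn without crossings. Hence a
  point set carries at most \<open>n!\<close> of them, a fraction of about \<open>2\<^bsup>-n\<^esup>\<close>, and which ones depends only
  on the order type, refined by the order of the coordinates.

  There are at most \<open>n\<^bsup>4n\<^esup>\<close> labelled order types up to a factor \<open>c\<^sup>n\<close>, hence \<open>n\<^bsup>3n\<^esup>\<close> unlabelled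
  ones, so a union bound over the order types shows that \<open>(3 + o(1)) log\<^sub>2 n\<close> suitable triangulations
  are not simultaneously embeddable. The count of order types is Warren's bound on the
  number of sign patterns of \<open>m\<close> polynomials in \<open>N\<close> variables: each cell contains a critical point of
  \<open>\<Sum> x\<^sub>i\<^bsup>10\<^esup> + K \<Sum>\<^bsub>j\<in>S\<^esub> (f\<^sub>j\<^sup>2 - e\<^sub>j)\<^sup>2\<close> for some set \<open>S\<close> of at most \<open>N\<close> indices, and for
  each \<open>S\<close> there are at most \<open>9\<^sup>N\<close> critical points, since their equations rewrite every \<open>x\<^sub>i\<^sup>9\<close>
  into terms of lower degree.
\<close>

subsection \<open>Polynomial functions and the number of solutions of triangular systems\<close>

text \<open>The union bound is carried out on labelled patterns, by counting pairs of a
  \<open>k\<close>-tuple of triangulations and a pattern that carries all its members. A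
  simultaneously embeddable tuple contributes at least \<open>n!\<close> pairs, because relabelling
  its point set produces pairwise different patterns; a pattern contributes at most
  \<open>(n!)^k\<close>. This gain of \<open>n!\<close> on the side of the tuples is what lowers the
  exponent \<open>4n\<close> to \<open>3n\<close>.

  The exponent \<open>4n\<close> itself arises because about \<open>n^3\<close> sign conditions in
  \<open>2n\<close> coordinates leave about \<open>(n^3 / n)^(2n)\<close> choices of
  \<open>S\<close>. Point sets need not be in general position, so signs take three values.

  For the critical points the levels \<open>e_j\<close> must be generic, so that no more than
  \<open>N\<close> of them are met at once; a finite counting argument supplies them.
  \<open>S\<close> is a maximal set of levels met at once within a cell, which keeps the penalty
  positive on the walls, so a minimiser for large \<open>K\<close> is interior.

  The obstacle to uniqueness is that a drawing may have a different outer triangle than the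
  combinatorial one. Only the set of all triangular faces, outer one included, is independent of the
  drawing, and the induction is about that set.\<close>

lemma homogeneous_system_nontrivial:
  fixes a :: "'b \<Rightarrow> 'z \<Rightarrow> real"
  assumes "finite B" "finite Z" "card B < card Z"
  shows "\<exists>u. (\<exists>z\<in>Z. u z \<noteq> 0) \<and> (\<forall>b\<in>B. (\<Sum>z\<in>Z. u z * a b z) = 0)"
  using assms
proof (induction B arbitrary: Z a rule: finite_induct)
  case empty
  then have "Z \<noteq> {}" by auto
  then show ?case by (intro exI[of _ "\<lambda>_. 1"]) auto
next
  case (insert b B)
  have lt: "card B < card Z" using insert by auto
  show ?case
  proof (cases "\<forall>z\<in>Z. a b z = 0")
    case True
    obtain u where u: "\<exists>z\<in>Z. u z \<noteq> 0" "\<forall>b\<in>B. (\<Sum>z\<in>Z. u z * a b z) = 0"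
      using insert.IH[OF insert.prems(1) lt] by metis
    have "(\<Sum>z\<in>Z. u z * a b z) = 0" using True by (intro sum.neutral) auto
    then show ?thesis using u by (intro exI[of _ u]) auto
  next
    case False
    then obtain z0 where z0: "z0 \<in> Z" "a b z0 \<noteq> 0" by auto
    \<comment> \<open>Elimination of the unknown \<open>z0\<close> with the equation
      \<open>b\<close>; \<open>v\<close> below restores its value.\<close>
    define a' where "a' = (\<lambda>b' z. a b' z - a b' z0 * a b z / a b z0)"
    have "card B < card (Z - {z0})" using insert z0 by auto
    then obtain u where u: "\<exists>z\<in>Z-{z0}. u z \<noteq> 0" "\<forall>b\<in>B. (\<Sum>z\<in>Z-{z0}. u z * a' b z) = 0"
      using insert.IH[of "Z - {z0}" a'] insert.prems(1) by auto
    define v where "v = u(z0 := - (\<Sum>z\<in>Z-{z0}. u z * a b z) / a b z0)"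
    have spl: "(\<Sum>z\<in>Z. v z * a b' z) = v z0 * a b' z0 + (\<Sum>z\<in>Z-{z0}. u z * a b' z)" for b'
    proof -
      have "(\<Sum>z\<in>Z. v z * a b' z) = v z0 * a b' z0 + (\<Sum>z\<in>Z-{z0}. v z * a b' z)"
        using insert.prems(1) z0 by (simp add: sum.remove)
      also have "(\<Sum>z\<in>Z-{z0}. v z * a b' z) = (\<Sum>z\<in>Z-{z0}. u z * a b' z)"
        by (intro sum.cong) (auto simp: v_def)
      finally show ?thesis .
    qed
    have "(\<Sum>z\<in>Z. v z * a b' z) = 0" if "b' \<in> insert b B" for b'
    proof (cases "b' = b")
      case True
      then show ?thesis using z0 unfolding spl by (simp add: v_def)
    next
      case False
      then have "(\<Sum>z\<in>Z-{z0}. u z * a' b' z) = 0" using u that by auto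
      moreover have "(\<Sum>z\<in>Z-{z0}. u z * a' b' z)
          = (\<Sum>z\<in>Z-{z0}. u z * a b' z) - a b' z0 / a b z0 * (\<Sum>z\<in>Z-{z0}. u z * a b z)"
        by (simp add: a'_def sum_subtractf sum_distrib_left algebra_simps)
      ultimately show ?thesis using z0 unfolding spl by (simp add: v_def)
    qed
    moreover have "\<exists>z\<in>Z. v z \<noteq> 0" using u(1) by (auto simp: v_def)
    ultimately show ?thesis by (intro exI[of _ v]) auto
  qed
qed

text \<open>Functions instead of formal polynomials, with an upper bound \<open>d\<close> on the
  degree. Multiplying by one variable at a time makes closure properties, continuity, derivatives
  and the expansion into monomials plain rule inductions.\<close>

inductive polyfun :: "'i set \<Rightarrow> nat \<Rightarrow> (('i \<Rightarrow> real) \<Rightarrow> real) \<Rightarrow> bool" for I where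
  polyfun_const: "polyfun I d (\<lambda>_. c)"
| polyfun_add: "polyfun I d f \<Longrightarrow> polyfun I d g \<Longrightarrow> polyfun I d (\<lambda>x. f x + g x)"
| polyfun_var_mult: "i \<in> I \<Longrightarrow> polyfun I d f \<Longrightarrow> polyfun I (Suc d) (\<lambda>x. x i * f x)"

lemma polyfun_mono:
  assumes "polyfun I d f" "d \<le> e"
  shows "polyfun I e f"
  using assms
proof (induction arbitrary: e rule: polyfun.induct)
  case (polyfun_var_mult i d f)
  then obtain e' where "e = Suc e'" "d \<le> e'" by (cases e) auto
  then show ?case using polyfun.polyfun_var_mult[OF polyfun_var_mult.hyps(1) polyfun_var_mult.IH] by simp
qed (auto intro: polyfun.intros)

lemma polyfun_scale: "polyfun I d f \<Longrightarrow> polyfun I d (\<lambda>x. c * f x)"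
proof (induction rule: polyfun.induct)
  case (polyfun_add d f g)
  then show ?case using polyfun.polyfun_add[of I d "\<lambda>x. c * f x" "\<lambda>x. c * g x"]
    by (simp add: distrib_left)
next
  case (polyfun_var_mult i d f)
  then show ?case using polyfun.polyfun_var_mult[of i I d "\<lambda>x. c * f x"]
    by (simp add: mult.left_commute)
qed (auto intro: polyfun.intros)

lemma polyfun_mult: "polyfun I d f \<Longrightarrow> polyfun I e g \<Longrightarrow> polyfun I (d + e) (\<lambda>x. f x * g x)"
proof (induction arbitrary: e rule: polyfun.induct)
  case (polyfun_const d c)
  then show ?case using polyfun_mono[OF polyfun_scale, of I e g "d + e"] by simp
next
  case (polyfun_add d f f')
  then show ?case
    using polyfun.polyfun_add[of I "d + e" "\<lambda>x. f x * g x" "\<lambda>x. f' x * g x"]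
    by (simp add: distrib_right)
next
  case (polyfun_var_mult i d f)
  then show ?case
    using polyfun.polyfun_var_mult[of i I "d + e" "\<lambda>x. f x * g x"]
    by (simp add: mult.assoc)
qed

lemma polyfun_var: "i \<in> I \<Longrightarrow> polyfun I 1 (\<lambda>x. x i)"
  using polyfun_var_mult[of i I 0 "\<lambda>_. 1"] polyfun_const[of I 0 1] by simp

lemma polyfun_diff: "polyfun I d f \<Longrightarrow> polyfun I d g \<Longrightarrow> polyfun I d (\<lambda>x. f x - g x)"
  using polyfun_add[of I d f "\<lambda>x. - 1 * g x"] polyfun_scale[of I d g "-1"] by simp

lemma polyfun_power: "polyfun I d f \<Longrightarrow> polyfun I (k * d) (\<lambda>x. f x ^ k)"
  by (induction k) (auto intro: polyfun_const polyfun_mult)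

lemma polyfun_sum: "(\<And>a. a \<in> A \<Longrightarrow> polyfun I d (f a)) \<Longrightarrow> polyfun I d (\<lambda>x. \<Sum>a\<in>A. f a x)"
  by (induction A rule: infinite_finite_induct) (auto intro: polyfun_const polyfun_add)

lemma polyfun_prod:
  "(\<And>a. a \<in> A \<Longrightarrow> polyfun I d (f a)) \<Longrightarrow> polyfun I (card A * d) (\<lambda>x. \<Prod>a\<in>A. f a x)"
  by (induction A rule: infinite_finite_induct) (auto intro: polyfun_const polyfun_mult)

lemma continuous_on_polyfun:
  assumes "polyfun I d f" shows "continuous_on S f"
proof -
  have "continuous_on UNIV f"
    using assms by (induction rule: polyfun.induct) (auto intro!: continuous_intros)
  then show ?thesis using continuous_on_subset by blast
qed

text \<open>The bound \<open>d\<close> is kept for the derivative. This suffices later: the penalty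
  has degree bound 8, and its derivatives only have to stay below \<open>x i ^ 9\<close>.\<close>

lemma polyfun_partial_derivative:
  assumes "polyfun I d f"
  shows "\<exists>g. polyfun I d g \<and> (\<forall>x. ((\<lambda>t. f (x(j := t))) has_real_derivative g x) (at (x j)))"
  using assms
proof (induction rule: polyfun.induct)
  case (polyfun_const d c)
  show ?case by (intro exI[of _ "\<lambda>_. 0"]) (auto intro: polyfun.polyfun_const)
next
  case (polyfun_add d f g)
  from polyfun_add.IH obtain f' g' where f': "polyfun I d f'"
     "\<And>x. ((\<lambda>t. f (x(j := t))) has_real_derivative f' x) (at (x j))"
    and g': "polyfun I d g'"
     "\<And>x. ((\<lambda>t. g (x(j := t))) has_real_derivative g' x) (at (x j))" by metis
  show ?case
    by (intro exI[of _ "\<lambda>x. f' x + g' x"] conjI allI polyfun.polyfun_add DERIV_add f' g')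
next
  case (polyfun_var_mult i d f)
  then obtain f' where f': "polyfun I d f'"
     "\<And>x. ((\<lambda>t. f (x(j := t))) has_real_derivative f' x) (at (x j))" by metis
  have a: "polyfun I (Suc d) (\<lambda>x. (if i = j then 1 else 0) * f x)"

    by (intro polyfun_scale polyfun_mono[OF polyfun_var_mult.hyps(2)]) simp
  have b: "polyfun I (Suc d) (\<lambda>x. x i * f' x)"
    using polyfun_var_mult.hyps(1) f'(1) by (rule polyfun.polyfun_var_mult)
  have "((\<lambda>t. (x(j := t)) i * f (x(j := t))) has_real_derivative
      (if i = j then 1 else 0) * f x + x i * f' x) (at (x j))" for x
  proof (cases "i = j")
    case True
    then show ?thesis using DERIV_mult[OF DERIV_ident f'(2)[of x]] by (simp add: algebra_simps)
  next
    case False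
    then show ?thesis using DERIV_cmult[OF f'(2)[of x], of "x i"] by simp
  qed
  then show ?case using polyfun.polyfun_add[OF a b] by blast
qed

section \<open>Spans of monomials on a finite set of points\<close>

definition monom_at :: "'i set \<Rightarrow> ('i \<Rightarrow> nat) \<Rightarrow> ('i \<Rightarrow> real) \<Rightarrow> real" where
  "monom_at I b x = (\<Prod>i\<in>I. x i ^ b i)"

text \<open>Equality is required on \<open>Z\<close> only, so this is the span of \<open>B\<close>
  modulo the functions vanishing on \<open>Z\<close>, without a quotient space.\<close>

definition lincomb_on ::
    "'i set \<Rightarrow> ('i \<Rightarrow> nat) set \<Rightarrow> ('i \<Rightarrow> real) set \<Rightarrow> (('i \<Rightarrow> real) \<Rightarrow> real) \<Rightarrow> bool" where
  "lincomb_on I B Z f \<longleftrightarrow> (\<exists>c. \<forall>z\<in>Z. f z = (\<Sum>b\<in>B. c b * monom_at I b z))"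

lemma lincomb_on_add:
  assumes "lincomb_on I B Z f" "lincomb_on I B Z g"
  shows "lincomb_on I B Z (\<lambda>x. f x + g x)"
proof -
  obtain c d where "\<forall>z\<in>Z. f z = (\<Sum>b\<in>B. c b * monom_at I b z)"
    "\<forall>z\<in>Z. g z = (\<Sum>b\<in>B. d b * monom_at I b z)" using assms by (auto simp: lincomb_on_def)
  then show ?thesis unfolding lincomb_on_def
    by (intro exI[of _ "\<lambda>b. c b + d b"]) (auto simp: algebra_simps sum.distrib)
qed

lemma lincomb_on_scale: "lincomb_on I B Z f \<Longrightarrow> lincomb_on I B Z (\<lambda>x. a * f x)"
  unfolding lincomb_on_def
proof (elim exE)
  fix c assume "\<forall>z\<in>Z. f z = (\<Sum>b\<in>B. c b * monom_at I b z)"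
  then show "\<exists>c. \<forall>z\<in>Z. a * f z = (\<Sum>b\<in>B. c b * monom_at I b z)"
    by (intro exI[of _ "\<lambda>b. a * c b"]) (auto simp: sum_distrib_left algebra_simps)
qed

lemma lincomb_on_zero: "lincomb_on I B Z (\<lambda>x. 0)"
  unfolding lincomb_on_def by (intro exI[of _ "\<lambda>_. 0"]) auto

lemma lincomb_on_sum:
  "(\<And>a. a \<in> A \<Longrightarrow> lincomb_on I B Z (f a)) \<Longrightarrow> lincomb_on I B Z (\<lambda>x. \<Sum>a\<in>A. f a x)"
  by (induction A rule: infinite_finite_induct) (auto intro: lincomb_on_zero lincomb_on_add)

lemma lincomb_on_cong:
  "lincomb_on I B Z f \<Longrightarrow> (\<And>z. z \<in> Z \<Longrightarrow> g z = f z) \<Longrightarrow> lincomb_on I B Z g"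
  unfolding lincomb_on_def by auto

lemma lincomb_on_monom_at:
  assumes "finite B" "b \<in> B"
  shows "lincomb_on I B Z (monom_at I b)"
proof -
  have "(\<Sum>b'\<in>B. (if b' = b then 1 else 0) * monom_at I b' z) = monom_at I b z" for z
    using assms by (simp add: if_distrib[of "\<lambda>t. t * _"] cong: if_cong)
  then show ?thesis unfolding lincomb_on_def by (intro exI[of _ "\<lambda>b'. if b' = b then 1 else 0"]) auto
qed

lemma lincomb_on_trans:
  assumes "lincomb_on I B Z f" "\<And>b. b \<in> B \<Longrightarrow> lincomb_on I B' Z (monom_at I b)"
  shows "lincomb_on I B' Z f"
proof -
  obtain c where c: "\<forall>z\<in>Z. f z = (\<Sum>b\<in>B. c b * monom_at I b z)"
    using assms by (auto simp: lincomb_on_def)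
  have "lincomb_on I B' Z (\<lambda>z. \<Sum>b\<in>B. c b * monom_at I b z)"
    by (intro lincomb_on_sum lincomb_on_scale assms(2))
  then show ?thesis using c by (auto intro: lincomb_on_cong)
qed

definition exponents :: "'i set \<Rightarrow> nat \<Rightarrow> ('i \<Rightarrow> nat) set" where
  "exponents I d = {b \<in> I \<rightarrow>\<^sub>E {..d}. sum b I \<le> d}"

lemma finite_exponents: "finite I \<Longrightarrow> finite (exponents I d)"
  unfolding exponents_def by (rule finite_subset[of _ "I \<rightarrow>\<^sub>E {..d}"]) (auto intro: finite_PiE)

lemma exponents_iff:
  assumes "finite I"
  shows "b \<in> exponents I d \<longleftrightarrow> b \<in> extensional I \<and> sum b I \<le> d"
proof -
  have "b i \<le> d" if "i \<in> I" "sum b I \<le> d" for i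
    using member_le_sum[OF that(1), of b] assms that(2) by auto
  then show ?thesis by (auto simp: exponents_def PiE_def)
qed

lemma monom_at_upd:
  assumes "finite I" "i \<in> I"
  shows "monom_at I (b(i := k)) x = x i ^ k * (\<Prod>j\<in>I-{i}. x j ^ b j)"
proof -
  have "monom_at I (b(i := k)) x = x i ^ k * (\<Prod>j\<in>I-{i}. x j ^ (b(i := k)) j)"
    using assms by (simp add: monom_at_def prod.remove)
  also have "(\<Prod>j\<in>I-{i}. x j ^ (b(i := k)) j) = (\<Prod>j\<in>I-{i}. x j ^ b j)"
    by (intro prod.cong) auto
  finally show ?thesis .
qed

lemma sum_upd_nat:
  fixes b :: "'i \<Rightarrow> nat"
  assumes "finite I" "i \<in> I"
  shows "sum (b(i := k)) I = k + sum b (I - {i})"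
proof -
  have "sum (b(i := k)) I = k + sum (b(i := k)) (I - {i})" using assms by (simp add: sum.remove)
  also have "sum (b(i := k)) (I - {i}) = sum b (I - {i})" by (intro sum.cong) auto
  finally show ?thesis .
qed

lemma polyfun_lincomb:
  assumes "finite I" "polyfun I d f"
  shows "lincomb_on I (exponents I d) Z f"
  using assms(2)
proof (induction rule: polyfun.induct)
  case (polyfun_const d c)
  have "restrict (\<lambda>_. 0) I \<in> exponents I d" using assms(1) by (simp add: exponents_iff)
  from lincomb_on_scale[OF lincomb_on_monom_at[OF finite_exponents[OF assms(1)] this], of I Z c]
  show ?case by (simp add: monom_at_def)
next
  case (polyfun_add d f g)
  then show ?case by (intro lincomb_on_add)
next
  case (polyfun_var_mult i d f)
  obtain c where c: "\<forall>z\<in>Z. f z = (\<Sum>b\<in>exponents I d. c b * monom_at I b z)"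
    using polyfun_var_mult by (auto simp: lincomb_on_def)
  have "lincomb_on I (exponents I (Suc d)) Z (\<lambda>x. x i * monom_at I b x)" if b: "b \<in> exponents I d" for b
  proof -
    let ?b = "b(i := Suc (b i))"
    have "sum b I = b i + sum b (I - {i})"
      using sum_upd_nat[OF assms(1) polyfun_var_mult(1), of b "b i"] by simp
    then have "sum ?b I = Suc (sum b I)" using sum_upd_nat[OF assms(1) polyfun_var_mult(1), of b "Suc (b i)"]
      by simp
    then have "?b \<in> exponents I (Suc d)"
      using b polyfun_var_mult(1) unfolding exponents_iff[OF assms(1)] by (auto simp: extensional_def)
    then have "lincomb_on I (exponents I (Suc d)) Z (monom_at I ?b)"
      by (intro lincomb_on_monom_at finite_exponents assms)
    moreover have "monom_at I ?b x = x i * monom_at I b x" for x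
      using monom_at_upd[OF assms(1) polyfun_var_mult(1), of b "Suc (b i)" x]
        monom_at_upd[OF assms(1) polyfun_var_mult(1), of b "b i" x] by simp
    ultimately show ?thesis by (simp add: lincomb_on_def)
  qed
  then have "lincomb_on I (exponents I (Suc d)) Z (\<lambda>x. \<Sum>b\<in>exponents I d. c b * (x i * monom_at I b x))"
    by (intro lincomb_on_sum lincomb_on_scale)
  then show ?case using c
    by (elim lincomb_on_cong) (auto simp: sum_distrib_left algebra_simps)
qed

lemma polyfun_monom_at:
  assumes "finite I" shows "polyfun I (sum b I) (monom_at I b)"
proof -
  have "A \<subseteq> I \<Longrightarrow> polyfun I (sum b A) (\<lambda>x. \<Prod>i\<in>A. x i ^ b i)" if "finite A" for A using that
  proof (induction A rule: finite_induct)
    case (insert a A)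
    have "polyfun I (b a) (\<lambda>x. x a ^ b a)"
      using polyfun_power[OF polyfun_var, of a I "b a"] insert by simp
    then show ?case using insert polyfun_mult[of I "b a" "\<lambda>x. x a ^ b a" "sum b A"] by simp
  qed (auto intro: polyfun_const)
  from this[of I] show ?thesis using assms by (simp add: monom_at_def[abs_def])
qed

text \<open>Rewriting with \<open>x i ^ r = g i x\<close> lowers the total degree, so it terminates on \<open>Z\<close>.\<close>
lemma monom_at_reduce:
  assumes "finite I" "0 < r"
    and g: "\<And>i. i \<in> I \<Longrightarrow> polyfun I (r - 1) (g i)"
    and Z: "\<And>z i. z \<in> Z \<Longrightarrow> i \<in> I \<Longrightarrow> z i ^ r = g i z"
  shows "sum b I = d \<Longrightarrow> b \<in> extensional I \<Longrightarrow> lincomb_on I (I \<rightarrow>\<^sub>E {..<r}) Z (monom_at I b)"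
proof (induction d arbitrary: b rule: less_induct)
  case (less d)
  show ?case
  proof (cases "\<forall>i\<in>I. b i < r")
    case True
    then show ?thesis using less.prems assms(1)
      by (intro lincomb_on_monom_at finite_PiE) (auto simp: PiE_def)
  next
    case False
    then obtain i where i: "i \<in> I" "r \<le> b i" by auto
    let ?b = "b(i := b i - r)"
    have s: "sum ?b I + r = d"
      using sum_upd_nat[OF assms(1) i(1), of b "b i - r"] sum_upd_nat[OF assms(1) i(1), of b "b i"] i(2)
        less.prems(1) by simp
    have m: "monom_at I b x = x i ^ r * monom_at I ?b x" for x
      using monom_at_upd[OF assms(1) i(1), of b "b i" x] monom_at_upd[OF assms(1) i(1), of b "b i - r" x] i(2)
      by (simp flip: power_add mult.assoc)
    have "polyfun I (r - 1 + sum ?b I) (\<lambda>x. g i x * monom_at I ?b x)"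
      by (intro polyfun_mult g i polyfun_monom_at assms)
    then have "lincomb_on I (exponents I (r - 1 + sum ?b I)) Z (\<lambda>x. g i x * monom_at I ?b x)"
      using polyfun_lincomb assms(1) by blast
    then have "lincomb_on I (exponents I (r - 1 + sum ?b I)) Z (monom_at I b)"
      by (rule lincomb_on_cong) (simp add: m Z i)
    then show ?thesis
    proof (rule lincomb_on_trans)
      fix b' assume "b' \<in> exponents I (r - 1 + sum ?b I)"
      then have "b' \<in> extensional I" "sum b' I < d"
        using s assms(2) by (auto simp: exponents_iff[OF assms(1)])
      then show "lincomb_on I (I \<rightarrow>\<^sub>E {..<r}) Z (monom_at I b')" using less.IH by blast
    qed
  qed
qed

text \<open>The functions \<open>\<delta> z\<close> have a diagonal matrix of values on
  \<open>Z\<close> with nonzero diagonal, so they are linearly independent; but they all lie in a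
  space spanned by \<open>card B\<close> functions.\<close>

lemma card_le_of_separating:
  fixes \<delta> :: "('i \<Rightarrow> real) \<Rightarrow> ('i \<Rightarrow> real) \<Rightarrow> real"
  assumes "finite Z" "finite B"
    and "\<And>z. z \<in> Z \<Longrightarrow> lincomb_on I B Z (\<delta> z)"
    and "\<And>z. z \<in> Z \<Longrightarrow> \<delta> z z \<noteq> 0"
    and "\<And>z w. z \<in> Z \<Longrightarrow> w \<in> Z \<Longrightarrow> w \<noteq> z \<Longrightarrow> \<delta> z w = 0"
  shows "card Z \<le> card B"
proof (rule ccontr)
  assume "\<not> card Z \<le> card B"
  then obtain u where u: "\<exists>z\<in>Z. u z \<noteq> 0" "\<forall>b\<in>B. (\<Sum>z\<in>Z. u z * monom_at I b z) = 0"
    using homogeneous_system_nontrivial[OF assms(2,1), of "monom_at I"] by auto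
  have "u w = 0" if w: "w \<in> Z" for w
  proof -
    obtain c where c: "\<forall>z\<in>Z. \<delta> w z = (\<Sum>b\<in>B. c b * monom_at I b z)"
      using assms(3)[OF w] by (auto simp: lincomb_on_def)
    have "u w * \<delta> w w = (\<Sum>z\<in>Z. u z * \<delta> w z)"
    proof -
      have "(\<Sum>z\<in>Z. u z * \<delta> w z) = (\<Sum>z\<in>Z. if z = w then u w * \<delta> w w else 0)"
        using assms(5)[OF w] by (intro sum.cong) auto
      then show ?thesis using assms(1) w by simp
    qed
    also have "\<dots> = (\<Sum>z\<in>Z. \<Sum>b\<in>B. c b * (u z * monom_at I b z))"
      by (intro sum.cong) (auto simp: c sum_distrib_left algebra_simps)
    also have "\<dots> = (\<Sum>b\<in>B. c b * (\<Sum>z\<in>Z. u z * monom_at I b z))"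
      by (subst sum.swap) (simp add: sum_distrib_left)
    also have "\<dots> = 0" using u(2) by simp
    finally show ?thesis using assms(4)[OF w] by simp
  qed
  then show False using u(1) by auto
qed

text \<open>On the solutions every polynomial reduces to monomials with all exponents below
  \<open>r\<close>, of which there are \<open>r ^ card I\<close>. This elementary form of Bezout's
  bound applies to each finite set of solutions; \<open>supp\<close> ensures that distinct solutions
  differ in a coordinate from \<open>I\<close>.\<close>

lemma card_power_system_le:
  assumes "finite I" "0 < r" "finite Z"
    and g: "\<And>i. i \<in> I \<Longrightarrow> polyfun I (r - 1) (g i)"
    and Z: "\<And>z i. z \<in> Z \<Longrightarrow> i \<in> I \<Longrightarrow> z i ^ r = g i z"
    and supp: "\<And>z i. z \<in> Z \<Longrightarrow> i \<notin> I \<Longrightarrow> z i = 0"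
  shows "card Z \<le> r ^ card I"
proof -
  \<comment> \<open>Products of squared distances to the other solutions. Their degree is
    irrelevant, since reduction brings it down; a real sum of squares vanishes only when the points
    agree.\<close>
  define \<delta> where "\<delta> = (\<lambda>(z::'a\<Rightarrow>real) (x::'a\<Rightarrow>real). \<Prod>w\<in>Z-{z}. \<Sum>i\<in>I. (x i - w i)^2)"
  have "card Z \<le> card (I \<rightarrow>\<^sub>E {..<r})"
  proof (rule card_le_of_separating[where \<delta> = \<delta> and I = I])
    show "finite (I \<rightarrow>\<^sub>E {..<r})" using assms(1) by (auto intro: finite_PiE)
    fix z assume z: "z \<in> Z"
    have "polyfun I (card (Z-{z}) * (2 * 1)) (\<delta> z)" unfolding \<delta>_def
      by (intro polyfun_prod polyfun_sum polyfun_power polyfun_diff polyfun_var polyfun_const)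
    from polyfun_lincomb[OF assms(1) this]
    show "lincomb_on I (I \<rightarrow>\<^sub>E {..<r}) Z (\<delta> z)"
      by (rule lincomb_on_trans)
         (use assms in \<open>auto simp: exponents_iff intro!: monom_at_reduce[where g = g]\<close>)
    have "(\<Sum>i\<in>I. (z i - w i)^2) \<noteq> 0" if "w \<in> Z" "w \<noteq> z" for w
    proof
      assume "(\<Sum>i\<in>I. (z i - w i)^2) = 0"
      then have "\<forall>i\<in>I. z i = w i" using assms(1) by (simp add: sum_nonneg_eq_0_iff)
      then have "z = w" using supp z that by (intro ext) metis
      then show False using that by simp
    qed
    then show "\<delta> z z \<noteq> 0" using assms(3) by (auto simp: \<delta>_def)
  next
    fix z w assume "z \<in> Z" "w \<in> Z" "w \<noteq> z"
    then show "\<delta> z w = 0" using assms(3) by (auto simp: \<delta>_def intro!: prod_zero bexI[of _ w])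
  qed (use assms in auto)
  then show ?thesis using assms(1) by (simp add: card_PiE)
qed

subsection \<open>The number of sign patterns of quadratic polynomials\<close>

lemma card_exponents_le:
  assumes "finite I" shows "card (exponents I d) \<le> (d + 1) ^ card I"
proof -
  have "card (exponents I d) \<le> card (I \<rightarrow>\<^sub>E {..d})"
    unfolding exponents_def using assms by (intro card_mono finite_PiE) auto
  then show ?thesis using assms by (simp add: card_PiE)
qed

text \<open>Choose one preimage for each attained value vector; products of \<open>g j x - t\<close>
  over the wrong values \<open>t\<close> separate these preimages and have bounded degree. The
  resulting bound grows like \<open>card T\<close> to the power \<open>card I\<close>, whereas the
  grid has \<open>card T ^ card S\<close> vectors, so for \<open>card S > card I\<close> and large
  \<open>T\<close> most vectors are missed.\<close>

lemma card_grid_points_le: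
  fixes g :: "'j \<Rightarrow> ('i \<Rightarrow> real) \<Rightarrow> real"
  assumes "finite I" "finite S" "finite T"
    and g: "\<And>j. j \<in> S \<Longrightarrow> polyfun I q (g j)"
  shows "card {v \<in> S \<rightarrow>\<^sub>E T. \<exists>x. \<forall>j\<in>S. g j x = v j} \<le> (card S * (card T * q) + 1) ^ card I"
proof -
  let ?A = "{v \<in> S \<rightarrow>\<^sub>E T. \<exists>x. \<forall>j\<in>S. g j x = v j}"
  define X where "X = (\<lambda>v. SOME x. \<forall>j\<in>S. g j x = v j)"
  have X: "g j (X v) = v j" if "v \<in> ?A" "j \<in> S" for v j
  proof -
    from that have "\<exists>x. \<forall>j\<in>S. g j x = v j" by auto
    then have "\<forall>j\<in>S. g j (X v) = v j" unfolding X_def by (rule someI_ex)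
    then show ?thesis using that by auto
  qed
  have fin: "finite ?A" by (rule finite_subset[of _ "S \<rightarrow>\<^sub>E T"]) (auto intro: finite_PiE assms)
  have inj: "inj_on X ?A"
  proof (rule inj_onI)
    fix v w assume vw: "v \<in> ?A" "w \<in> ?A" "X v = X w"
    then have "v j = w j" if "j \<in> S" for j
      using X[OF vw(1) that] X[OF vw(2) that] vw(3) by simp
    then show "v = w" using vw(1,2) by (intro PiE_ext[of v S "\<lambda>_. T" w]) auto
  qed
  define \<delta> where "\<delta> = (\<lambda>z x. \<Prod>j\<in>S. \<Prod>t\<in>T-{g j z}. g j x - t)"
  have "card (X ` ?A) \<le> card (exponents I (card S * (card T * q)))"
  proof (rule card_le_of_separating[where I = I and \<delta> = \<delta>])
    show "finite (X ` ?A)" using fin by simp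
    show "finite (exponents I (card S * (card T * q)))" by (rule finite_exponents[OF assms(1)])
    fix z assume "z \<in> X ` ?A"
    then obtain v where v: "v \<in> ?A" "z = X v" by auto
    have "polyfun I (card T * q) (\<lambda>x. \<Prod>t\<in>T-{g j z}. g j x - t)" if "j \<in> S" for j
    proof -
      have "polyfun I (card (T - {g j z}) * q) (\<lambda>x. \<Prod>t\<in>T-{g j z}. g j x - t)"
        using that by (intro polyfun_prod polyfun_diff g polyfun_const)
      moreover have "card (T - {g j z}) * q \<le> card T * q"
        using assms(3) by (intro mult_right_mono card_mono) auto
      ultimately show ?thesis using polyfun_mono by metis
    qed
    then have "polyfun I (card S * (card T * q)) (\<delta> z)"
      unfolding \<delta>_def by (intro polyfun_prod)
    then show "lincomb_on I (exponents I (card S * (card T * q))) (X ` ?A) (\<delta> z)"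
      using polyfun_lincomb assms(1) by blast
    show "\<delta> z z \<noteq> 0" unfolding \<delta>_def using assms by auto
  next
    fix z w assume "z \<in> X ` ?A" "w \<in> X ` ?A" "w \<noteq> z"
    then obtain u v where uv: "u \<in> ?A" "v \<in> ?A" "z = X u" "w = X v" "u \<noteq> v" by auto
    have "\<exists>j\<in>S. u j \<noteq> v j"
    proof (rule ccontr)
      assume "\<not> (\<exists>j\<in>S. u j \<noteq> v j)"
      then have "u = v" using uv by (intro PiE_ext[of u S "\<lambda>_. T" v]) auto
      then show False using uv by simp
    qed
    then obtain j where j: "j \<in> S" "u j \<noteq> v j" by auto
    have gz: "g j z = u j" "g j w = v j" using X uv j by auto
    have "v j \<in> T" using uv j by auto
    then have "(\<Prod>t\<in>T-{g j z}. g j w - t) = 0"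
      using gz j assms(3) by (intro prod_zero) auto
    then show "\<delta> z w = 0" unfolding \<delta>_def using assms(2) j by (intro prod_zero) auto
  qed
  also have "\<dots> \<le> (card S * (card T * q) + 1) ^ card I" by (rule card_exponents_le[OF assms(1)])
  finally show ?thesis unfolding card_image[OF inj] .
qed

text \<open>A finite substitute for Sard's theorem. Levels are sought in a grid
  \<open>J \<rightarrow>\<^sub>E T\<close>; by \<open>card_grid_points_le\<close>, on any
  \<open>card I + 1\<close> indices only a small share of the grid values is attained, and a union
  over these index sets leaves a good vector.\<close>

lemma ex_generic_levels:
  fixes g :: "'j \<Rightarrow> ('i \<Rightarrow> real) \<Rightarrow> real" and \<delta> :: real
  assumes "finite I" "finite J" "\<delta> > 0"
    and g: "\<And>j. j \<in> J \<Longrightarrow> polyfun I q (g j)"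
  shows "\<exists>e. (\<forall>j\<in>J. 0 < e j \<and> e j < \<delta>) \<and>
    (\<forall>S\<subseteq>J. \<forall>x. (\<forall>j\<in>S. g j x = e j) \<longrightarrow> card S \<le> card I)"
proof -
  define N where "N = card I"
  define m where "m = card J"
  define Q where "Q = Suc N * q + 1"
  \<comment> \<open>At most \<open>2 ^ m\<close> index sets occur, each spoiling at most a share
    \<open>Q ^ N / t\<close> of the grid; this \<open>t\<close> makes the shares add up to less than
    1.\<close>
  define t where "t = 2 ^ m * Q ^ N + 1"
  have "infinite {0<..<\<delta>}" using assms(3) by (simp add: infinite_Ioo)
  then obtain T where T: "finite T" "card T = t" "T \<subseteq> {0<..<\<delta>}"
    using infinite_arbitrarily_large by metis
  define A where "A = (\<lambda>S. {v \<in> S \<rightarrow>\<^sub>E T. \<exists>x. \<forall>j\<in>S. g j x = v j})"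
  define Ss where "Ss = {S. S \<subseteq> J \<and> card S = Suc N}"
  define bad where "bad = (\<lambda>S. {e \<in> J \<rightarrow>\<^sub>E T. restrict e S \<in> A S})"
  have finSs: "finite Ss" using assms(2) by (auto simp: Ss_def)
  have cSs: "card Ss \<le> 2 ^ m"
    using card_mono[of "Pow J" Ss] assms(2) by (auto simp: Ss_def m_def card_Pow)
  have cbad: "card (bad S) \<le> (Q * t) ^ N * t ^ (m - Suc N)" if S: "S \<in> Ss" for S
  proof -
    have SJ: "S \<subseteq> J" "card S = Suc N" "finite S" using S assms(2) finite_subset by (auto simp: Ss_def)
    have "card (A S) \<le> (card S * (card T * q) + 1) ^ card I"
      unfolding A_def using SJ g T by (intro card_grid_points_le assms) auto
    also have "\<dots> \<le> (Q * t) ^ N"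
      unfolding N_def[symmetric] T SJ Q_def by (intro power_mono) (auto simp: algebra_simps t_def)
    finally have cA: "card (A S) \<le> (Q * t) ^ N" .
    have finA: "finite (A S)" unfolding A_def
      by (rule finite_subset[of _ "S \<rightarrow>\<^sub>E T"]) (auto intro: finite_PiE SJ T)
    have finP: "finite ((J - S) \<rightarrow>\<^sub>E T)" using assms(2) T by (auto intro: finite_PiE)
    have "card (bad S) \<le> card (A S \<times> ((J - S) \<rightarrow>\<^sub>E T))"
    proof (rule card_inj_on_le[where f = "\<lambda>e. (restrict e S, restrict e (J - S))"])
      show "inj_on (\<lambda>e. (restrict e S, restrict e (J - S))) (bad S)"
      proof (rule inj_onI)
        fix d e assume de: "d \<in> bad S" "e \<in> bad S"
          "(restrict d S, restrict d (J - S)) = (restrict e S, restrict e (J - S))"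
        have "d j = e j" if "j \<in> J" for j
        proof (cases "j \<in> S")
          case True
          then show ?thesis using de(3) by (metis Pair_inject restrict_apply')
        next
          case False
          then have "j \<in> J - S" using that by auto
          then show ?thesis using de(3) by (metis Pair_inject restrict_apply')
        qed
        then show "d = e" using de by (intro PiE_ext[of d J "\<lambda>_. T" e]) (auto simp: bad_def)
      qed
      show "(\<lambda>e. (restrict e S, restrict e (J - S))) ` bad S \<subseteq> A S \<times> ((J - S) \<rightarrow>\<^sub>E T)"
        by (auto simp: bad_def)
      show "finite (A S \<times> ((J - S) \<rightarrow>\<^sub>E T))" using finA finP by simp
    qed
    also have "\<dots> = card (A S) * t ^ (m - Suc N)"
      using assms(2) SJ T by (simp add: card_PiE card_cartesian_product card_Diff_subset m_def)
    also have "\<dots> \<le> (Q * t) ^ N * t ^ (m - Suc N)" using cA by simp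
    finally show ?thesis .
  qed
  have "\<exists>e \<in> J \<rightarrow>\<^sub>E T. e \<notin> (\<Union>S\<in>Ss. bad S)"
  proof (cases "Suc N \<le> m")
    \<comment> \<open>Fewer than \<open>N + 1\<close> indices: nothing can be spoilt, and any grid
      vector will do.\<close>
    case False
    then have "Ss = {}" using assms(2) by (auto simp: Ss_def m_def dest: card_mono)
    moreover have "card (J \<rightarrow>\<^sub>E T) \<noteq> 0"
      using assms(2) T by (simp add: card_PiE t_def)
    then have "J \<rightarrow>\<^sub>E T \<noteq> {}" by force
    ultimately show ?thesis by auto
  next
    case True
    have "card (\<Union>S\<in>Ss. bad S) \<le> (\<Sum>S\<in>Ss. card (bad S))" by (rule card_UN_le[OF finSs])
    also have "\<dots> \<le> (\<Sum>S\<in>Ss. (Q * t) ^ N * t ^ (m - Suc N))" by (intro sum_mono cbad)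
    also have "\<dots> = card Ss * ((Q * t) ^ N * t ^ (m - Suc N))" by simp
    also have "\<dots> \<le> 2 ^ m * ((Q * t) ^ N * t ^ (m - Suc N))" using cSs by (rule mult_right_mono) simp
    also have "\<dots> = (2 ^ m * Q ^ N) * t ^ (m - 1)"
      using True by (simp add: power_mult_distrib flip: power_add)
    also have "\<dots> < t * t ^ (m - 1)" by (intro mult_strict_right_mono) (auto simp: t_def)
    also have "\<dots> = t ^ m" using True by (simp add: power_eq_if)
    also have "\<dots> = card (J \<rightarrow>\<^sub>E T)" using assms(2) T by (simp add: card_PiE m_def)
    finally have lt: "card (\<Union>S\<in>Ss. bad S) < card (J \<rightarrow>\<^sub>E T)" .
    have "finite (\<Union>S\<in>Ss. bad S)"
      by (rule finite_subset[of _ "J \<rightarrow>\<^sub>E T"]) (auto simp: bad_def finite_PiE assms(2) T(1))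
    then have "\<not> J \<rightarrow>\<^sub>E T \<subseteq> (\<Union>S\<in>Ss. bad S)"
      using lt card_mono[of "\<Union>S\<in>Ss. bad S" "J \<rightarrow>\<^sub>E T"] by linarith
    then show ?thesis by blast
  qed
  then obtain e where e: "e \<in> J \<rightarrow>\<^sub>E T" "\<And>S. S \<in> Ss \<Longrightarrow> e \<notin> bad S" by auto
  have "card S \<le> card I" if "S \<subseteq> J" "\<forall>j\<in>S. g j x = e j" for S x
  proof (rule ccontr)
    assume "\<not> card S \<le> card I"
    then have "Suc N \<le> card S" by (simp add: N_def)
    then obtain S' where S': "S' \<subseteq> S" "card S' = Suc N" using obtain_subset_with_card_n by metis
    then have "restrict e S' \<in> A S'" using e(1) that unfolding A_def by force
    then show False using e(1) e(2)[of S'] S' that by (auto simp: bad_def Ss_def)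
  qed
  moreover have "0 < e j \<and> e j < \<delta>" if "j \<in> J" for j using e(1) T(3) that by fastforce
  ultimately show ?thesis by blast
qed

section \<open>Critical points in the cells of a sign condition\<close>

definition supported_on :: "'i set \<Rightarrow> ('i \<Rightarrow> real) set" where
  "supported_on I = {x. \<forall>i. i \<notin> I \<longrightarrow> x i = 0}"

text \<open>Extension by zero makes the box a product over all indices, with a singleton outside
  \<open>I\<close>, so Tychonoff's theorem applies in the topology of the function type.\<close>

lemma compact_supported_box: "compact {x \<in> supported_on I. \<forall>i\<in>I. \<bar>x i\<bar> \<le> R}"
proof -
  have "{x \<in> supported_on I. \<forall>i\<in>I. \<bar>x i\<bar> \<le> R} = PiE UNIV (\<lambda>i. if i \<in> I then {-R..R} else {0})"
    by (fastforce simp: supported_on_def PiE_iff abs_le_iff split: if_splits)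
  moreover have "compactin (product_topology (\<lambda>i. euclidean) UNIV) (PiE UNIV (\<lambda>i. if i \<in> I then {-R..R} else {0::real}))"
    by (subst compactin_PiE) auto
  ultimately show ?thesis by (simp add: euclidean_product_topology)
qed

text \<open>
  The maximality hypothesis says that the solutions of \<open>f\<^sub>j\<^sup>2 = e\<^sub>j\<close>, \<open>j \<in> S\<close>, in the cell stay away
  from the other level sets; so a minimiser of the penalised function cannot leave the cell.
\<close>
lemma penalised_critical_point:
  fixes f :: "'j \<Rightarrow> ('i \<Rightarrow> real) \<Rightarrow> real" and e s :: "'j \<Rightarrow> real"
  assumes "finite I" "finite J" "S \<subseteq> J"
    and f: "\<And>j. j \<in> J \<Longrightarrow> polyfun I d (f j)"
    and z: "z \<in> supported_on I" "\<And>j. j \<in> J \<Longrightarrow> 0 \<le> s j * f j z" "\<And>j. j \<in> J \<Longrightarrow> e j \<le> (f j z)\<^sup>2"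
       "\<And>j. j \<in> S \<Longrightarrow> (f j z)\<^sup>2 = e j"
    and s: "\<And>j. j \<in> J \<Longrightarrow> s j \<noteq> 0" and e: "\<And>j. j \<in> J \<Longrightarrow> 0 < e j"
    and maximal: "\<And>x j. \<lbrakk>x \<in> supported_on I; \<And>j. j \<in> J \<Longrightarrow> 0 \<le> s j * f j x;
        \<And>j. j \<in> J \<Longrightarrow> e j \<le> (f j x)\<^sup>2; \<And>j. j \<in> S \<Longrightarrow> (f j x)\<^sup>2 = e j; j \<in> J - S\<rbrakk> \<Longrightarrow> (f j x)\<^sup>2 \<noteq> e j"
  shows "\<exists>K0. \<forall>K\<ge>K0. \<exists>y\<in>supported_on I. (\<forall>j\<in>J. 0 < s j * f j y) \<and>
     (\<forall>i\<in>I. \<forall>D. ((\<lambda>t. \<Sum>j\<in>S. ((f j (y(i := t)))\<^sup>2 - e j)\<^sup>2) has_real_derivative D) (at (y i))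
        \<longrightarrow> 10 * y i ^ 9 + K * D = 0)"
proof -
  define \<rho> where "\<rho> = (\<lambda>x. \<Sum>j\<in>S. ((f j x)\<^sup>2 - e j)\<^sup>2)"
  \<comment> \<open>The exponent 10 is the least even one above 8, the degree of the penalty when
    the \<open>f j\<close> are quadratic. Evenness makes \<open>h\<close> nonnegative and large far
    from the origin.\<close>
  define h where "h = (\<lambda>x::'i\<Rightarrow>real. \<Sum>i\<in>I. x i ^ 10)"
  \<comment> \<open>The summand 2 makes a coordinate of absolute value at least \<open>R\<close>
    exceed 1, so that its tenth power dominates it and \<open>h\<close> exceeds \<open>h z\<close>
    there.\<close>
  define R where "R = h z + 2"
  define Q where "Q = {x \<in> supported_on I. \<forall>i\<in>I. \<bar>x i\<bar> \<le> R} \<inter>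
    ((\<Inter>j\<in>J. {x. 0 \<le> s j * f j x}) \<inter> (\<Inter>j\<in>J - S. {x. e j \<le> (f j x)\<^sup>2}))"
  \<comment> \<open>The walls of \<open>Q\<close> that a minimiser must avoid. The sides of the box
    are left to \<open>hbig\<close>.\<close>
  define Bd where "Bd = Q \<inter> ((\<Union>j\<in>J. {x. f j x = 0}) \<union> (\<Union>j\<in>J - S. {x. (f j x)\<^sup>2 = e j}))"
  have finS: "finite S" using assms finite_subset by metis
  have h0: "h x \<ge> 0" for x unfolding h_def by (intro sum_nonneg) simp
  have \<rho>0: "\<rho> x \<ge> 0" for x unfolding \<rho>_def by (intro sum_nonneg) simp
  have contf: "continuous_on A (f j)" if "j \<in> J" for A j using continuous_on_polyfun[OF f[OF that]] .
  have cont\<rho>: "continuous_on A \<rho>" for A unfolding \<rho>_def using assms(3)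
    by (intro continuous_intros contf) auto
  have conth: "continuous_on A h" for A unfolding h_def
    by (intro continuous_intros continuous_on_subset[OF continuous_on_product_coordinates]) simp
  have hbig: "\<bar>x i\<bar> < R" if "i \<in> I" "h x \<le> h z" for x i
  proof (rule ccontr)
    assume "\<not> \<bar>x i\<bar> < R"
    then have a: "\<bar>x i\<bar> \<ge> h z + 2" by (simp add: R_def)
    then have "\<bar>x i\<bar> ^ 1 \<le> \<bar>x i\<bar> ^ 10" using h0[of z] by (intro power_increasing) auto
    also have "\<dots> = x i ^ 10" by simp
    also have "\<dots> \<le> h x" unfolding h_def using assms(1) that
      by (intro member_le_sum[of i I "\<lambda>i. x i ^ 10"]) auto
    finally show False using a that by simp
  qed
  have cQ: "compact Q" unfolding Q_def
    by (intro compact_Int_closed compact_supported_box closed_Int closed_INT ballI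
        closed_Collect_le continuous_intros contf) auto
  have cBd: "compact Bd" unfolding Bd_def
    by (intro compact_Int_closed cQ closed_Un closed_UN ballI closed_Collect_eq continuous_intros contf)
       (use assms in auto)
  have zQ: "z \<in> Q" using z hbig[of _ z] by (auto simp: Q_def less_imp_le)
  have \<rho>z: "\<rho> z = 0" using z by (simp add: \<rho>_def)
  \<comment> \<open>A zero of the penalty in \<open>Q\<close> meets all levels in \<open>S\<close>.
    By \<open>maximal\<close> it meets no other level, and since \<open>e j > 0\<close> no
    \<open>f j\<close> vanishes there, so it is not on a wall.\<close>
  have posBd: "\<rho> x > 0" if x: "x \<in> Bd" for x
  proof (rule ccontr)
    assume "\<not> \<rho> x > 0"
    then have "\<rho> x = 0" using \<rho>0[of x] by simp
    then have S: "(f j x)\<^sup>2 = e j" if "j \<in> S" for j using finS that by (simp add: \<rho>_def sum_nonneg_eq_0_iff)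
    have Q: "x \<in> supported_on I" "0 \<le> s j * f j x" "e j \<le> (f j x)\<^sup>2" if "j \<in> J" for j
      using x S that by (cases "j \<in> S"; force simp: Bd_def Q_def)+
    have "x \<in> supported_on I" using x by (auto simp: Bd_def Q_def)
    then have "(f j x)\<^sup>2 \<noteq> e j" if "j \<in> J - S" for j using maximal[of x j] Q S that by blast
    moreover have "f j x \<noteq> 0" if "j \<in> J" for j using Q(3)[OF that] e[OF that] by auto
    ultimately show False using x by (auto simp: Bd_def)
  qed
  obtain \<eta> where \<eta>: "\<eta> > 0" "\<And>x. x \<in> Bd \<Longrightarrow> \<eta> \<le> \<rho> x"
  proof (cases "Bd = {}")
    case True
    then show ?thesis using that[of 1] by auto
  next
    case False
    then obtain x where "x \<in> Bd" "\<forall>y\<in>Bd. \<rho> x \<le> \<rho> y"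
      using continuous_attains_inf[OF cBd False cont\<rho>] by blast
    then show ?thesis using that[of "\<rho> x"] posBd by auto
  qed
  show ?thesis
  \<comment> \<open>From this threshold on, \<open>K * \<eta> > h z\<close>: every wall point costs
    more than the feasible point \<open>z\<close>, whose penalty is 0.\<close>
  proof (intro exI[of _ "h z / \<eta> + 1"] allI impI)
    fix K assume K: "h z / \<eta> + 1 \<le> K"
    have Kpos: "K > 0" "h z < K * \<eta>"
    proof -
      have "h z / \<eta> \<ge> 0" using h0[of z] \<eta> by simp
      then show "K > 0" using K by linarith
      have "h z / \<eta> < K" using K by linarith
      then show "h z < K * \<eta>" using \<eta> by (simp add: pos_divide_less_eq)
    qed
    have "continuous_on Q (\<lambda>x. h x + K * \<rho> x)" by (intro continuous_intros conth cont\<rho>)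
    then obtain y where y: "y \<in> Q" "\<forall>x\<in>Q. h y + K * \<rho> y \<le> h x + K * \<rho> x"
      using continuous_attains_inf[OF cQ] zQ by blast
    have le: "h y + K * \<rho> y \<le> h z" using y zQ \<rho>z by fastforce
    have hy: "h y \<le> h z"
      using le mult_nonneg_nonneg[of K "\<rho> y"] Kpos \<rho>0[of y] by linarith
    have yBd: "y \<notin> Bd"
    proof
      assume "y \<in> Bd"
      then have "K * \<eta> \<le> K * \<rho> y" using \<eta> Kpos by (intro mult_left_mono) auto
      then show False using le Kpos h0[of y] by linarith
    qed
    have y1: "0 < s j * f j y" if "j \<in> J" for j
    proof -
      have "0 \<le> s j * f j y" "f j y \<noteq> 0" using y yBd that by (auto simp: Bd_def Q_def)
      then show ?thesis using s[OF that] by (simp add: less_le)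
    qed
    have y2: "e j < (f j y)\<^sup>2" if "j \<in> J - S" for j
    proof -
      have "e j \<le> (f j y)\<^sup>2" "(f j y)\<^sup>2 \<noteq> e j" using y yBd that by (auto simp: Bd_def Q_def)
      then show ?thesis by simp
    qed
    have ysup: "y \<in> supported_on I" using y by (auto simp: Q_def)
    have "10 * y i ^ 9 + K * D = 0"
      if i: "i \<in> I" and D: "((\<lambda>t. \<rho> (y(i := t))) has_real_derivative D) (at (y i))" for i D
    proof -
      have contj: "isCont (\<lambda>t. f j (y(i := t))) (y i)" if "j \<in> J" for j
      proof -
        obtain g where "\<forall>x. ((\<lambda>t. f j (x(i := t))) has_real_derivative g x) (at (x i))"
          using polyfun_partial_derivative[OF f[OF \<open>j \<in> J\<close>]] by blast
        then show ?thesis using DERIV_isCont by blast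
      qed
      have lim: "((\<lambda>t. f j (y(i := t))) \<longlongrightarrow> f j y) (nhds (y i))" if "j \<in> J" for j
        using contj[OF that] by (simp add: continuous_at tendsto_nhds_iff)
      have ev1: "\<forall>\<^sub>F t in nhds (y i). 0 < s j * f j (y(i := t))" if "j \<in> J" for j
        using order_tendstoD(1)[OF tendsto_mult[OF tendsto_const lim[OF that], of "s j"]] y1[OF that]
        by simp
      have ev2: "\<forall>\<^sub>F t in nhds (y i). e j < (f j (y(i := t)))\<^sup>2" if "j \<in> J - S" for j
        using order_tendstoD(1)[OF tendsto_power[OF lim, of j 2]] y2[OF that] that by simp
      have ev3: "\<forall>\<^sub>F t in nhds (y i). \<bar>t\<bar> < R"
      proof -
        have "((\<lambda>t. \<bar>t\<bar>) \<longlongrightarrow> \<bar>y i\<bar>) (nhds (y i))" by (intro tendsto_rabs filterlim_ident)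
        then show ?thesis using order_tendstoD(2) hbig[OF i hy] by blast
      qed
      have "\<forall>\<^sub>F t in nhds (y i). (\<forall>j\<in>J. 0 < s j * f j (y(i := t))) \<and>
          (\<forall>j\<in>J-S. e j < (f j (y(i := t)))\<^sup>2) \<and> \<bar>t\<bar> < R"
        using ev1 ev2 ev3 assms(2) by (intro eventually_conj eventually_ball_finite) auto
      then obtain r where r: "r > 0" "\<And>t. dist t (y i) < r \<Longrightarrow> (\<forall>j\<in>J. 0 < s j * f j (y(i := t))) \<and>
          (\<forall>j\<in>J-S. e j < (f j (y(i := t)))\<^sup>2) \<and> \<bar>t\<bar> < R"
        unfolding eventually_nhds_metric by blast
      have inQ: "y(i := t) \<in> Q" if "\<bar>y i - t\<bar> < r" for t
      proof -
        have "dist t (y i) < r" using that by (simp add: dist_real_def abs_minus_commute)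
        note r(2)[OF this]
        moreover have "y(i := t) \<in> supported_on I" using ysup i by (auto simp: supported_on_def)
        ultimately show ?thesis using y(1) by (auto simp: Q_def less_imp_le)
      qed
      have hupd: "h (y(i := t)) = t ^ 10 + (\<Sum>k\<in>I-{i}. y k ^ 10)" for t
      proof -
        have "h (y(i := t)) = t ^ 10 + (\<Sum>k\<in>I-{i}. (y(i := t)) k ^ 10)"
          unfolding h_def using assms(1) i by (simp add: sum.remove)
        also have "(\<Sum>k\<in>I-{i}. (y(i := t)) k ^ 10) = (\<Sum>k\<in>I-{i}. y k ^ 10)"
          by (intro sum.cong) auto
        finally show ?thesis .
      qed
      have dh: "((\<lambda>t. h (y(i := t))) has_real_derivative 10 * y i ^ 9) (at (y i))"
        unfolding hupd by (auto intro!: derivative_eq_intros)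
      have "((\<lambda>t. h (y(i := t)) + K * \<rho> (y(i := t))) has_real_derivative 10 * y i ^ 9 + K * D) (at (y i))"
        by (intro DERIV_add dh DERIV_cmult D)
      then show ?thesis
        by (rule DERIV_local_min[OF _ r(1)]) (use y(2) inQ in simp)
    qed
    then show "\<exists>y\<in>supported_on I. (\<forall>j\<in>J. 0 < s j * f j y) \<and>
     (\<forall>i\<in>I. \<forall>D. ((\<lambda>t. \<Sum>j\<in>S. ((f j (y(i := t)))\<^sup>2 - e j)\<^sup>2) has_real_derivative D) (at (y i))
        \<longrightarrow> 10 * y i ^ 9 + K * D = 0)"
      using ysup y1 unfolding \<rho>_def by blast
  qed
qed

lemma finite_pos_lower_bound:
  fixes A :: "real set"
  assumes "finite A" "\<And>a. a \<in> A \<Longrightarrow> 0 < a"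
  shows "\<exists>\<delta>>0. \<forall>a\<in>A. \<delta> < a"
proof (cases "A = {}")
  case True
  then show ?thesis by (intro exI[of _ 1]) auto
next
  case False
  then have "Min A \<in> A" using assms by auto
  then have "0 < Min A" using assms by auto
  moreover have "Min A / 2 < a" if "a \<in> A" for a using Min_le[OF assms(1) that] \<open>0 < Min A\<close> by linarith
  ultimately show ?thesis by (intro exI[of _ "Min A / 2"]) auto
qed

text \<open>Each cell \<open>P\<close> is assigned a maximal set \<open>M P\<close> of levels met at
  once in it; genericity bounds its size by \<open>card I\<close>. All cells with the same
  \<open>M P\<close> yield critical points of one and the same function, which
  \<open>card_power_system_le\<close> counts.\<close>

lemma card_sign_cells_le:
  fixes f :: "'j \<Rightarrow> ('i \<Rightarrow> real) \<Rightarrow> real"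
  assumes "finite I" "finite J" and f: "\<And>j. j \<in> J \<Longrightarrow> polyfun I 2 (f j)"
  shows "card {P. P \<subseteq> J \<and> (\<exists>x\<in>supported_on I. (\<forall>j\<in>J. f j x \<noteq> 0) \<and> P = {j \<in> J. 0 < f j x})}
    \<le> 9 ^ card I * card {S. S \<subseteq> J \<and> card S \<le> card I}"
proof -
  define Cells where "Cells = {P. P \<subseteq> J \<and> (\<exists>x\<in>supported_on I. (\<forall>j\<in>J. f j x \<noteq> 0) \<and> P = {j \<in> J. 0 < f j x})}"
  have finC: "finite Cells" using assms(2) by (auto simp: Cells_def)
  define s where "s = (\<lambda>(P::'j set) j. if j \<in> P then 1 else -1 :: real)"
  have "\<forall>P\<in>Cells. \<exists>x\<in>supported_on I. (\<forall>j\<in>J. f j x \<noteq> 0) \<and> P = {j \<in> J. 0 < f j x}"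
    by (auto simp: Cells_def)
  then obtain X where X: "\<And>P. P \<in> Cells \<Longrightarrow> X P \<in> supported_on I"
    "\<And>P j. P \<in> Cells \<Longrightarrow> j \<in> J \<Longrightarrow> f j (X P) \<noteq> 0"
    "\<And>P. P \<in> Cells \<Longrightarrow> P = {j \<in> J. 0 < f j (X P)}" by metis
  \<comment> \<open>Levels below \<open>\<delta>\<close> are exceeded at every sample point
    \<open>X P\<close>, so no cell is lost when the walls \<open>f j = 0\<close> are replaced by the
    level sets.\<close>
  have "\<exists>\<delta>>0. \<forall>a\<in>(\<lambda>(P, j). (f j (X P))\<^sup>2) ` (Cells \<times> J). \<delta> < a"
    by (rule finite_pos_lower_bound) (use finC assms X(2) in auto)
  then obtain \<delta> where \<delta>: "\<delta> > 0" "\<And>P j. P \<in> Cells \<Longrightarrow> j \<in> J \<Longrightarrow> \<delta> < (f j (X P))\<^sup>2" by auto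
  have "polyfun I (2 * 2) (\<lambda>x. (f j x)\<^sup>2)" if "j \<in> J" for j by (intro polyfun_power f that)
  then have "\<exists>e. (\<forall>j\<in>J. 0 < e j \<and> e j < \<delta>) \<and>
      (\<forall>S\<subseteq>J. \<forall>x. (\<forall>j\<in>S. (f j x)\<^sup>2 = e j) \<longrightarrow> card S \<le> card I)"
    by (rule ex_generic_levels[OF assms(1,2) \<delta>(1)])
  then obtain e where e0: "\<forall>j\<in>J. 0 < e j \<and> e j < \<delta>"
    "\<forall>S\<subseteq>J. \<forall>x. (\<forall>j\<in>S. (f j x)\<^sup>2 = e j) \<longrightarrow> card S \<le> card I" by (elim exE conjE)
  have e: "j \<in> J \<Longrightarrow> 0 < e j" "j \<in> J \<Longrightarrow> e j < \<delta>"
    "S \<subseteq> J \<Longrightarrow> (\<And>j. j \<in> S \<Longrightarrow> (f j x)\<^sup>2 = e j) \<Longrightarrow> card S \<le> card I" for j S x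
    using e0(1) e0(2)[rule_format, of S x] by simp_all
  define good where "good = (\<lambda>P S x. x \<in> supported_on I \<and> (\<forall>j\<in>J. 0 \<le> s P j * f j x) \<and>
     (\<forall>j\<in>J. e j \<le> (f j x)\<^sup>2) \<and> (\<forall>j\<in>S. (f j x)\<^sup>2 = e j))"
  \<comment> \<open>The empty set qualifies, witnessed by the sample point, so a maximal set exists
    among the finitely many candidates.\<close>
  have "\<exists>S. S \<subseteq> J \<and> (\<exists>x. good P S x) \<and> (\<forall>S'. S \<subseteq> S' \<longrightarrow> S' \<subseteq> J \<longrightarrow> (\<exists>x. good P S' x) \<longrightarrow> S' = S)"
    if P: "P \<in> Cells" for P
  proof -
    have "0 < s P j * f j (X P)" if "j \<in> J" for j
      using X(2)[OF P that] X(3)[OF P] that unfolding s_def by (cases "0 < f j (X P)") auto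
    moreover have "e j \<le> (f j (X P))\<^sup>2" if "j \<in> J" for j using e(2)[OF that] \<delta>(2)[OF P that] by linarith
    ultimately have "good P {} (X P)" using X(1)[OF P] by (auto simp: good_def less_imp_le)
    moreover define F where "F = {S. S \<subseteq> J \<and> (\<exists>x. good P S x)}"
    ultimately have "F \<noteq> {}" "finite F" using assms(2) by auto
    from finite_has_maximal[OF this(2,1)] obtain S where S: "S \<in> F" "\<forall>S'\<in>F. S \<subseteq> S' \<longrightarrow> S = S'"
      by (elim bexE)
    show ?thesis
    proof (intro exI[of _ S] conjI allI impI)
      show "S \<subseteq> J" "\<exists>x. good P S x" using S(1) unfolding F_def by simp_all
      fix S' assume "S \<subseteq> S'" "S' \<subseteq> J" "\<exists>x. good P S' x"
      then have "S' \<in> F" unfolding F_def by simp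
      then show "S' = S" using S(2) \<open>S \<subseteq> S'\<close> by blast
    qed
  qed
  then obtain M where M: "\<And>P. P \<in> Cells \<Longrightarrow> M P \<subseteq> J" "\<And>P. P \<in> Cells \<Longrightarrow> \<exists>x. good P (M P) x"
    "\<And>P S'. P \<in> Cells \<Longrightarrow> M P \<subseteq> S' \<Longrightarrow> S' \<subseteq> J \<Longrightarrow> (\<exists>x. good P S' x) \<Longrightarrow> S' = M P" by metis
  define Sub where "Sub = {S. S \<subseteq> J \<and> card S \<le> card I}"
  have finSub: "finite Sub" using assms(2) by (auto simp: Sub_def)
  have MSub: "M P \<in> Sub" if P: "P \<in> Cells" for P
  proof -
    obtain x where "good P (M P) x" using M(2)[OF P] ..
    then have "card (M P) \<le> card I" using e(3)[OF M(1)[OF P], of x] by (simp add: good_def)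
    then show ?thesis using M(1)[OF P] by (simp add: Sub_def)
  qed
  have fibre: "card {P \<in> Cells. M P = S} \<le> 9 ^ card I" if S: "S \<in> Sub" for S
  proof -
    define CS where "CS = {P \<in> Cells. M P = S}"
    have finCS: "finite CS" using finC by (auto simp: CS_def)
    define \<rho> where "\<rho> = (\<lambda>x. \<Sum>j\<in>S. ((f j x)\<^sup>2 - e j)\<^sup>2)"
    have "\<exists>K0. \<forall>K\<ge>K0. \<exists>y\<in>supported_on I. (\<forall>j\<in>J. 0 < s P j * f j y) \<and>
     (\<forall>i\<in>I. \<forall>D. ((\<lambda>t. \<rho> (y(i := t))) has_real_derivative D) (at (y i))
        \<longrightarrow> 10 * y i ^ 9 + K * D = 0)" if P: "P \<in> CS" for P
    proof -
      have PC: "P \<in> Cells" "M P = S" using P by (auto simp: CS_def)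
      then obtain z where z: "good P S z" using M(2) by metis
      show ?thesis unfolding \<rho>_def
      proof (rule penalised_critical_point[where z = z, OF assms(1,2)])
        show "S \<subseteq> J" using S by (auto simp: Sub_def)
        fix x j assume x: "x \<in> supported_on I" "\<And>j. j \<in> J \<Longrightarrow> 0 \<le> s P j * f j x"
          "\<And>j. j \<in> J \<Longrightarrow> e j \<le> (f j x)\<^sup>2" "\<And>j. j \<in> S \<Longrightarrow> (f j x)\<^sup>2 = e j" "j \<in> J - S"
        show "(f j x)\<^sup>2 \<noteq> e j"
        proof
          assume "(f j x)\<^sup>2 = e j"
          then have "good P (insert j S) x" using x by (auto simp: good_def)
          then have "insert j S = S" using M(3)[OF PC(1), of "insert j S"] PC(2) S x(5) by (auto simp: Sub_def)
          then show False using x(5) by auto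
        qed
      qed (use z f e in \<open>auto simp: good_def s_def\<close>)
    qed
    then obtain K0 where K0: "\<And>P K. P \<in> CS \<Longrightarrow> K0 P \<le> K \<Longrightarrow> \<exists>y\<in>supported_on I. (\<forall>j\<in>J. 0 < s P j * f j y) \<and>
     (\<forall>i\<in>I. \<forall>D. ((\<lambda>t. \<rho> (y(i := t))) has_real_derivative D) (at (y i))
        \<longrightarrow> 10 * y i ^ 9 + K * D = 0)" by metis
    \<comment> \<open>One \<open>K\<close> above all thresholds of the fibre, so that its critical
      points solve a single system.\<close>
    define K where "K = (\<Sum>P\<in>CS. \<bar>K0 P\<bar>)"
    have "K0 P \<le> K" if "P \<in> CS" for P
      using member_le_sum[OF that, of "\<lambda>P. \<bar>K0 P\<bar>"] finCS unfolding K_def by simp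
    then have "\<forall>P\<in>CS. \<exists>y\<in>supported_on I. (\<forall>j\<in>J. 0 < s P j * f j y) \<and>
     (\<forall>i\<in>I. \<forall>D. ((\<lambda>t. \<rho> (y(i := t))) has_real_derivative D) (at (y i))
        \<longrightarrow> 10 * y i ^ 9 + K * D = 0)" using K0 by blast
    then obtain Y where Y: "\<And>P. P \<in> CS \<Longrightarrow> Y P \<in> supported_on I"
      "\<And>P j. P \<in> CS \<Longrightarrow> j \<in> J \<Longrightarrow> 0 < s P j * f j (Y P)"
      "\<And>P i D. P \<in> CS \<Longrightarrow> i \<in> I \<Longrightarrow> ((\<lambda>t. \<rho> ((Y P)(i := t))) has_real_derivative D) (at (Y P i)) \<Longrightarrow>
         10 * Y P i ^ 9 + K * D = 0" by metis
    have "polyfun I (2 * (2 * 2)) \<rho>" unfolding \<rho>_def using S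
      by (intro polyfun_sum polyfun_power polyfun_diff polyfun_const f) (auto simp: Sub_def)
    then have p8: "polyfun I 8 \<rho>" by simp
    have "\<forall>i. \<exists>g. polyfun I 8 g \<and> (\<forall>x. ((\<lambda>t. \<rho> (x(i := t))) has_real_derivative g x) (at (x i)))"
      using polyfun_partial_derivative[OF p8] by blast
    then obtain D where D: "\<And>i. polyfun I 8 (D i)"
      "\<And>i x. ((\<lambda>t. \<rho> (x(i := t))) has_real_derivative D i x) (at (x i))" by metis
    \<comment> \<open>The signs at \<open>Y P\<close> are strict and equal to those of the cell, so
      the point determines \<open>P\<close>.\<close>
    have inj: "inj_on Y CS"
    proof (rule inj_onI)
      fix P P' assume PP: "P \<in> CS" "P' \<in> CS" "Y P = Y P'"
      have "j \<in> P \<longleftrightarrow> j \<in> P'" if "j \<in> J" for j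
        using Y(2)[OF PP(1) that] Y(2)[OF PP(2) that] PP(3) by (auto simp: s_def split: if_splits)
      moreover have "P \<subseteq> J" "P' \<subseteq> J" using PP by (auto simp: CS_def Cells_def)
      ultimately show "P = P'" by blast
    qed
    have "card (Y ` CS) \<le> 9 ^ card I"
    \<comment> \<open>The vanishing gradient reads \<open>x_i^9 = - K/10 * D_i\<close> with
      \<open>D_i\<close> of degree at most 8, which is the required shape for
      \<open>r = 9\<close>.\<close>
    proof (rule card_power_system_le[where g = "\<lambda>i x. - K / 10 * D i x"])
      show "polyfun I (9 - 1) (\<lambda>x. - K / 10 * D i x)" for i
        using polyfun_scale[OF D(1), of "- K / 10"] by simp
      fix z i assume "z \<in> Y ` CS" "i \<in> I"
      then show "z i ^ 9 = - K / 10 * D i z" using Y(3)[OF _ _ D(2)] by fastforce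
    next
      fix z i assume "z \<in> Y ` CS" "i \<notin> I"
      then show "z i = 0" using Y(1) by (auto simp: supported_on_def)
    qed (use assms finCS in auto)
    then have "card CS \<le> 9 ^ card I" unfolding card_image[OF inj] .
    then show ?thesis unfolding CS_def .
  qed
  have "Cells = (\<Union>S\<in>Sub. {P \<in> Cells. M P = S})" using MSub by auto
  then have "card Cells \<le> (\<Sum>S\<in>Sub. card {P \<in> Cells. M P = S})" using card_UN_le[OF finSub] by metis
  also have "\<dots> \<le> (\<Sum>S\<in>Sub. 9 ^ card I)" by (intro sum_mono fibre)
  finally show ?thesis unfolding Cells_def Sub_def by (simp add: mult.commute)
qed

lemma finite_sgn_patterns:
  fixes f :: "'j \<Rightarrow> 'a \<Rightarrow> real"
  assumes "finite J" shows "finite ((\<lambda>x. \<lambda>j\<in>J. sgn (f j x)) ` X)"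
proof (rule finite_subset)
  show "(\<lambda>x. \<lambda>j\<in>J. sgn (f j x)) ` X \<subseteq> J \<rightarrow>\<^sub>E {-1, 0, 1}"
    by (auto simp: sgn_if split: if_splits)
  show "finite (J \<rightarrow>\<^sub>E {-1, 0, 1 :: real})" by (intro finite_PiE assms) simp
qed

text \<open>Signs in \<open>{-1, 0, 1}\<close> of \<open>f j\<close> are read off the nonzero signs of \<open>f j + \<delta>\<close> and \<open>f j - \<delta>\<close>.\<close>
lemma card_sgn_patterns_le:
  fixes f :: "'j \<Rightarrow> ('i \<Rightarrow> real) \<Rightarrow> real"
  assumes "finite I" "finite J" and f: "\<And>j. j \<in> J \<Longrightarrow> polyfun I 2 (f j)"
  shows "card ((\<lambda>x. \<lambda>j\<in>J. sgn (f j x)) ` supported_on I)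
    \<le> 9 ^ card I * card {S. S \<subseteq> J \<times> (UNIV :: bool set) \<and> card S \<le> card I}"
proof -
  let ?pat = "\<lambda>x. \<lambda>j\<in>J. sgn (f j x)"
  define Pats where "Pats = ?pat ` supported_on I"
  have finP: "finite Pats" unfolding Pats_def by (rule finite_sgn_patterns[OF assms(2)])
  have "\<forall>\<tau>\<in>Pats. \<exists>x\<in>supported_on I. \<tau> = ?pat x" by (auto simp: Pats_def)
  then obtain X where X: "\<And>\<tau>. \<tau> \<in> Pats \<Longrightarrow> X \<tau> \<in> supported_on I" "\<And>\<tau>. \<tau> \<in> Pats \<Longrightarrow> \<tau> = ?pat (X \<tau>)"
    by metis
  have "\<exists>\<delta>>0. \<forall>a\<in>(\<lambda>(\<tau>, j). \<bar>f j (X \<tau>)\<bar>) ` (Pats \<times> J) - {0}. \<delta> < a"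
    by (rule finite_pos_lower_bound) (use finP assms in auto)
  then obtain \<delta> where \<delta>0: "\<delta> > 0"
    "\<And>a. a \<in> (\<lambda>(\<tau>, j). \<bar>f j (X \<tau>)\<bar>) ` (Pats \<times> J) - {0} \<Longrightarrow> \<delta> < a" by blast
  have \<delta>: "\<delta> > 0" "\<delta> < \<bar>f j (X \<tau>)\<bar>" if "\<tau> \<in> Pats" "j \<in> J" "f j (X \<tau>) \<noteq> 0" for \<tau> j
    using \<delta>0(1) \<delta>0(2)[of "\<bar>f j (X \<tau>)\<bar>"] that by force+
  define g where "g = (\<lambda>(j, b) x. f j x + (if b then \<delta> else - \<delta>))"
  let ?J = "J \<times> (UNIV :: bool set)"
  define P where "P = (\<lambda>\<tau>. {k \<in> ?J. 0 < g k (X \<tau>)})"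
  have gnz: "g k (X \<tau>) \<noteq> 0" if "\<tau> \<in> Pats" "k \<in> ?J" for \<tau> k
    using that \<delta>0(1) \<delta>(2)[OF that(1), of "fst k"]
    by (cases k; cases "f (fst k) (X \<tau>) = 0") (auto simp: g_def split: if_splits)
  have sg: "sgn (f j (X \<tau>)) = (if (j, False) \<in> P \<tau> then 1 else if (j, True) \<in> P \<tau> then 0 else -1)"
    if "\<tau> \<in> Pats" "j \<in> J" for \<tau> j
    using that \<delta>0(1) \<delta>(2)[OF that] by (auto simp: P_def g_def sgn_if)
  have inj: "inj_on P Pats"
  proof (rule inj_onI)
    fix \<tau> \<tau>' assume t: "\<tau> \<in> Pats" "\<tau>' \<in> Pats" "P \<tau> = P \<tau>'"
    have "?pat (X \<tau>) = ?pat (X \<tau>')" using sg t by (intro restrict_ext) auto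
    then show "\<tau> = \<tau>'" using X(2) t by metis
  qed
  have "card Pats = card (P ` Pats)" using card_image[OF inj] by simp
  also have "\<dots> \<le> card {A. A \<subseteq> ?J \<and> (\<exists>x\<in>supported_on I. (\<forall>k\<in>?J. g k x \<noteq> 0) \<and> A = {k \<in> ?J. 0 < g k x})}"
  proof (rule card_mono)
    show "finite {A. A \<subseteq> ?J \<and> (\<exists>x\<in>supported_on I. (\<forall>k\<in>?J. g k x \<noteq> 0) \<and> A = {k \<in> ?J. 0 < g k x})}"
      using assms(2) by auto
    show "P ` Pats \<subseteq> {A. A \<subseteq> ?J \<and> (\<exists>x\<in>supported_on I. (\<forall>k\<in>?J. g k x \<noteq> 0) \<and> A = {k \<in> ?J. 0 < g k x})}"
    proof
      fix A assume "A \<in> P ` Pats"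
      then obtain \<tau> where t: "\<tau> \<in> Pats" "A = P \<tau>" by auto
      have "A \<subseteq> ?J" using t by (auto simp: P_def)
      moreover have "\<forall>k\<in>?J. g k (X \<tau>) \<noteq> 0" using gnz t by blast
      ultimately show "A \<in> {A. A \<subseteq> ?J \<and> (\<exists>x\<in>supported_on I. (\<forall>k\<in>?J. g k x \<noteq> 0) \<and> A = {k \<in> ?J. 0 < g k x})}"
        using X(1)[OF t(1)] t(2) unfolding P_def by blast
    qed
  qed
  also have "\<dots> \<le> 9 ^ card I * card {S. S \<subseteq> ?J \<and> card S \<le> card I}"
  proof (rule card_sign_cells_le)
    fix k assume k: "k \<in> ?J"
    show "polyfun I 2 (g k)" using k f by (cases k) (auto simp: g_def intro!: polyfun_add polyfun_diff polyfun_const)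
  qed (use assms in auto)
  finally show ?thesis unfolding Pats_def .
qed

lemma sum_power_fact_le_exp:
  fixes x :: real assumes "x \<ge> 0" shows "(\<Sum>k\<le>n. x ^ k / fact k) \<le> exp x"
proof -
  have "(\<Sum>k\<le>n. x ^ k /\<^sub>R fact k) \<le> (\<Sum>k. x ^ k /\<^sub>R fact k)"
    using assms by (intro sum_le_suminf summable_exp_generic) auto
  then show ?thesis by (simp add: exp_def divide_inverse mult.commute)
qed

text \<open>Each binomial coefficient is at most \<open>(m/N)^k * N^k / k!\<close>. Because
  \<open>N \<le> m\<close>, the first factor is at most \<open>(m/N)^N\<close>, and the rest sums to
  at most \<open>exp N\<close>.\<close>

lemma card_small_subsets_le:
  assumes "finite J" "0 < N" "N \<le> card J"
  shows "real (card {S. S \<subseteq> J \<and> card S \<le> N}) \<le> (exp 1 * real (card J) / real N) ^ N"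
proof -
  define m where "m = card J"
  have "{S. S \<subseteq> J \<and> card S \<le> N} = (\<Union>k\<in>{..N}. {S. S \<subseteq> J \<and> card S = k})" by auto
  then have "card {S. S \<subseteq> J \<and> card S \<le> N} \<le> (\<Sum>k\<le>N. card {S. S \<subseteq> J \<and> card S = k})"
    using card_UN_le[of "{..N}"] by simp
  also have "\<dots> = (\<Sum>k\<le>N. m choose k)" using assms(1) by (simp add: n_subsets m_def)
  finally have "real (card {S. S \<subseteq> J \<and> card S \<le> N}) \<le> (\<Sum>k\<le>N. real (m choose k))"
    by (simp flip: of_nat_sum)
  also have "\<dots> \<le> (\<Sum>k\<le>N. (m / N) ^ N * (real N ^ k / fact k))"
  proof (rule sum_mono)
    fix k assume k: "k \<in> {..N}"
    have "real ((m choose k) * fact k) \<le> real (m ^ k)"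
      using binomial_fact_pow[of m k] by (intro of_nat_mono)
    then have "real (m choose k) \<le> real m ^ k / fact k" by (simp add: field_simps)
    also have "\<dots> = (m / N) ^ k * (real N ^ k / fact k)" using assms by (simp add: power_divide)
    also have "\<dots> \<le> (m / N) ^ N * (real N ^ k / fact k)"
      using assms k by (intro mult_right_mono power_increasing) (auto simp: m_def)
    finally show "real (m choose k) \<le> (m / N) ^ N * (real N ^ k / fact k)" .
  qed
  also have "\<dots> = (m / N) ^ N * (\<Sum>k\<le>N. real N ^ k / fact k)" by (simp add: sum_distrib_left)
  also have "\<dots> \<le> (m / N) ^ N * exp (real N)"
    by (intro mult_left_mono sum_power_fact_le_exp) auto
  also have "\<dots> = (exp 1 * real m / real N) ^ N"
    using exp_of_nat_mult[of N "1::real"] by (simp add: power_mult_distrib power_divide)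
  finally show ?thesis by (simp add: m_def)
qed

subsection \<open>Stacked triangulations and their planarity\<close>

text \<open>Stellar subdivision of the simplex \<open>f\<close> in a complex \<open>C\<close>: the
  interior of \<open>f\<close> is replaced by the cone from \<open>v\<close> over its boundary. The
  choice \<open>S = {}\<close> contributes the new vertex itself.\<close>

definition stack :: "nat \<Rightarrow> nat set \<Rightarrow> nat set set \<Rightarrow> nat set set" where
  "stack v f C = (C - {f}) \<union> insert v ` {S. S \<subset> f}"

text \<open>\<open>m\<close> counts the vertices beyond the first three, so vertex
  \<open>m + 3\<close> is the one added last. The full complex is kept since its edges and bounded
  faces are then its members of size 2 and 3. The triangle \<open>{..<3}\<close> is listed only as
  the bounded face of the start, never as the outer one.\<close>

fun stacked :: "nat \<Rightarrow> nat set set set" where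
  "stacked 0 = {Pow {..<3}}"
| "stacked (Suc m) = (\<lambda>(C, f). stack (m + 3) f C) ` (SIGMA C:stacked m. {f \<in> C. card f = 3})"

abbreviation faces_of :: "nat set set \<Rightarrow> nat set set" where "faces_of C \<equiv> {f \<in> C. card f = 3}"
abbreviation edges_of :: "nat set set \<Rightarrow> nat set set" where "edges_of C \<equiv> {e \<in> C. card e = 2}"

lemma stacked_simplex:
  assumes "C \<in> stacked m" "s \<in> C"
  shows "s \<subseteq> {..<m + 3} \<and> card s \<le> 3"
  using assms
proof (induction m arbitrary: C s)
  case 0
  then show ?case using card_mono[of "{..<3::nat}" s] by auto
next
  case (Suc m)
  then obtain D f where D: "D \<in> stacked m" "f \<in> D" "card f = 3" "C = stack (m + 3) f D" by auto
  show ?case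
  proof (cases "s \<in> D")
    case True
    then show ?thesis using Suc.IH[OF D(1), of s] by auto
  next
    case False
    then obtain S where S: "S \<subset> f" "s = insert (m + 3) S" using Suc.prems D by (auto simp: stack_def)
    have f: "f \<subseteq> {..<m + 3}" "finite f" using Suc.IH[OF D(1,2)] finite_subset[of f "{..<m + 3}"] by auto
    then have "card S < 3" using psubset_card_mono[of f S] S D by auto
    moreover have "finite S" using S(1) f(2) finite_subset[of S f] by auto
    ultimately have "card s \<le> 3" using S by (simp add: card_insert_if)
    then show ?thesis using S f by auto
  qed
qed

lemma stacked_finite_simplex: "C \<in> stacked m \<Longrightarrow> s \<in> C \<Longrightarrow> finite s"
  using stacked_simplex[of C m s] finite_subset[of s "{..<m + 3}"] by simp

lemma vertex_in_stacked: "C \<in> stacked m \<Longrightarrow> i < m + 3 \<Longrightarrow> {i} \<in> C"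
proof (induction m arbitrary: C)
  case (Suc m)
  then obtain D f where D: "D \<in> stacked m" "f \<in> D" "card f = 3" "C = stack (m + 3) f D" by auto
  show ?case
  proof (cases "i = m + 3")
    case True
    have "{} \<subset> f" using D(3) by auto
    then show ?thesis using True D by (auto simp: stack_def)
  next
    case False
    then have "{i} \<in> D" using Suc.IH[OF D(1)] Suc.prems by auto
    moreover have "{i} \<noteq> f" using D(3) by auto
    ultimately show ?thesis using D by (simp add: stack_def)
  qed
qed auto

lemma edges_of_stack:
  assumes "C \<in> stacked m" "f \<in> C" "card f = 3"
  shows "edges_of (stack (m + 3) f C) = edges_of C \<union> (\<lambda>x. {m + 3, x}) ` f"
proof -
  have f: "m + 3 \<notin> f" "finite f" using stacked_simplex[OF assms(1,2)] stacked_finite_simplex[OF assms(1,2)] by auto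
  have "{e \<in> insert (m + 3) ` {S. S \<subset> f}. card e = 2} = (\<lambda>x. {m + 3, x}) ` f"
  proof (intro equalityI subsetI)
    fix e assume "e \<in> {e \<in> insert (m + 3) ` {S. S \<subset> f}. card e = 2}"
    then obtain S where S: "S \<subset> f" "e = insert (m + 3) S" "card e = 2" by auto
    have "finite S" "m + 3 \<notin> S" using S f finite_subset[of S f] by auto
    then have "card S = 1" using S by simp
    then show "e \<in> (\<lambda>x. {m + 3, x}) ` f" using S by (auto simp: card_1_singleton_iff)
  next
    fix e assume "e \<in> (\<lambda>x. {m + 3, x}) ` f"
    then obtain x where x: "x \<in> f" "e = {m + 3, x}" by auto
    have "{x} \<noteq> f" using assms(3) by auto
    then have "{x} \<subset> f" using x by auto
    moreover have "m + 3 \<noteq> x" using x f by auto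
    then have "card e = 2" using x by simp
    ultimately show "e \<in> {e \<in> insert (m + 3) ` {S. S \<subset> f}. card e = 2}" using x by auto
  qed
  then show ?thesis using assms(3) unfolding stack_def by auto
qed

lemma faces_of_stack:
  assumes "C \<in> stacked m" "f \<in> C" "card f = 3"
  shows "faces_of (stack (m + 3) f C) = (faces_of C - {f}) \<union> (\<lambda>x. insert (m + 3) (f - {x})) ` f"
proof -
  have f: "m + 3 \<notin> f" "finite f" using stacked_simplex[OF assms(1,2)] stacked_finite_simplex[OF assms(1,2)] by auto
  have "{e \<in> insert (m + 3) ` {S. S \<subset> f}. card e = 3} = (\<lambda>x. insert (m + 3) (f - {x})) ` f"
  proof (intro equalityI subsetI)
    fix e assume "e \<in> {e \<in> insert (m + 3) ` {S. S \<subset> f}. card e = 3}"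
    then obtain S where S: "S \<subset> f" "e = insert (m + 3) S" "card e = 3" by auto
    have fS: "finite S" "m + 3 \<notin> S" using S f finite_subset[of S f] by auto
    then have "card S = 2" using S by simp
    then have "card (f - S) = 1" using assms(3) S fS by (simp add: card_Diff_subset psubset_imp_subset)
    then obtain x where "f - S = {x}" by (auto simp: card_1_singleton_iff)
    then have "S = f - {x}" "x \<in> f" using S by auto
    then show "e \<in> (\<lambda>x. insert (m + 3) (f - {x})) ` f" using S by auto
  next
    fix e assume "e \<in> (\<lambda>x. insert (m + 3) (f - {x})) ` f"
    then obtain x where x: "x \<in> f" "e = insert (m + 3) (f - {x})" by auto
    then have "card e = 3" using f assms(3) by simp
    moreover have "f - {x} \<subset> f" using x by auto
    ultimately show "e \<in> {e \<in> insert (m + 3) ` {S. S \<subset> f}. card e = 3}" using x by auto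
  qed
  then show ?thesis unfolding stack_def by auto
qed

lemma card_faces_of:
  assumes "C \<in> stacked m" shows "finite (faces_of C) \<and> card (faces_of C) = 2 * m + 1"
  using assms
proof (induction m arbitrary: C)
  case 0
  have "f = {..<3}" if "f \<subseteq> {..<3}" "card f = 3" for f :: "nat set"
    using card_subset_eq[of "{..<3::nat}" f] that by simp
  then have "faces_of (Pow {..<3}) \<subseteq> {{..<3}}" by blast
  moreover have "{..<3} \<in> faces_of (Pow {..<3})" by simp
  ultimately have "faces_of (Pow {..<3}) = {{..<3}}" by blast
  then show ?case using 0 by simp
next
  case (Suc m)
  then obtain D f where D: "D \<in> stacked m" "f \<in> D" "card f = 3" "C = stack (m + 3) f D" by auto
  have f: "m + 3 \<notin> f" "finite f" using stacked_simplex[OF D(1,2)] stacked_finite_simplex[OF D(1,2)] by auto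
  have inj: "inj_on (\<lambda>x. insert (m + 3) (f - {x})) f"
  proof (rule inj_onI)
    fix x y assume xy: "x \<in> f" "y \<in> f" "insert (m + 3) (f - {x}) = insert (m + 3) (f - {y})"
    have "x \<notin> insert (m + 3) (f - {x})" using f xy(1) by auto
    then have "x \<notin> insert (m + 3) (f - {y})" using xy(3) by simp
    then show "x = y" using xy(1) by blast
  qed
  have "m + 3 \<notin> g" if "g \<in> D" for g using stacked_simplex[OF D(1) that] by auto
  then have "(faces_of D - {f}) \<inter> (\<lambda>x. insert (m + 3) (f - {x})) ` f = {}" by blast
  then have "card (faces_of C) = card (faces_of D - {f}) + card ((\<lambda>x. insert (m + 3) (f - {x})) ` f)"
    unfolding D(4) faces_of_stack[OF D(1-3)] using Suc.IH[OF D(1)] f(2)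
    by (intro card_Un_disjoint) auto
  also have "card ((\<lambda>x. insert (m + 3) (f - {x})) ` f) = 3" using card_image[OF inj] D(3) by simp
  also have "card (faces_of D - {f}) = 2 * m" using Suc.IH[OF D(1)] D(2,3) by simp
  finally show ?case using Suc.IH[OF D(1)] f(2) unfolding D(4) faces_of_stack[OF D(1-3)] by auto
qed

text \<open>A segment from the relatively interior point \<open>v\<close> into the simplex stays in
  the relative interior up to its far end, so the cone from \<open>v\<close> over \<open>S\<close>
  meets a proper face only within the hull of \<open>S\<close>. Affine independence then cuts this
  down to \<open>S \<inter> T\<close>. This separates the simplices of a subdivided triangle from
  the old ones.\<close>

lemma hull_insert_Int_proper_face:
  fixes F :: "'a::euclidean_space set"
  assumes "\<not> affine_dependent F" "v \<in> rel_interior (convex hull F)" "S \<subseteq> F" "T \<subset> F"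
  shows "convex hull (insert v S) \<inter> convex hull T \<subseteq> convex hull (S \<inter> T)"
proof -
  have face: "convex hull T face_of convex hull F"
    unfolding face_of_convex_hull_affine_independent[OF assms(1)]
    by (intro exI[of _ T]) (use assms(4) in auto)
  have "convex hull T \<noteq> convex hull F"
  proof
    assume eq: "convex hull T = convex hull F"
    obtain x where x: "x \<in> F" "x \<notin> T" using assms(4) by auto
    then have "x \<in> convex hull T" using eq hull_inc by metis
    then have "x \<in> affine hull (F - {x})"
      using convex_hull_subset_affine_hull hull_mono[of T "F - {x}" affine] assms(4) x by blast
    then show False using assms(1) x by (auto simp: affine_dependent_def)
  qed
  then have "disjnt (convex hull T) (rel_interior (convex hull F))"
    using face_of_disjoint_rel_interior[OF face] by (simp add: disjnt_def)
  then have "convex hull T \<inter> convex hull (insert v S) = convex hull T \<inter> convex hull S"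
    using assms(2,3) hull_subset[of F convex]
    by (intro Int_convex_hull_insert_rel_exterior[OF convex_convex_hull[of F]]) auto
  also have "\<dots> \<subseteq> convex hull (T \<inter> S)"
  proof (rule convex_hull_Int_subset)
    show "\<not> affine_dependent (T \<union> S)"
      using affine_dependent_subset[of "T \<union> S" F] assms by auto
  qed
  finally show ?thesis by (simp add: Int_commute)
qed

text \<open>Realisation as a geometric simplicial complex. As single vertices belong to the complex,
  the last condition also keeps vertices off foreign edges; independence of the triangles provides
  room for the next vertex.\<close>

definition simplicial_drawing :: "nat \<Rightarrow> (nat \<Rightarrow> real ^ 2) \<Rightarrow> nat set set \<Rightarrow> bool" where
  "simplicial_drawing n p C \<longleftrightarrow> inj_on p {..<n} \<and>
     (\<forall>f\<in>C. card f = 3 \<longrightarrow> \<not> affine_dependent (p ` f)) \<and>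
     (\<forall>s\<in>C. \<forall>t\<in>C. convex hull (p ` s) \<inter> convex hull (p ` t) \<subseteq> convex hull (p ` (s \<inter> t)))"

lemma ex_affine_independent_triple:
  "\<exists>p :: nat \<Rightarrow> real ^ 2. inj_on p {..<3} \<and> \<not> affine_dependent (p ` {..<3})"
proof -
  let ?S = "insert 0 (Basis :: (real ^ 2) set)"
  have "\<not> affine_dependent ?S"
    using independent_Basis by (subst affine_dependent_iff_dependent) auto
  moreover have "card ?S = card {..<3::nat}" by (simp add: card_insert_if)
  then obtain p :: "nat \<Rightarrow> real ^ 2" where "bij_betw p {..<3} ?S"
    using finite_same_card_bij[of "{..<3::nat}" ?S] by auto
  ultimately show ?thesis by (auto simp: bij_betw_def)
qed

text \<open>The new vertex goes into the relative interior of its face. Intersections of two new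
  simplices are governed by uniqueness in the decomposition into cones, those of a new and an old
  one by \<open>hull_insert_Int_proper_face\<close>.\<close>

lemma simplicial_drawing_exists:
  assumes "C \<in> stacked m" shows "\<exists>p. simplicial_drawing (m + 3) p C"
  using assms
proof (induction m arbitrary: C)
  case 0
  obtain p :: "nat \<Rightarrow> real ^ 2" where p: "inj_on p {..<3}" "\<not> affine_dependent (p ` {..<3})"
    using ex_affine_independent_triple by blast
  have sub: "\<not> affine_dependent (p ` f)" if "f \<subseteq> {..<3}" for f
    using affine_dependent_subset[of "p ` f" "p ` {..<3}"] p(2) that by blast
  have "convex hull (p ` s) \<inter> convex hull (p ` t) \<subseteq> convex hull (p ` (s \<inter> t))"
    if "s \<subseteq> {..<3}" "t \<subseteq> {..<3}" for s t
    using convex_hull_Int_subset[of "p ` s" "p ` t"] sub[of "s \<union> t"] that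
      inj_on_image_Int[OF p(1) that] by (simp add: image_Un)
  then show ?case using 0 p sub by (intro exI[of _ p]) (auto simp: simplicial_drawing_def)
next
  case (Suc m)
  then obtain D f where D: "D \<in> stacked m" "f \<in> D" "card f = 3" "C = stack (m + 3) f D" by auto
  obtain p where p: "simplicial_drawing (m + 3) p D" using Suc.IH[OF D(1)] by blast
  let ?k = "m + 3"
  have f: "f \<subseteq> {..<?k}" "finite f" using stacked_simplex[OF D(1,2)] stacked_finite_simplex[OF D(1,2)] by auto
  have indf: "\<not> affine_dependent (p ` f)" and injp: "inj_on p {..<?k}"
    using p D by (auto simp: simplicial_drawing_def)
  have pint: "convex hull (p ` s) \<inter> convex hull (p ` t) \<subseteq> convex hull (p ` (s \<inter> t))"
    if "s \<in> D" "t \<in> D" for s t using p that by (auto simp: simplicial_drawing_def)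
  have "f \<noteq> {}" using D(3) by auto
  then have "rel_interior (convex hull (p ` f)) \<noteq> {}" by (simp add: rel_interior_eq_empty)
  then obtain v where v: "v \<in> rel_interior (convex hull (p ` f))" by blast
  then have vf: "v \<in> convex hull (p ` f)" using rel_interior_subset by blast
  define q where "q = p(?k := v)"
  have qp: "q ` s = p ` s" if "?k \<notin> s" for s using that unfolding q_def by (auto simp: image_iff)
  have qk: "q ` insert ?k s = insert v (p ` s)" if "?k \<notin> s" for s
    unfolding image_insert qp[OF that] by (simp add: q_def)
  have kD: "?k \<notin> s" if "s \<in> D" for s using stacked_simplex[OF D(1) that] by auto
  have kf: "?k \<notin> S" if "S \<subseteq> f" for S using kD[OF D(2)] that by auto
  have img: "p ` S \<subset> p ` f" if "S \<subset> f" for S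
    using that f(1) injp by (metis image_strict_mono inj_on_subset)
  have pI: "p ` (S \<inter> T) = p ` S \<inter> p ` T" if "S \<subseteq> f" "T \<subseteq> f" for S T
    using inj_on_image_Int[OF injp, of S T] that f(1) by blast
  have hullsub: "convex hull (insert v (p ` S)) \<subseteq> convex hull (p ` f)" if "S \<subseteq> f" for S
    using that vf hull_subset[of "p ` f" convex] by (intro hull_minimal) auto
  have on: "convex hull (q ` s) \<inter> convex hull (q ` insert ?k S) \<subseteq> convex hull (q ` (s \<inter> insert ?k S))"
    if s: "s \<in> D" "s \<noteq> f" and S: "S \<subset> f" for s S
  proof
    fix x assume x: "x \<in> convex hull (q ` s) \<inter> convex hull (q ` insert ?k S)"
    have x1: "x \<in> convex hull (p ` s)" "x \<in> convex hull (insert v (p ` S))"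
      using x qp[OF kD[OF s(1)]] qk[OF kf[of S]] S by auto
    have "\<not> f \<subseteq> s"
    proof
      assume "f \<subseteq> s"
      moreover have "card s \<le> card f" using stacked_simplex[OF D(1) s(1)] D(3) by simp
      ultimately show False using s(2) card_seteq[OF stacked_finite_simplex[OF D(1) s(1)]] by blast
    qed
    then have T: "s \<inter> f \<subset> f" by auto
    have "x \<in> convex hull (p ` (s \<inter> f))"
      using x1 hullsub[of S] S pint[OF s(1) D(2)] by blast
    then have "x \<in> convex hull (p ` S \<inter> p ` (s \<inter> f))"
      using hull_insert_Int_proper_face[OF indf v, of "p ` S" "p ` (s \<inter> f)"] x1(2) img[OF T] S by blast
    also have "p ` S \<inter> p ` (s \<inter> f) = p ` (s \<inter> insert ?k S)"
    proof -
      have "s \<inter> insert ?k S = S \<inter> (s \<inter> f)" using kD[OF s(1)] S by auto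
      then show ?thesis using pI[of S "s \<inter> f"] S by auto
    qed
    also have "\<dots> = q ` (s \<inter> insert ?k S)" using qp[of "s \<inter> insert ?k S"] kD[OF s(1)] by auto
    finally show "x \<in> convex hull (q ` (s \<inter> insert ?k S))" .
  qed
  have nn: "convex hull (q ` insert ?k S) \<inter> convex hull (q ` insert ?k T) \<subseteq> convex hull (q ` (insert ?k S \<inter> insert ?k T))"
    if S: "S \<subset> f" "T \<subset> f" for S T
  proof
    fix x assume "x \<in> convex hull (q ` insert ?k S) \<inter> convex hull (q ` insert ?k T)"
    then have "x \<in> convex hull (insert v (p ` S))" "x \<in> convex hull (insert v (p ` T))"
      using qk kf S by auto
    then have "x \<in> convex hull (insert v (p ` S \<inter> p ` T))"
      using in_convex_hull_exchange_unique[OF indf vf] S by (metis image_mono psubset_imp_subset)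
    moreover have "q ` (insert ?k S \<inter> insert ?k T) = insert v (p ` S \<inter> p ` T)"
    proof -
      have "insert ?k S \<inter> insert ?k T = insert ?k (S \<inter> T)" by auto
      then show ?thesis using qk[of "S \<inter> T"] kf[of "S \<inter> T"] S pI[of S T] by auto
    qed
    ultimately show "x \<in> convex hull (q ` (insert ?k S \<inter> insert ?k T))" by simp
  qed
  have "inj_on q {..<Suc m + 3}"
  proof -
    have "v \<notin> p ` {..<?k}"
    proof
      assume "v \<in> p ` {..<?k}"
      then obtain i where i: "i < ?k" "v = p i" by auto
      have "{i} \<noteq> f" "{} \<subset> f" using D(3) by auto
      \<comment> \<open>The old vertex \<open>i\<close> and the new vertex alone have no common
        element, so their images cannot coincide.\<close>
      from on[OF vertex_in_stacked[OF D(1) i(1)] this]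
      have "convex hull (q ` {i}) \<inter> convex hull (q ` insert ?k {}) \<subseteq> convex hull (q ` ({i} \<inter> insert ?k {}))" .
      then show False using i by (auto simp: q_def)
    qed
    moreover have "inj_on q {..<?k}" using injp by (auto simp: inj_on_def q_def)
    moreover have "q ` {..<?k} = p ` {..<?k}" by (intro qp) simp
    moreover have "{..<Suc m + 3} = insert ?k {..<?k}" by auto
    ultimately show ?thesis by (simp add: q_def)
  qed
  moreover have "\<not> affine_dependent (q ` g)" if g: "g \<in> C" "card g = 3" for g
  proof (cases "g \<in> D")
    case True
    then show ?thesis using p g qp[OF kD[OF True]] by (auto simp: simplicial_drawing_def)
  next
    case False
    then obtain S where S: "S \<subset> f" "g = insert ?k S" using g D(4) by (auto simp: stack_def)
    have "p ` S \<subseteq> p ` f" using S(1) by auto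
    then have "convex hull (p ` S) face_of convex hull (p ` f)"
      unfolding face_of_convex_hull_affine_independent[OF indf] by (intro exI[of _ "p ` S"]) simp
    moreover have "convex hull (p ` S) \<noteq> convex hull (p ` f)"
    proof
      assume "convex hull (p ` S) = convex hull (p ` f)"
      then have "v \<in> convex hull (insert v {}) \<inter> convex hull (p ` S)" using vf by simp
      then show False
        using hull_insert_Int_proper_face[OF indf v, of "{}" "p ` S"] img[OF S(1)] by auto
    qed
    ultimately have "v \<notin> affine hull (p ` S)"
      using affine_hull_face_of_disjoint_rel_interior[of "convex hull (p ` f)" "convex hull (p ` S)"] v by auto
    moreover have "\<not> affine_dependent (p ` S)"
      using affine_dependent_subset[of "p ` S" "p ` f"] indf S by blast
    ultimately show ?thesis using affine_independent_insert qk[OF kf[of S]] S by auto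
  qed
  moreover have "convex hull (q ` s) \<inter> convex hull (q ` t) \<subseteq> convex hull (q ` (s \<inter> t))"
    if st: "s \<in> C" "t \<in> C" for s t
  proof -
    have c: "(u \<in> D \<and> u \<noteq> f) \<or> (\<exists>S. S \<subset> f \<and> u = insert ?k S)" if "u \<in> C" for u
      using that D(4) by (auto simp: stack_def)
    from c[OF st(1)] c[OF st(2)] show ?thesis
    proof (elim disjE exE conjE)
      assume "s \<in> D" "t \<in> D"
      then show ?thesis using pint[of s t] qp[of s] qp[of t] qp[of "s \<inter> t"] kD by auto
    next
      fix S assume "s \<in> D" "s \<noteq> f" "S \<subset> f" "t = insert ?k S"
      then show ?thesis using on by simp
    next
      fix S assume "t \<in> D" "t \<noteq> f" "S \<subset> f" "s = insert ?k S"
      then show ?thesis using on[of t S] by (simp add: Int_commute)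
    next
      fix S T assume "S \<subset> f" "s = insert ?k S" "T \<subset> f" "t = insert ?k T"
      then show ?thesis using nn by simp
    qed
  qed
  ultimately show ?case unfolding simplicial_drawing_def by blast
qed

definition graph_of :: "nat \<Rightarrow> nat set set \<Rightarrow> nat graph" where
  "graph_of n C = ({..<n}, edges_of C)"

lemma finite_simple_graph_of: "C \<in> stacked m \<Longrightarrow> finite_simple_graph (graph_of (m + 3) C)"
  using stacked_simplex by (fastforce simp: finite_simple_graph_def graph_of_def)

lemma crossing_free_simplicial_drawing:
  assumes C: "C \<in> stacked m" and p: "simplicial_drawing (m + 3) p C"
  shows "crossing_free (graph_of (m + 3) C) p (\<lambda>e. convex hull (p ` e))"
proof -
  have I: "convex hull (p ` s) \<inter> convex hull (p ` t) \<subseteq> convex hull (p ` (s \<inter> t))"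
    if "s \<in> C" "t \<in> C" for s t using p that by (auto simp: simplicial_drawing_def)
  have "convex hull (p ` e) \<inter> convex hull (p ` f) \<subseteq> p ` (e \<inter> f)"
    if e: "e \<in> C" "card e = 2" and f: "f \<in> C" "card f = 2" and ne: "e \<noteq> f" for e f
  proof -
    have fin: "finite e" "finite f" using stacked_finite_simplex[OF C] e f by auto
    have "card (e \<inter> f) < 2"
    proof (rule ccontr)
      assume "\<not> card (e \<inter> f) < 2"
      then have "e \<inter> f = e" "e \<inter> f = f"
        using card_seteq[of e "e \<inter> f"] card_seteq[of f "e \<inter> f"] fin e f by auto
      then show False using ne by auto
    qed
    then have "e \<inter> f = {} \<or> (\<exists>x. e \<inter> f = {x})"
      using fin by (cases "card (e \<inter> f)") (auto simp: card_1_singleton_iff)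
    then have "convex hull (p ` (e \<inter> f)) = p ` (e \<inter> f)" by (elim disjE exE) simp_all
    then show ?thesis using I[OF e(1) f(1)] by auto
  qed
  moreover have "p w \<notin> convex hull (p ` e)" if e: "e \<in> C" and w: "w < m + 3" "w \<notin> e" for e w
    using I[OF e vertex_in_stacked[OF C w(1)]] w(2) by auto
  ultimately show ?thesis using p
    by (auto simp: crossing_free_def graph_of_def simplicial_drawing_def)
qed

lemma planar_graph_of:
  assumes C: "C \<in> stacked m" shows "planar (graph_of (m + 3) C)"
proof -
  obtain p where p: "simplicial_drawing (m + 3) p C" using simplicial_drawing_exists[OF C] by blast
  \<comment> \<open>An edge is a set without direction; its least and greatest elements serve as
    start and end of the arc.\<close>
  define \<gamma> where "\<gamma> = (\<lambda>e. linepath (p (Min e)) (p (Max e)))"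
  have e2: "e = {Min e, Max e}" "p (Min e) \<noteq> p (Max e)" if e: "e \<in> edges_of C" for e
  proof -
    obtain a' b' where "e = {a', b'}" "a' \<noteq> b'" using e by (auto simp: card_2_iff)
    then have "e = {min a' b', max a' b'}" "min a' b' < max a' b'" by (auto simp: min_def max_def)
    then obtain a b where ab: "e = {a, b}" "a < b" by blast
    then have "Min e = a" "Max e = b" by auto
    then show "e = {Min e, Max e}" using ab by auto
    have "inj_on p {..<m + 3}" using p by (auto simp: simplicial_drawing_def)
    moreover have "a < m + 3" "b < m + 3" using stacked_simplex[OF C, of e] e ab by auto
    ultimately show "p (Min e) \<noteq> p (Max e)"
      using ab \<open>Min e = a\<close> \<open>Max e = b\<close> by (auto dest: inj_onD)
  qed
  have img: "path_image (\<gamma> e) = convex hull (p ` e)" if "e \<in> edges_of C" for e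
  proof -
    have "p ` e = p ` {Min e, Max e}" by (rule arg_cong[OF e2(1)[OF that]])
    then have "p ` e = {p (Min e), p (Max e)}" by simp
    then show ?thesis by (simp add: \<gamma>_def segment_convex_hull)
  qed
  have "crossing_free (graph_of (m + 3) C) p (\<lambda>e. path_image (\<gamma> e))"
    using crossing_free_simplicial_drawing[OF C p] img unfolding crossing_free_def graph_of_def by auto
  moreover have "arc (\<gamma> e) \<and> {pathstart (\<gamma> e), pathfinish (\<gamma> e)} = p ` e" if "e \<in> edges_of C" for e
  proof -
    have "p ` e = p ` {Min e, Max e}" by (rule arg_cong[OF e2(1)[OF that]])
    then have "p ` e = {p (Min e), p (Max e)}" by simp
    then show ?thesis using e2(2)[OF that] by (simp add: \<gamma>_def)
  qed
  ultimately show ?thesis using finite_simple_graph_of[OF C]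
    unfolding planar_def by (auto simp: graph_of_def)
qed

subsection \<open>A labelled point set carries at most one stacked triangulation\<close>

text \<open>The part of \<open>crossing_free\<close> that can be read off signs: only disjoint edges
  are compared. Two edges with a common end that overlap further would put an end of one on the
  other, which the condition on vertices excludes.\<close>

definition disjoint_drawing :: "nat \<Rightarrow> (nat \<Rightarrow> real ^ 2) \<Rightarrow> nat set set \<Rightarrow> bool" where
  "disjoint_drawing n p E \<longleftrightarrow> inj_on p {..<n} \<and>
     (\<forall>e\<in>E. card e = 2 \<and> e \<subseteq> {..<n} \<and> (\<forall>w<n. w \<notin> e \<longrightarrow> p w \<notin> convex hull (p ` e))) \<and>
     (\<forall>e\<in>E. \<forall>f\<in>E. e \<inter> f = {} \<longrightarrow> convex hull (p ` e) \<inter> convex hull (p ` f) = {})"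

lemma disjoint_drawing_subset: "disjoint_drawing n p E \<Longrightarrow> E' \<subseteq> E \<Longrightarrow> disjoint_drawing n p E'"
  unfolding disjoint_drawing_def by (meson subsetD)

definition triangle_in :: "nat set set \<Rightarrow> nat set \<Rightarrow> bool" where
  "triangle_in E f \<longleftrightarrow> card f = 3 \<and> (\<forall>e\<subseteq>f. card e = 2 \<longrightarrow> e \<in> E)"

lemma triangle_inE:
  assumes "triangle_in E f"
  obtains a b c where "f = {a, b, c}" "a \<noteq> b" "b \<noteq> c" "a \<noteq> c" "{a, b} \<in> E" "{b, c} \<in> E" "{a, c} \<in> E"
proof -
  obtain a b c where abc: "f = {a, b, c}" "a \<noteq> b" "b \<noteq> c" "a \<noteq> c"
    using assms by (auto simp: triangle_in_def card_3_iff)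
  have "e \<in> E" if "e \<subseteq> f" "card e = 2" for e using assms that by (simp add: triangle_in_def)
  from this[of "{a, b}"] this[of "{b, c}"] this[of "{a, c}"] abc that[of a b c] show ?thesis by simp
qed

section \<open>Triangles in a fixed drawing\<close>

locale drawn_edges =
  fixes n :: nat and p :: "nat \<Rightarrow> real ^ 2" and E :: "nat set set"
  assumes drawing: "disjoint_drawing n p E"
begin

abbreviation H :: "nat set \<Rightarrow> (real ^ 2) set" where "H s \<equiv> convex hull (p ` s)"

lemma inj_p: "inj_on p {..<n}" using drawing by (simp add: disjoint_drawing_def)

lemma edge_subset: "e \<in> E \<Longrightarrow> e \<subseteq> {..<n}" using drawing by (simp add: disjoint_drawing_def)

lemma on_edge: "e \<in> E \<Longrightarrow> w < n \<Longrightarrow> p w \<in> H e \<Longrightarrow> w \<in> e"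
  using drawing by (auto simp: disjoint_drawing_def)

lemma disjoint_edges: "e \<in> E \<Longrightarrow> f \<in> E \<Longrightarrow> e \<inter> f = {} \<Longrightarrow> H e \<inter> H f = {}"
  using drawing by (auto simp: disjoint_drawing_def)

lemma triangle_subset: "triangle_in E f \<Longrightarrow> f \<subseteq> {..<n}"
  by (erule triangle_inE) (use edge_subset in fast)

lemma triangle_finite: "triangle_in E f \<Longrightarrow> finite f"
  using triangle_subset finite_subset by blast

text \<open>If the corners were collinear, one would lie between the other two, hence on the edge
  joining them.\<close>

lemma triangle_affine_independent:
  assumes f: "triangle_in E f" shows "\<not> affine_dependent (p ` f)"
proof
  assume dep: "affine_dependent (p ` f)"
  obtain a b c where abc: "f = {a, b, c}" "a \<noteq> b" "b \<noteq> c" "a \<noteq> c" "{a, b} \<in> E" "{b, c} \<in> E" "{a, c} \<in> E"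
    using f by (rule triangle_inE)
  have n: "a < n" "b < n" "c < n" using triangle_subset[OF f] abc(1) by auto
  have "collinear {p a, p b, p c}"
    using dep abc(1) collinear_3_eq_affine_dependent[of "p a" "p b" "p c"] by simp
  then have "p a \<in> H {b, c} \<or> p b \<in> H {c, a} \<or> p c \<in> H {a, b}"
    by (simp add: collinear_between_cases between_mem_segment segment_convex_hull)
  moreover have "{c, a} \<in> E" using abc(7) by (simp add: insert_commute)
  ultimately have "a \<in> {b, c} \<or> b \<in> {c, a} \<or> c \<in> {a, b}" using on_edge n abc by blast
  then show False using abc by auto
qed

text \<open>The edge would meet the frontier of the triangle, that is, one of its sides. That side
  is disjoint from it as an edge, since \<open>y\<close> is not a corner either: corners lie in the
  hull.\<close>

lemma edge_crosses_triangle: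
  assumes f: "triangle_in E f" and xy: "{x, y} \<in> E" "x \<notin> f" "p x \<in> H f" "p y \<notin> H f"
  shows False
proof -
  obtain a b c where abc: "f = {a, b, c}" "a \<noteq> b" "b \<noteq> c" "a \<noteq> c" "{a, b} \<in> E" "{b, c} \<in> E" "{a, c} \<in> E"
    using f by (rule triangle_inE)
  have "y \<notin> f" using xy(4) hull_inc[of "p y" "p ` f"] by blast
  have "H {x, y} \<inter> frontier (H f) \<noteq> {}"
  proof (rule connected_Int_frontier)
    show "connected (H {x, y})" by (intro convex_connected convex_convex_hull)
    have "p x \<in> H {x, y}" "p y \<in> H {x, y}" by (auto intro: hull_inc)
    then show "H {x, y} \<inter> H f \<noteq> {}" "H {x, y} - H f \<noteq> {}" using xy by auto
  qed
  moreover have "frontier (H f) = H {a, b} \<union> H {b, c} \<union> H {a, c}"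
    using abc(1) frontier_of_triangle[of "p a" "p b" "p c"]
    by (simp add: segment_convex_hull insert_commute)
  ultimately have "H {x, y} \<inter> H {a, b} \<noteq> {} \<or> H {x, y} \<inter> H {b, c} \<noteq> {} \<or> H {x, y} \<inter> H {a, c} \<noteq> {}"
    by (simp only: Int_Un_distrib Un_empty de_Morgan_conj disj_assoc)
  then have "\<exists>e\<in>{{a, b}, {b, c}, {a, c}}. H {x, y} \<inter> H e \<noteq> {}" by simp
  then obtain e where e: "e \<in> {{a, b}, {b, c}, {a, c}}" "H {x, y} \<inter> H e \<noteq> {}" ..
  have "e \<in> E" "e \<subseteq> f" using e abc by auto
  then have "{x, y} \<inter> e = {}" using xy(2) \<open>y \<notin> f\<close> by auto
  then show False using disjoint_edges[OF xy(1) \<open>e \<in> E\<close>] e(2) by simp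
qed

text \<open>Together with \<open>triangle_exchange_unique\<close> this says that the cones from
  \<open>p v\<close> over the sides cover the triangle and overlap only in cones over common
  corners.\<close>

lemma triangle_exchange:
  assumes f: "triangle_in E f" and v: "p v \<in> H f" and x: "x \<in> H f"
  obtains a where "a \<in> f" "x \<in> H (insert v (f - {a}))"
proof -
  obtain b where b: "b \<in> p ` f" "x \<in> convex hull (insert (p v) (p ` f - {b}))"
    using in_convex_hull_exchange[OF v x] by blast
  then obtain a where a: "a \<in> f" "b = p a" by auto
  have "p ` f - {b} = p ` (f - {a})"
    using inj_on_image_set_diff[OF inj_p, of f "{a}"] triangle_subset[OF f] a by auto
  then show ?thesis using that[OF a(1)] b by simp
qed

lemma triangle_exchange_unique:
  assumes f: "triangle_in E f" and v: "p v \<in> H f" and S: "S \<subseteq> f" "T \<subseteq> f"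
    and x: "x \<in> H (insert v S)" "x \<in> H (insert v T)"
  shows "x \<in> H (insert v (S \<inter> T))"
proof -
  have "x \<in> convex hull (insert (p v) (p ` S \<inter> p ` T))"
    by (rule in_convex_hull_exchange_unique[OF triangle_affine_independent[OF f] v]) (use S x in auto)
  moreover have "p ` S \<inter> p ` T = p ` (S \<inter> T)"
    using inj_on_image_Int[OF inj_p, of S T] S triangle_subset[OF f] by blast
  ultimately show ?thesis by simp
qed

lemma hull_insert_subset: "p v \<in> H f \<Longrightarrow> S \<subseteq> f \<Longrightarrow> H (insert v S) \<subseteq> H f"
  using hull_subset[of "p ` f" convex] by (intro hull_minimal) auto

end

text \<open>
  \<open>B\<close> are the bounded faces and \<open>U\<close> the outer triangle of the drawing of the first \<open>k\<close> vertices.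
  The outer triangle need not be the triangle on \<open>{..<3}\<close>.
\<close>
definition face_structure ::
    "nat \<Rightarrow> (nat \<Rightarrow> real ^ 2) \<Rightarrow> nat \<Rightarrow> nat set set \<Rightarrow> nat set set \<Rightarrow> nat set \<Rightarrow> bool" where
  "face_structure n p k E B U \<longleftrightarrow>
     (\<forall>f\<in>insert U B. triangle_in E f \<and> f \<subseteq> {..<k}) \<and>
     (\<forall>f\<in>B. convex hull (p ` f) \<subseteq> convex hull (p ` U)) \<and>
     (\<forall>j. k \<le> j \<longrightarrow> j < n \<longrightarrow> p j \<in> convex hull (p ` U) \<longrightarrow> (\<exists>f\<in>B. p j \<in> convex hull (p ` f))) \<and>
     (\<forall>j. k \<le> j \<longrightarrow> j < n \<longrightarrow>
        (\<forall>f\<in>B. \<forall>g\<in>B. p j \<in> convex hull (p ` f) \<longrightarrow> p j \<in> convex hull (p ` g) \<longrightarrow> f = g)) \<and>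
     (\<forall>j<k. \<forall>f\<in>B. p j \<in> convex hull (p ` f) \<longrightarrow> j \<in> f) \<and>
     (\<forall>j<k. p j \<in> convex hull (p ` U))"

lemma face_structureI:
  assumes "\<And>f. f \<in> insert U B \<Longrightarrow> triangle_in E f" "\<And>f. f \<in> insert U B \<Longrightarrow> f \<subseteq> {..<k}"
    "\<And>f. f \<in> B \<Longrightarrow> convex hull (p ` f) \<subseteq> convex hull (p ` U)"
    "\<And>j. k \<le> j \<Longrightarrow> j < n \<Longrightarrow> p j \<in> convex hull (p ` U) \<Longrightarrow> \<exists>f\<in>B. p j \<in> convex hull (p ` f)"
    "\<And>j f g. k \<le> j \<Longrightarrow> j < n \<Longrightarrow> f \<in> B \<Longrightarrow> g \<in> B \<Longrightarrow> p j \<in> convex hull (p ` f) \<Longrightarrow>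
        p j \<in> convex hull (p ` g) \<Longrightarrow> f = g"
    "\<And>j f. j < k \<Longrightarrow> f \<in> B \<Longrightarrow> p j \<in> convex hull (p ` f) \<Longrightarrow> j \<in> f"
    "\<And>j. j < k \<Longrightarrow> p j \<in> convex hull (p ` U)"
  shows "face_structure n p k E B U"
  unfolding face_structure_def
  by (intro conjI ballI allI impI) (rule assms; assumption)+

lemma face_structureD:
  assumes "face_structure n p k E B U"
  shows "f \<in> insert U B \<Longrightarrow> triangle_in E f" "f \<in> insert U B \<Longrightarrow> f \<subseteq> {..<k}"
    "f \<in> B \<Longrightarrow> convex hull (p ` f) \<subseteq> convex hull (p ` U)"
    "k \<le> j \<Longrightarrow> j < n \<Longrightarrow> p j \<in> convex hull (p ` U) \<Longrightarrow> \<exists>f\<in>B. p j \<in> convex hull (p ` f)"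
    "k \<le> j \<Longrightarrow> j < n \<Longrightarrow> f \<in> B \<Longrightarrow> g \<in> B \<Longrightarrow> p j \<in> convex hull (p ` f) \<Longrightarrow>
        p j \<in> convex hull (p ` g) \<Longrightarrow> f = g"
    "j < k \<Longrightarrow> f \<in> B \<Longrightarrow> p j \<in> convex hull (p ` f) \<Longrightarrow> j \<in> f"
    "j < k \<Longrightarrow> p j \<in> convex hull (p ` U)"
  using assms unfolding face_structure_def by meson+

lemma triangle_in_mono: "triangle_in E f \<Longrightarrow> E \<subseteq> E' \<Longrightarrow> triangle_in E' f"
  unfolding triangle_in_def by auto

lemma face_structure_mono: "face_structure n p k E B U \<Longrightarrow> E \<subseteq> E' \<Longrightarrow> face_structure n p k E' B U"
  using triangle_in_mono[of E _ E'] unfolding face_structure_def by simp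

context drawn_edges
begin

text \<open>The only earlier vertices in the hull of \<open>b\<close> are its corners, and no edge
  from \<open>v\<close> can leave that hull. So all of \<open>f\<close> lies in \<open>b\<close>,
  and both have three elements.\<close>

lemma located_in_bounded_face:
  assumes fs: "face_structure n p k E B U" and v: "k \<le> v"
    and b: "b \<in> B" "p v \<in> H b" and f: "f \<in> insert U B" and adj: "\<And>x. x \<in> f \<Longrightarrow> {v, x} \<in> E"
  shows "f = b"
proof -
  note fs' = face_structureD[OF fs]
  have tb: "triangle_in E b" "b \<subseteq> {..<k}" and tf: "triangle_in E f" "f \<subseteq> {..<k}" using fs'(1,2) b f by auto
  have "v \<notin> b" using tb(2) v by auto
  have "f \<subseteq> b"
  proof
    fix x assume x: "x \<in> f"
    show "x \<in> b"
    proof (rule ccontr)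
      assume "x \<notin> b"
      then have "p x \<notin> H b" using fs'(6)[of x b] b(1) tf(2) x by auto
      then show False using edge_crosses_triangle[OF tb(1) adj[OF x] \<open>v \<notin> b\<close> b(2)] by simp
    qed
  qed
  then show ?thesis using tb(1) tf(1) triangle_finite[OF tb(1)] card_subset_eq[of b f]
    by (simp add: triangle_in_def)
qed

text \<open>All earlier vertices lie in the hull of \<open>U\<close>; an edge from one that is not a
  corner of \<open>U\<close> to the outside would cross a side of \<open>U\<close>.\<close>

lemma located_outside:
  assumes fs: "face_structure n p k E B U" and v: "k \<le> v"
    and out: "p v \<notin> H U" and f: "f \<in> insert U B" and adj: "\<And>x. x \<in> f \<Longrightarrow> {v, x} \<in> E"
  shows "f = U"
proof -
  note fs' = face_structureD[OF fs]
  have tO: "triangle_in E U" and tf: "triangle_in E f" "f \<subseteq> {..<k}" using fs'(1,2) f by auto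
  have "f \<subseteq> U"
  proof
    fix x assume x: "x \<in> f"
    show "x \<in> U"
    proof (rule ccontr)
      assume "x \<notin> U"
      have "{x, v} \<in> E" using adj[OF x] by (simp add: insert_commute)
      then show False using edge_crosses_triangle[OF tO _ \<open>x \<notin> U\<close> _ out] fs'(7)[of x] tf(2) x by auto
    qed
  qed
  then show ?thesis using tO tf(1) triangle_finite[OF tO] card_subset_eq[of U f]
    by (simp add: triangle_in_def)
qed

lemma triangle_cone:
  assumes f: "triangle_in E f" and adj: "\<And>x. x \<in> f \<Longrightarrow> {v, x} \<in> E" and "v \<notin> f" "x \<in> f"
  shows "triangle_in E (insert v (f - {x}))"
proof -
  have fin: "finite f" using f triangle_finite by simp
  have c: "card (insert v (f - {x})) = 3" using assms fin by (simp add: triangle_in_def)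
  have "e \<in> E" if e: "e \<subseteq> insert v (f - {x})" "card e = 2" for e
  proof (cases "v \<in> e")
    case True
    have "finite e" using e(2) card.infinite by fastforce
    then have "card (e - {v}) = 1" using True e(2) by simp
    then obtain y where y: "e - {v} = {y}" by (auto simp: card_1_singleton_iff)
    then have "e = {v, y}" using True by auto
    moreover have "y \<in> f" using y e(1) by auto
    ultimately show ?thesis using adj by simp
  next
    case False
    then have "e \<subseteq> f" using e(1) by auto
    then show ?thesis using f e(2) by (simp add: triangle_in_def)
  qed
  then show ?thesis using c by (simp add: triangle_in_def)
qed

lemma triangle_third:
  assumes f: "triangle_in E f" and xy: "x \<in> f" "y \<in> f" "x \<noteq> y"
  obtains z where "f - {x, y} = {z}" "z \<in> f"
proof -
  have "card (f - {x, y}) = 1"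
    using f xy triangle_finite[OF f] by (simp add: triangle_in_def card_Diff_subset)
  then obtain z where z: "f - {x, y} = {z}" by (auto simp: card_1_singleton_iff)
  then have "z \<in> f" by auto
  then show ?thesis using that z by blast
qed

text \<open>The three cones from vertex \<open>k\<close> replace \<open>t\<close>. Two of them share
  only an edge at \<open>k\<close>, which no other vertex may touch, so later vertices still have a
  unique face.\<close>

lemma face_structure_inside:
  assumes fs: "face_structure n p k E B U" and k: "k < n"
    and t: "t \<in> B" "p k \<in> H t" and adj: "\<And>x. x \<in> t \<Longrightarrow> {k, x} \<in> E"
  shows "face_structure n p (Suc k) E (B - {t} \<union> (\<lambda>x. insert k (t - {x})) ` t) U"
proof -
  note fs' = face_structureD[OF fs]
  have tt: "triangle_in E t" "t \<subseteq> {..<k}" using fs'(1,2) t by auto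
  have kt: "k \<notin> t" using tt(2) by auto
  have sub: "H (insert k (t - {x})) \<subseteq> H t" for x by (rule hull_insert_subset[OF t(2)]) auto
  have apex: "j = k \<or> j \<in> {k, z}"
    if j: "j < n" "p j \<in> H (insert k (S \<inter> T))" "S \<inter> T = {} \<or> S \<inter> T = {z} \<and> z \<in> t" for j S T z
    using j(3)
  proof (elim disjE conjE)
    assume "S \<inter> T = {}"
    then have "p j = p k" using j by simp
    then show ?thesis using inj_onD[OF inj_p, of j k] j(1) k by simp
  next
    assume "S \<inter> T = {z}" "z \<in> t"
    then show ?thesis using on_edge[OF adj[of z] j(1)] j(2) by auto
  qed
  have two: "j \<in> insert k (t - {x, y})"
    if j: "j < n" "p j \<in> H (insert k (t - {x}))" "p j \<in> H (insert k (t - {y}))" and xy: "x \<in> t" "y \<in> t" "x \<noteq> y"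
    for j x y
  proof -
    obtain z where z: "t - {x, y} = {z}" "z \<in> t" using triangle_third[OF tt(1) xy] by blast
    have "(t - {x}) \<inter> (t - {y}) = t - {x, y}" by auto
    then show ?thesis
      using apex[of j "t - {x}" "t - {y}" z] triangle_exchange_unique[OF tt(1) t(2) _ _ j(2,3)] j(1) z by auto
  qed
  show ?thesis
  proof (rule face_structureI)
    fix f assume f: "f \<in> insert U (B - {t} \<union> (\<lambda>x. insert k (t - {x})) ` t)"
    then consider "f \<in> insert U B" | x where "x \<in> t" "f = insert k (t - {x})" by auto
    then have "triangle_in E f \<and> f \<subseteq> {..<Suc k}"
    proof cases
      case 1
      then show ?thesis using fs'(1,2)[of f] by fastforce
    next
      case 2
      then show ?thesis using triangle_cone[OF tt(1) adj kt] tt(2) by fastforce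
    qed
    then show "triangle_in E f" "f \<subseteq> {..<Suc k}" by auto
  next
    fix f assume f: "f \<in> B - {t} \<union> (\<lambda>x. insert k (t - {x})) ` t"
    then show "H f \<subseteq> H U" using fs'(3) sub t(1) by blast
  next
    fix j assume j: "Suc k \<le> j" "j < n" "p j \<in> H U"
    then obtain f where f: "f \<in> B" "p j \<in> H f" using fs'(4)[of j] by auto
    show "\<exists>f\<in>B - {t} \<union> (\<lambda>x. insert k (t - {x})) ` t. p j \<in> H f"
    proof (cases "f = t")
      case True
      then obtain a where "a \<in> t" "p j \<in> H (insert k (t - {a}))"
        using triangle_exchange[OF tt(1) t(2)] f(2) by blast
      then show ?thesis by blast
    qed (use f in blast)
  next
    fix j f g assume j: "Suc k \<le> j" "j < n"
      and fg: "f \<in> B - {t} \<union> (\<lambda>x. insert k (t - {x})) ` t" "g \<in> B - {t} \<union> (\<lambda>x. insert k (t - {x})) ` t"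
      "p j \<in> H f" "p j \<in> H g"
    have old: "p j \<in> H h \<Longrightarrow> p j \<in> H h' \<Longrightarrow> h \<in> B \<Longrightarrow> h' \<in> B \<Longrightarrow> h = h'" for h h'
      using fs'(5)[of j h h'] j by simp
    have new: False if "h \<in> B - {t}" "p j \<in> H h" "p j \<in> H (insert k (t - {x}))" for h x
      using old[of h t] that t(1) sub by blast
    consider "f \<in> B" "g \<in> B" | x where "f \<in> B - {t}" "g = insert k (t - {x})"
      | x where "g \<in> B - {t}" "f = insert k (t - {x})"
      | x y where "x \<in> t" "y \<in> t" "f = insert k (t - {x})" "g = insert k (t - {y})" using fg(1,2) by blast
    then show "f = g"
    proof cases
      case 1
      then show ?thesis using old fg by blast
    next
      case 2
      then show ?thesis using new fg by blast
    next
      case 3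
      then show ?thesis using new fg by blast
    next
      case (4 x y)
      show ?thesis
      proof (rule ccontr)
        assume "f \<noteq> g"
        then have "x \<noteq> y" using 4 by auto
        then have "j \<in> insert k (t - {x, y})" using two[of j x y] 4 fg j by blast
        then show False using j tt(2) by auto
      qed
    qed
  next
    fix j f assume j: "j < Suc k" and f: "f \<in> B - {t} \<union> (\<lambda>x. insert k (t - {x})) ` t" "p j \<in> H f"
    consider "j = k" "f \<in> B - {t}" | "j < k" "f \<in> B"
      | x where "x \<in> t" "f = insert k (t - {x})" using f j by fastforce
    then show "j \<in> f"
    proof cases
      case 1
      then show ?thesis using fs'(5)[of k f t] k t f by auto
    next
      case 2
      then show ?thesis using fs'(6) f by blast
    next
      case (3 x)
      show ?thesis
      proof (cases "j = k")
        case False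
        then have jk: "j < k" using j by simp
        have "p j \<in> H t" using 3 f sub by blast
        then have jt: "j \<in> t" using fs'(6)[OF jk t(1)] by blast
        \<comment> \<open>The cone over \<open>t - {x}\<close> and the cone over \<open>{x}\<close>
          share only the apex, so a corner \<open>x\<close> in the former would coincide with vertex
          \<open>k\<close>.\<close>
        have "j \<noteq> x"
        proof
          assume jx: "j = x"
          have "p j \<in> H (insert k {x})" using jx by (auto intro: hull_inc)
          then have "p j \<in> H (insert k ((t - {x}) \<inter> {x}))"
            using triangle_exchange_unique[OF tt(1) t(2), of "t - {x}" "{x}" "p j"] 3 f by auto
          then have "j = k" using apex[of j "t - {x}" "{x}"] jk k by auto
          then show False using jk by simp
        qed
        then show ?thesis using 3 jt by auto
      qed (use 3 in auto)
    qed
  next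
    fix j assume "j < Suc k"
    then show "p j \<in> H U" using fs'(7)[of j] fs'(3)[OF t(1)] t(2) by (auto simp: less_Suc_eq)
  qed
qed

text \<open>Radon's theorem for the four points of a drawn complete graph. A partition into two
  pairs would be a crossing of disjoint edges, so one point lies in the triangle of the other three;
  it is not \<open>v\<close>, which lies outside.\<close>

lemma outer_swap:
  assumes U: "triangle_in E U" and v: "v < n" "v \<notin> U" "p v \<notin> H U" and adj: "\<And>x. x \<in> U \<Longrightarrow> {v, x} \<in> E"
  obtains c where "c \<in> U" "p c \<in> H (insert v (U - {c}))"
proof -
  let ?Q = "insert v U"
  have fin: "finite U" using triangle_finite[OF U] .
  have Qn: "?Q \<subseteq> {..<n}" using triangle_subset[OF U] v by auto
  have cQ: "card ?Q = 4" using U v fin by (simp add: triangle_in_def)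
  have edge: "e \<in> E" if "e \<subseteq> ?Q" "card e = 2" for e
  proof (cases "v \<in> e")
    case True
    have "finite e" using that(2) card.infinite by fastforce
    then have "card (e - {v}) = 1" using True that(2) by simp
    then obtain y where y: "e - {v} = {y}" by (auto simp: card_1_singleton_iff)
    then have "e = {v, y}" "y \<in> U" using True that by auto
    then show ?thesis using adj by simp
  next
    case False
    then have "e \<subseteq> U" using that by auto
    then show ?thesis using U that(2) by (simp add: triangle_in_def)
  qed
  have injQ: "inj_on p ?Q" using inj_on_subset[OF inj_p Qn] .
  have "card (p ` ?Q) = 4" using card_image[OF injQ] cQ by simp
  then have "affine_dependent (p ` ?Q)" using fin by (intro affine_dependent_biggerset) auto
  then obtain M P where MP: "M \<inter> P = {}" "M \<union> P = p ` ?Q" "convex hull M \<inter> convex hull P \<noteq> {}"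
    using Radon_partition[of "p ` ?Q"] fin by auto
  define A where "A = {i \<in> ?Q. p i \<in> M}"
  define A' where "A' = {i \<in> ?Q. p i \<in> P}"
  have M: "M = p ` A" "P = p ` A'" using MP(2) by (auto simp: A_def A'_def)
  have AA: "A \<union> A' = ?Q" "A \<inter> A' = {}" using MP by (auto simp: A_def A'_def)
  have finA: "finite A" "finite A'" using fin by (auto simp: A_def A'_def)
  have cA: "card A + card A' = 4" using card_Un_disjoint[OF finA AA(2)] AA(1) cQ by simp
  have ne: "H A \<inter> H A' \<noteq> {}" using MP(3) M by simp
  have single: thesis if c: "card S = 1" "S \<union> S' = ?Q" "S \<inter> S' = {}" "H S \<inter> H S' \<noteq> {}" for S S'
  proof -
    obtain c where S: "S = {c}" using c(1) by (auto simp: card_1_singleton_iff)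
    then have pc: "p c \<in> H S'" "S' = ?Q - {c}" using c by auto
    have "c \<noteq> v" using pc v by auto
    then have "c \<in> U" "S' = insert v (U - {c})" using pc S c by auto
    then show thesis using pc \<open>\<And>c. c \<in> U \<Longrightarrow> p c \<in> H (insert v (U - {c})) \<Longrightarrow> thesis\<close> by blast
  qed
  have "card A \<noteq> 0" "card A' \<noteq> 0" using ne finA by auto
  then consider "card A = 1" | "card A = 2" "card A' = 2" | "card A' = 1" using cA by linarith
  then show thesis
  proof cases
    case 1
    then show thesis using single[of A A'] AA ne by auto
  next
    case 2
    then have "A \<in> E" "A' \<in> E" using edge AA by auto
    then show thesis using disjoint_edges AA(2) ne by blast
  next
    case 3
    then show thesis using single[of A' A] AA ne by (auto simp: Un_commute Int_commute)
  qed
qed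

text \<open>The corner \<open>c\<close> is swallowed by the new outer triangle. Seen from
  \<open>c\<close>, that triangle splits into three cones: the old outer triangle \<open>U\<close>
  and the two new bounded faces. So the situation is a subdivision with apex \<open>c\<close>
  instead of \<open>k\<close>, and the triangles that appear are the same as after stacking on
  \<open>U\<close>.\<close>

lemma face_structure_outside:
  assumes fs: "face_structure n p k E B U" and k: "k < n"
    and out: "p k \<notin> H U" and adj: "\<And>x. x \<in> U \<Longrightarrow> {k, x} \<in> E"
  obtains c where "c \<in> U" "face_structure n p (Suc k) E
      (B \<union> (\<lambda>x. insert k (U - {x})) ` (U - {c})) (insert k (U - {c}))"
proof -
  note fs' = face_structureD[OF fs]
  have tO: "triangle_in E U" "U \<subseteq> {..<k}" using fs'(1,2) by auto
  have kO: "k \<notin> U" using tO(2) by auto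
  obtain c where c: "c \<in> U" "p c \<in> H (insert k (U - {c}))"
    using outer_swap[OF tO(1) k kO out adj] by blast
  let ?U = "insert k (U - {c})"
  let ?new = "\<lambda>x. insert k (U - {x})"
  have ck: "c < k" "c \<noteq> k" using c(1) tO(2) by auto
  have tO': "triangle_in E ?U" by (rule triangle_cone[OF tO(1) adj kO c(1)])
  have O_cone: "insert c (U - {c}) = U" using c(1) by auto
  \<comment> \<open>Rewrites the new faces as cones from \<open>c\<close> within the new outer
    triangle, the form to which the exchange lemmas apply.\<close>
  have new_cone: "?new x = insert c (?U - {x})" if "x \<in> U - {c}" for x using that c(1) kO by auto
  have OO: "H U \<subseteq> H ?U" using hull_insert_subset[OF c(2), of "U - {c}"] unfolding O_cone by blast
  have newO: "H (?new x) \<subseteq> H ?U" if "x \<in> U - {c}" for x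
    using hull_insert_subset[OF c(2), of "?U - {x}"] new_cone[OF that] by auto
  have old_new: "j \<in> ?new x" "j < k" if j: "j < n" "p j \<in> H U" "p j \<in> H (?new x)" and x: "x \<in> U - {c}" for j x
  proof -
    have "p j \<in> H (insert c ((U - {c}) \<inter> (?U - {x})))"
      using j x O_cone new_cone[OF x]
      by (intro triangle_exchange_unique[OF tO' c(2)]) auto
    moreover obtain y where y: "U - {c, x} = {y}" "y \<in> U"
      using triangle_third[OF tO(1) c(1), of x] x by blast
    moreover have "(U - {c}) \<inter> (?U - {x}) = U - {c, x}" using kO by auto
    ultimately have "p j \<in> H {c, y}" by simp
    moreover have "{c, y} \<in> E"
    proof -
      have "c \<noteq> y" using y by auto
      then show ?thesis using tO(1) c(1) y(2) by (simp add: triangle_in_def)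
    qed
    ultimately have "j \<in> {c, y}" using on_edge j(1) by blast
    then show "j \<in> ?new x" "j < k" using y c(1) x tO(2) by auto
  qed
  have new_new: "j \<in> {c, k}" if j: "j < n" "p j \<in> H (?new x)" "p j \<in> H (?new y)"
    and xy: "x \<in> U - {c}" "y \<in> U - {c}" "x \<noteq> y" for j x y
  proof -
    have "p j \<in> H (insert c ((?U - {x}) \<inter> (?U - {y})))"
      using j new_cone[OF xy(1)] new_cone[OF xy(2)]
      by (intro triangle_exchange_unique[OF tO' c(2)]) auto
    moreover have "(?U - {x}) \<inter> (?U - {y}) = {k}"
    proof -
      obtain z where z: "U - {x, y} = {z}" using triangle_third[OF tO(1), of x y] xy by blast
      moreover have "c \<in> U - {x, y}" using c(1) xy by blast
      ultimately have "U - {x, y} = {c}" by simp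
      then have "w = c" if "w \<in> U" "w \<noteq> x" "w \<noteq> y" for w using that by blast
      moreover have "k \<noteq> x" "k \<noteq> y" using kO xy by auto
      ultimately show ?thesis by blast
    qed
    ultimately have "p j \<in> H {c, k}" by simp
    moreover have "{c, k} \<in> E" using adj[OF c(1)] by (simp add: insert_commute)
    ultimately show ?thesis using on_edge j(1) by blast
  qed
  have "face_structure n p (Suc k) E (B \<union> ?new ` (U - {c})) ?U"
  proof (rule face_structureI)
    fix f assume f: "f \<in> insert ?U (B \<union> ?new ` (U - {c}))"
    then consider "f \<in> B" | x where "x \<in> U" "f = ?new x" using c(1) by blast
    then have "triangle_in E f \<and> f \<subseteq> {..<Suc k}"
    proof cases
      case 1
      then show ?thesis using fs'(1,2)[of f] by fastforce
    next
      case 2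
      then show ?thesis using triangle_cone[OF tO(1) adj kO] tO(2) by fastforce
    qed
    then show "triangle_in E f" "f \<subseteq> {..<Suc k}" by auto
  next
    fix f assume f: "f \<in> B \<union> ?new ` (U - {c})"
    then show "H f \<subseteq> H ?U" using fs'(3) OO newO by blast
  next
    fix j assume j: "Suc k \<le> j" "j < n" "p j \<in> H ?U"
    obtain a where a: "a \<in> ?U" "p j \<in> H (insert c (?U - {a}))"
      using triangle_exchange[OF tO' c(2) j(3)] by blast
    show "\<exists>f\<in>B \<union> ?new ` (U - {c}). p j \<in> H f"
    proof (cases "a = k")
      case True
      then have "insert c (?U - {a}) = U" using O_cone kO by auto
      then show ?thesis using fs'(4)[of j] a(2) j by auto
    next
      case False
      then have ac: "a \<in> U - {c}" using a(1) by auto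
      then have "p j \<in> H (?new a)" using a(2) unfolding new_cone[OF ac] by simp
      then show ?thesis using ac by blast
    qed
  next
    fix j f g assume j: "Suc k \<le> j" "j < n"
      and fg: "f \<in> B \<union> ?new ` (U - {c})" "g \<in> B \<union> ?new ` (U - {c})" "p j \<in> H f" "p j \<in> H g"
    have no: False if "h \<in> B" "p j \<in> H h" "x \<in> U - {c}" "p j \<in> H (?new x)" for h x
      using old_new(2)[of j x] that fs'(3) j by auto
    consider "f \<in> B" "g \<in> B" | x where "f \<in> B" "x \<in> U - {c}" "g = ?new x"
      | x where "g \<in> B" "x \<in> U - {c}" "f = ?new x"
      | x y where "x \<in> U - {c}" "y \<in> U - {c}" "f = ?new x" "g = ?new y" using fg(1,2) by blast
    then show "f = g"
    proof cases
      case 1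
      then show ?thesis using fs'(5)[of j f g] fg j by simp
    next
      case 2
      then show ?thesis using no fg by blast
    next
      case 3
      then show ?thesis using no fg by blast
    next
      case (4 x y)
      then show ?thesis using new_new[of j x y] fg j ck by (cases "x = y") auto
    qed
  next
    fix j f assume j: "j < Suc k" and f: "f \<in> B \<union> ?new ` (U - {c})" "p j \<in> H f"
    consider "j = k" "f \<in> B" | "j < k" "f \<in> B" | "j = k" "f \<notin> B"
      | x where "j < k" "x \<in> U - {c}" "f = ?new x" using f j by fastforce
    then show "j \<in> f"
    proof cases
      case 1
      then show ?thesis using fs'(3) out f by blast
    next
      case 2
      then show ?thesis using fs'(6) f by blast
    next
      case 3
      then show ?thesis using f by auto
    next
      case (4 x)
      then show ?thesis using old_new(1)[of j x] fs'(7)[of j] f k by auto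
    qed
  next
    fix j assume "j < Suc k"
    moreover have "p k \<in> H ?U" by (auto intro: hull_inc)
    ultimately show "p j \<in> H ?U" using fs'(7)[of j] OO by (auto simp: less_Suc_eq)
  qed
  then show thesis using that c(1) by blast
qed

end

lemma outer_not_in_stacked:
  assumes "C \<in> stacked m" "0 < m" shows "{..<3} \<notin> C"
  using assms
proof (induction m arbitrary: C)
  case (Suc m)
  then obtain D f where D: "D \<in> stacked m" "f \<in> D" "card f = 3" "C = stack (m + 3) f D" by auto
  have "{..<3} \<notin> insert (m + 3) ` {S. S \<subset> f}"
  proof
    assume "{..<3} \<in> insert (m + 3) ` {S. S \<subset> f}"
    then have "m + 3 \<in> {..<3::nat}" by blast
    then show False by simp
  qed
  moreover have "{..<3} \<notin> D - {f}"
  proof (cases "m = 0")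
    case True
    then have "f = {..<3}" using D card_subset_eq[of "{..<3::nat}" f] by simp
    then show ?thesis by simp
  qed (use Suc.IH[OF D(1)] in simp)
  ultimately show ?case using D(4) by (simp add: stack_def)
qed simp

lemma cone_in_edges_of_stack:
  assumes "C \<in> stacked m" "f \<in> C" "card f = 3" "x \<in> f"
  shows "{m + 3, x} \<in> edges_of (stack (m + 3) f C)"
  unfolding edges_of_stack[OF assms(1-3)] using assms(4) by blast

lemma edges_of_subset_stack:
  assumes "C \<in> stacked m" "f \<in> C" "card f = 3"
  shows "edges_of C \<subseteq> edges_of (stack (m + 3) f C)"
  unfolding edges_of_stack[OF assms] by blast

text \<open>Which triangle is outer depends on the drawing, but the set of all of them is
  \<open>insert {..<3} (faces_of C)\<close>, determined by \<open>C\<close>. For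
  \<open>m = 0\<close> the single triangle is outer and bounded at once, which the last clause
  records; afterwards the two roles are distinct, and a step replaces exactly one triangle.\<close>

lemma stacked_face_structure:
  assumes "C \<in> stacked m" "m + 3 \<le> n" "disjoint_drawing n p (edges_of C)"
  shows "\<exists>B U. face_structure n p (m + 3) (edges_of C) B U \<and>
     insert U B = insert {..<3} (faces_of C) \<and> (U \<in> B \<longleftrightarrow> m = 0)"
  using assms
proof (induction m arbitrary: C)
  case 0
  have "f = {..<3}" if "f \<subseteq> {..<3}" "card f = 3" for f :: "nat set"
    using card_subset_eq[of "{..<3::nat}" f] that by simp
  then have F: "insert {..<3} (faces_of C) = {{..<3}}" using 0 by auto
  have "triangle_in (edges_of C) {..<3}" using 0 by (auto simp: triangle_in_def)
  then have "face_structure n p (0 + 3) (edges_of C) {{..<3}} {..<3}"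
    by (intro face_structureI) (auto intro: hull_inc)
  then show ?case using F by (intro exI[of _ "{{..<3}}"] exI[of _ "{..<3}"]) simp
next
  case (Suc m)
  then obtain D f where D: "D \<in> stacked m" "f \<in> D" "card f = 3" "C = stack (m + 3) f D" by auto
  let ?k = "m + 3" and ?new = "\<lambda>x. insert (m + 3) (f - {x})"
  have k: "?k < n" using Suc.prems by simp
  have ED: "edges_of D \<subseteq> edges_of C" unfolding D(4) by (rule edges_of_subset_stack[OF D(1-3)])
  have fC: "faces_of C = (faces_of D - {f}) \<union> ?new ` f" unfolding D(4) by (rule faces_of_stack[OF D(1-3)])
  have adj: "{?k, x} \<in> edges_of C" if "x \<in> f" for x
    unfolding D(4) by (rule cone_in_edges_of_stack[OF D(1-3) that])
  obtain B U where BU: "face_structure n p ?k (edges_of D) B U"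
    "insert U B = insert {..<3} (faces_of D)" "U \<in> B \<longleftrightarrow> m = 0"
    using Suc.IH[OF D(1)] disjoint_drawing_subset[OF Suc.prems(3) ED] k by auto
  interpret drawn_edges n p "edges_of C" by unfold_locales (rule Suc.prems(3))
  have fs: "face_structure n p ?k (edges_of C) B U" by (rule face_structure_mono[OF BU(1) ED])
  have kU: "?k \<notin> g" if "g \<in> insert U B" for g using face_structureD(2)[OF fs that] by auto
  have kf: "?k \<notin> f" using stacked_simplex[OF D(1,2)] by auto
  have f: "f \<in> insert U B" using BU(2) D(2,3) by simp
  have base: "faces_of D = {{..<3}} \<and> f = {..<3} \<and> B \<subseteq> {{..<3}} \<and> U = {..<3}" if "m = 0"
  proof -
    have "card (faces_of D) = 1" using card_faces_of[OF D(1)] that by simp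
    then obtain g where g: "faces_of D = {g}" by (auto simp: card_1_singleton_iff)
    have "{..<3} \<in> faces_of D" using D(1) that by simp
    then have "faces_of D = {{..<3}}" using g by simp
    moreover have "f \<in> faces_of D" using D by simp
    ultimately show ?thesis using BU(2) by auto
  qed
  \<comment> \<open>After the first step nothing is stacked on \<open>{..<3}\<close>, even if the
    drawing shows it as a bounded face; otherwise it would drop out of the set of triangles.\<close>
  have notouter: "{..<3} \<notin> faces_of D" if "m \<noteq> 0" using outer_not_in_stacked[OF D(1)] that by simp
  show ?case
  proof (cases "p ?k \<in> H U")
    case True
    then obtain b where b: "b \<in> B" "p ?k \<in> H b" using face_structureD(4)[OF fs _ k] by auto
    have fb: "f = b" by (rule located_in_bounded_face[OF fs _ b f adj]) simp_all
    have "face_structure n p (Suc ?k) (edges_of C) (B - {f} \<union> ?new ` f) U"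
      by (rule face_structure_inside[OF fs k]) (use b fb adj in auto)
    moreover have "insert U (B - {f} \<union> ?new ` f) = insert {..<3} (faces_of C)"
    proof (cases "m = 0")
      case True
      then show ?thesis unfolding fC using base by auto
    next
      case False
      have "f \<noteq> {..<3}" using notouter[OF False] D(2,3) by auto
      moreover have "f \<noteq> U" using BU(3) b(1) fb False by auto
      ultimately show ?thesis unfolding fC using BU(2) by blast
    qed
    moreover have "U \<notin> B - {f} \<union> ?new ` f"
    proof -
      have "U \<notin> ?new ` f" using kU[of U] by auto
      moreover have "U \<notin> B - {f}" using BU(3) base by auto
      ultimately show ?thesis by simp
    qed
    ultimately show ?thesis by (intro exI[of _ "B - {f} \<union> ?new ` f"] exI[of _ U]) simp
  next
    case False
    have fU: "f = U" by (rule located_outside[OF fs _ False f adj]) simp_all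
    have adjU: "{?k, x} \<in> edges_of C" if "x \<in> U" for x using adj[of x] fU that by simp
    obtain c where c: "c \<in> f" "face_structure n p (Suc ?k) (edges_of C) (B \<union> ?new ` (f - {c})) (?new c)"
      unfolding fU by (rule face_structure_outside[OF fs k False adjU])
    note c(2)
    moreover have "insert (?new c) (B \<union> ?new ` (f - {c})) = insert {..<3} (faces_of C)"
    proof -
      have "insert (?new c) (B \<union> ?new ` (f - {c})) = B \<union> ?new ` f" using c(1) by blast
      also have "\<dots> = insert {..<3} (faces_of C)"
      proof (cases "m = 0")
        case True
        then have "B = {{..<3}}" using base BU(3) by auto
        then show ?thesis unfolding fC using base[OF True] by auto
      next
        case False
        have "f \<noteq> {..<3}" using notouter[OF False] D(2,3) by auto
        moreover have "f \<notin> B" using BU(3) fU False by auto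
        ultimately show ?thesis unfolding fC using BU(2) fU by blast
      qed
      finally show ?thesis .
    qed
    moreover have "?new c \<notin> B \<union> ?new ` (f - {c})"
    proof -
      have "?new c \<notin> B" using kU by blast
      moreover have "?new c \<noteq> ?new x" if x: "x \<in> f - {c}" for x
      proof -
        have "x \<in> ?new c" "x \<notin> ?new x" using x kf by auto
        then show ?thesis by metis
      qed
      ultimately show ?thesis by blast
    qed
    ultimately show ?thesis by (intro exI[of _ "B \<union> ?new ` (f - {c})"] exI[of _ "?new c"]) simp
  qed
qed

text \<open>By induction both triangulations agree before the last vertex, so they share one face
  structure. The position of the last vertex then forces the face it is stacked on.\<close>

lemma stacked_unique:
  assumes "C \<in> stacked m" "D \<in> stacked m" "m + 3 \<le> n"
    "disjoint_drawing n p (edges_of C)" "disjoint_drawing n p (edges_of D)"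
  shows "C = D"
  using assms
proof (induction m arbitrary: C D)
  case 0
  then show ?case by simp
next
  case (Suc m)
  let ?k = "m + 3"
  obtain C' f where C': "C' \<in> stacked m" "f \<in> C'" "card f = 3" "C = stack ?k f C'" using Suc.prems(1) by auto
  obtain D' g where D': "D' \<in> stacked m" "g \<in> D'" "card g = 3" "D = stack ?k g D'" using Suc.prems(2) by auto
  have k: "?k < n" using Suc.prems by simp
  have EC: "edges_of C' \<subseteq> edges_of C" unfolding C'(4) by (rule edges_of_subset_stack[OF C'(1-3)])
  have ED: "edges_of D' \<subseteq> edges_of D" unfolding D'(4) by (rule edges_of_subset_stack[OF D'(1-3)])
  have drC: "disjoint_drawing n p (edges_of C')" by (rule disjoint_drawing_subset[OF Suc.prems(4) EC])
  have drD: "disjoint_drawing n p (edges_of D')" by (rule disjoint_drawing_subset[OF Suc.prems(5) ED])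
  have eq: "C' = D'" by (rule Suc.IH[OF C'(1) D'(1) _ drC drD]) (use k in simp)
  have adjC: "{?k, x} \<in> edges_of C" if "x \<in> f" for x
    unfolding C'(4) by (rule cone_in_edges_of_stack[OF C'(1-3) that])
  have adjD: "{?k, x} \<in> edges_of D" if "x \<in> g" for x
    unfolding D'(4) by (rule cone_in_edges_of_stack[OF D'(1-3) that])
  obtain B U where BU: "face_structure n p ?k (edges_of C') B U" "insert U B = insert {..<3} (faces_of C')"
    using stacked_face_structure[OF C'(1) _ drC] k by auto
  have fg: "f \<in> insert U B" "g \<in> insert U B" using BU(2) C' D' eq by auto
  have fsC: "face_structure n p ?k (edges_of C) B U" by (rule face_structure_mono[OF BU(1) EC])
  have fsD: "face_structure n p ?k (edges_of D) B U" by (rule face_structure_mono[OF BU(1)]) (use ED eq in simp)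
  interpret C: drawn_edges n p "edges_of C" by unfold_locales (rule Suc.prems(4))
  interpret D: drawn_edges n p "edges_of D" by unfold_locales (rule Suc.prems(5))
  have "f = g"
  proof (cases "p ?k \<in> convex hull (p ` U)")
    case True
    then obtain b where b: "b \<in> B" "p ?k \<in> convex hull (p ` b)" using face_structureD(4)[OF fsC _ k] by auto
    have "f = b" by (rule C.located_in_bounded_face[OF fsC _ b fg(1) adjC]) simp_all
    moreover have "g = b" by (rule D.located_in_bounded_face[OF fsD _ b fg(2) adjD]) simp_all
    ultimately show ?thesis by simp
  next
    case False
    have "f = U" by (rule C.located_outside[OF fsC _ False fg(1) adjC]) simp_all
    moreover have "g = U" by (rule D.located_outside[OF fsD _ False fg(2) adjD]) simp_all
    ultimately show ?thesis by simp
  qed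
  then show ?case using C' D' eq by simp
qed

lemma crossing_free_disjoint_drawing:
  assumes C: "C \<in> stacked m" and cf: "crossing_free (graph_of (m + 3) C) p (\<lambda>e. convex hull (p ` e))"
  shows "disjoint_drawing (m + 3) p (edges_of C)"
  unfolding disjoint_drawing_def
proof (intro conjI ballI impI allI)
  show "inj_on p {..<m + 3}" using cf by (simp add: crossing_free_def graph_of_def)
  fix e assume e: "e \<in> edges_of C"
  then show "card e = 2" "e \<subseteq> {..<m + 3}" using stacked_simplex[OF C, of e] by auto
  show "p w \<notin> convex hull (p ` e)" if "w < m + 3" "w \<notin> e" for w
    using cf e that by (auto simp: crossing_free_def graph_of_def)
  fix f assume f: "f \<in> edges_of C" "e \<inter> f = {}"
  then have "e \<noteq> f" using e by auto
  then have "convex hull (p ` e) \<inter> convex hull (p ` f) \<subseteq> p ` (e \<inter> f)"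
    using cf e f(1) by (simp add: crossing_free_def graph_of_def)
  then show "convex hull (p ` e) \<inter> convex hull (p ` f) = {}" using f(2) by simp
qed

text \<open>A geometric proof of a combinatorial fact: a drawing of \<open>C\<close> is also one of
  \<open>D\<close> when the edges agree, and a placement carries at most one triangulation.\<close>

lemma edges_of_inject:
  assumes "C \<in> stacked m" "D \<in> stacked m" "edges_of C = edges_of D"
  shows "C = D"
proof -
  obtain p where "simplicial_drawing (m + 3) p C" using simplicial_drawing_exists[OF assms(1)] by blast
  from crossing_free_disjoint_drawing[OF assms(1) crossing_free_simplicial_drawing[OF assms(1) this]]
  show ?thesis using stacked_unique[OF assms(1,2), of "m + 3" p] assms(3) by simp
qed

text \<open>Different choices give different results: the edges avoiding the last vertex recover
  \<open>C\<close>, and the neighbours of that vertex recover \<open>f\<close>. Each complex offers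
  \<open>2 * m + 1\<close> faces.\<close>

lemma card_stacked: "finite (stacked m) \<and> card (stacked m) = (\<Prod>j<m. 2 * j + 1)"
proof (induction m)
  case (Suc m)
  let ?\<Sigma> = "SIGMA C:stacked m. {f \<in> C. card f = 3}" and ?s = "\<lambda>(C, f). stack (m + 3) f C"
  have "inj_on ?s ?\<Sigma>"
  proof (rule inj_onI, clarify)
    fix C f D g assume C: "C \<in> stacked m" "f \<in> C" "card f = 3" and D: "D \<in> stacked m" "g \<in> D" "card g = 3"
      and eq: "stack (m + 3) f C = stack (m + 3) g D"
    have E: "edges_of C \<union> (\<lambda>x. {m + 3, x}) ` f = edges_of D \<union> (\<lambda>x. {m + 3, x}) ` g"
      unfolding edges_of_stack[OF C, symmetric] edges_of_stack[OF D, symmetric] eq ..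
    have nC: "m + 3 \<notin> s" if "s \<in> C" for s using stacked_simplex[OF C(1) that] by auto
    have nD: "m + 3 \<notin> s" if "s \<in> D" for s using stacked_simplex[OF D(1) that] by auto
    have "edges_of C = {e \<in> edges_of C \<union> (\<lambda>x. {m + 3, x}) ` f. m + 3 \<notin> e}" using nC by auto
    also have "\<dots> = edges_of D" unfolding E using nD by auto
    finally have CD: "C = D" by (rule edges_of_inject[OF C(1) D(1)])
    have "f = {x. x \<noteq> m + 3 \<and> {m + 3, x} \<in> edges_of C \<union> (\<lambda>x. {m + 3, x}) ` f}"
      using nC nC[OF C(2)] by (auto simp: doubleton_eq_iff)
    also have "\<dots> = g" unfolding E using nD nD[OF D(2)] by (auto simp: doubleton_eq_iff)
    finally show "C = D \<and> f = g" using CD by simp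
  qed
  then have "card (stacked (Suc m)) = card ?\<Sigma>" by (simp add: card_image)
  also have "\<dots> = (\<Sum>C\<in>stacked m. card (faces_of C))"
    using Suc card_faces_of by (intro card_SigmaI) auto
  also have "\<dots> = (\<Sum>C\<in>stacked m. 2 * m + 1)" using card_faces_of by (intro sum.cong) auto
  also have "\<dots> = (\<Prod>j<Suc m. 2 * j + 1)" using Suc by simp
  finally have "card (stacked (Suc m)) = (\<Prod>j<Suc m. 2 * j + 1)" .
  moreover have "finite ?\<Sigma>" using Suc card_faces_of by (intro finite_SigmaI) auto
  ultimately show ?case by simp
qed simp

subsection \<open>Order types and drawings\<close>

text \<open>Twice the signed area of the triangle \<open>a b c\<close>, quadratic in the
  coordinates.\<close>

definition orient :: "real ^ 2 \<Rightarrow> real ^ 2 \<Rightarrow> real ^ 2 \<Rightarrow> real" where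
  "orient a b c = (b $ 1 - a $ 1) * (c $ 2 - a $ 2) - (b $ 2 - a $ 2) * (c $ 1 - a $ 1)"

lemma orient_line_param:
  assumes "orient c d a = 0" "c \<noteq> d"
  obtains t where "a = c + t *\<^sub>R (d - c)"
proof -
  have eq: "(d $ 1 - c $ 1) * (a $ 2 - c $ 2) = (d $ 2 - c $ 2) * (a $ 1 - c $ 1)"
    using assms(1) by (simp add: orient_def)
  have "d $ 1 - c $ 1 \<noteq> 0 \<or> d $ 2 - c $ 2 \<noteq> 0" using assms(2) by (auto simp: vec_eq_iff forall_2)
  then have "\<exists>t. a $ 1 - c $ 1 = t * (d $ 1 - c $ 1) \<and> a $ 2 - c $ 2 = t * (d $ 2 - c $ 2)"
  proof
    assume *: "d $ 1 - c $ 1 \<noteq> 0"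
    then show ?thesis using eq
      by (intro exI[of _ "(a $ 1 - c $ 1) / (d $ 1 - c $ 1)"] conjI)
         (simp_all only: nonzero_eq_divide_eq times_divide_eq_left not_False_eq_True, simp_all add: mult.commute)
  next
    assume *: "d $ 2 - c $ 2 \<noteq> 0"
    then show ?thesis using eq
      by (intro exI[of _ "(a $ 2 - c $ 2) / (d $ 2 - c $ 2)"] conjI)
         (simp_all only: nonzero_eq_divide_eq times_divide_eq_left not_False_eq_True, simp_all add: mult.commute)
  qed
  then obtain t where t: "a $ 1 - c $ 1 = t * (d $ 1 - c $ 1)" "a $ 2 - c $ 2 = t * (d $ 2 - c $ 2)" by blast
  have "a = c + t *\<^sub>R (d - c)" using t by (simp add: vec_eq_iff forall_2)
  then show ?thesis by (rule that)
qed

lemma orient_affine: "orient c d ((1 - t) *\<^sub>R a + t *\<^sub>R b) = (1 - t) * orient c d a + t * orient c d b"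
  by (simp add: orient_def algebra_simps)

lemma orient_self [simp]: "orient c d c = 0" "orient c d d = 0"
  by (simp_all add: orient_def algebra_simps)

text \<open>Orientations do not show the order of collinear points; coordinate differences do. This
  is one reason why patterns record both.\<close>

lemma mem_closed_segment_iff_orient:
  "w \<in> closed_segment a b \<longleftrightarrow>
     orient a b w = 0 \<and> (\<forall>i. 0 \<le> (w $ i - a $ i) * (b $ i - w $ i))"
proof
  assume "w \<in> closed_segment a b"
  then obtain t where t: "w = (1 - t) *\<^sub>R a + t *\<^sub>R b" "0 \<le> t" "t \<le> 1" by (auto simp: in_segment)
  have "(w $ i - a $ i) * (b $ i - w $ i) = t * (1 - t) * (b $ i - a $ i)\<^sup>2" for i
    by (simp add: t(1) algebra_simps power2_eq_square)
  then show "orient a b w = 0 \<and> (\<forall>i. 0 \<le> (w $ i - a $ i) * (b $ i - w $ i))"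
    using t by (simp add: orient_affine)
next
  assume w: "orient a b w = 0 \<and> (\<forall>i. 0 \<le> (w $ i - a $ i) * (b $ i - w $ i))"
  show "w \<in> closed_segment a b"
  proof (cases "a = b")
    case True
    have "w $ i = a $ i" for i
    proof -
      have "0 \<le> - ((w $ i - a $ i)\<^sup>2)" using w True by (simp add: power2_eq_square algebra_simps)
      then show ?thesis by simp
    qed
    then have "w = a" by (simp add: vec_eq_iff)
    then show ?thesis using True by simp
  next
    case False
    then obtain t where t: "w = a + t *\<^sub>R (b - a)" using orient_line_param w by blast
    obtain i where i: "a $ i \<noteq> b $ i" using False by (auto simp: vec_eq_iff)
    have "(w $ i - a $ i) * (b $ i - w $ i) = t * (1 - t) * (b $ i - a $ i)\<^sup>2"
      by (simp add: t algebra_simps power2_eq_square)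
    then have "0 \<le> t * (1 - t)" using w i by (metis zero_le_mult_iff zero_less_power2 right_minus_eq not_less)
    then have "0 \<le> t" "t \<le> 1" by (auto simp: zero_le_mult_iff)
    then show ?thesis using t by (auto simp: in_segment algebra_simps intro!: exI[of _ t])
  qed
qed

text \<open>With \<open>c\<close> and \<open>d\<close> at parameters 0 and 1 on their line, ends
  \<open>a\<close> and \<open>b\<close> outside the interval lie on opposite sides of it, as the
  segments meet; then \<open>c\<close> is between them.\<close>

lemma collinear_segments_overlap:
  assumes "orient c d a = 0" "orient c d b = 0" "c \<noteq> d" "r \<in> closed_segment a b" "r \<in> closed_segment c d"
  shows "a \<in> closed_segment c d \<or> b \<in> closed_segment c d \<or> c \<in> closed_segment a b"
proof -
  obtain x where x: "a = c + x *\<^sub>R (d - c)" using orient_line_param assms by blast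
  obtain y where y: "b = c + y *\<^sub>R (d - c)" using orient_line_param assms by blast
  obtain s where s: "r = (1 - s) *\<^sub>R c + s *\<^sub>R d" "0 \<le> s" "s \<le> 1" using assms(5) by (auto simp: in_segment)
  obtain t where t: "r = (1 - t) *\<^sub>R a + t *\<^sub>R b" "0 \<le> t" "t \<le> 1" using assms(4) by (auto simp: in_segment)
  have "c + s *\<^sub>R (d - c) = c + ((1 - t) * x + t * y) *\<^sub>R (d - c)"
    using s(1) t(1) unfolding x y by (simp add: algebra_simps)
  then have st: "s = (1 - t) * x + t * y" using assms(3) by simp
  show ?thesis
  proof (rule ccontr)
    assume neg: "\<not> ?thesis"
    have nx: "x < 0 \<or> 1 < x"
    proof (rule ccontr)
      assume "\<not> (x < 0 \<or> 1 < x)"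
      then have "a \<in> closed_segment c d" unfolding in_segment
        by (intro exI[of _ x]) (simp add: x algebra_simps)
      then show False using neg by simp
    qed
    have ny: "y < 0 \<or> 1 < y"
    proof (rule ccontr)
      assume "\<not> (y < 0 \<or> 1 < y)"
      then have "b \<in> closed_segment c d" unfolding in_segment
        by (intro exI[of _ y]) (simp add: y algebra_simps)
      then show False using neg by simp
    qed
    have "\<not> (x < 0 \<and> y < 0)"
    proof
      assume "x < 0 \<and> y < 0"
      then have "(1 - t) * x + t * y < 0"
        using t(2,3) convex_bound_lt[of x 0 y "1 - t" t] by simp
      then show False using st s by simp
    qed
    moreover have "\<not> (1 < x \<and> 1 < y)"
    proof
      assume "1 < x \<and> 1 < y"
      then have "(1 - t) * (-x) + t * (-y) < -1"
        using t(2,3) by (intro convex_bound_lt) auto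
      then show False using st s by (simp add: algebra_simps)
    qed
    ultimately have xy: "x < 0 \<and> 1 < y \<or> 1 < x \<and> y < 0" using nx ny by auto
    define u where "u = x / (x - y)"
    have u: "0 \<le> u" "u \<le> 1" "(1 - u) * x + u * y = 0"
      using xy by (auto simp: u_def field_simps)
    have "(1 - u) *\<^sub>R a + u *\<^sub>R b = c + ((1 - u) * x + u * y) *\<^sub>R (d - c)"
      unfolding x y by (simp add: algebra_simps)
    then have "c = (1 - u) *\<^sub>R a + u *\<^sub>R b" using u(3) by simp
    then have "c \<in> closed_segment a b" unfolding in_segment using u by blast
    then show False using neg by simp
  qed
qed

text \<open>The common point lies on the line \<open>c d\<close>, so a convex combination of the two
  orientations is zero. They do not vanish, since that would make the segments collinear and put an
  end of one on the other.\<close>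

lemma segment_sides_opposite:
  assumes r: "r \<in> closed_segment a b" "r \<in> closed_segment c d"
    and n: "a \<notin> closed_segment c d" "b \<notin> closed_segment c d" "c \<notin> closed_segment a b"
  shows "orient c d a * orient c d b < 0"
proof -
  obtain t where t: "r = (1 - t) *\<^sub>R a + t *\<^sub>R b" "0 \<le> t" "t \<le> 1" using r(1) by (auto simp: in_segment)
  have "t \<noteq> 0" "t \<noteq> 1" using t r(2) n by auto
  then have t': "0 < t" "t < 1" using t by auto
  have "c \<noteq> d" using r n(3) by auto
  have "orient c d r = 0" using r(2) by (simp add: mem_closed_segment_iff_orient)
  then have eq: "(1 - t) * orient c d a + t * orient c d b = 0" using t(1) by (simp add: orient_affine)
  have "orient c d a \<noteq> 0"
  proof
    assume a: "orient c d a = 0"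
    then have "orient c d b = 0" using eq t' by simp
    then show False using collinear_segments_overlap[OF a _ \<open>c \<noteq> d\<close> r] n by simp
  qed
  then have "orient c d a > 0 \<or> orient c d a < 0" by auto
  then show ?thesis
  proof
    assume a: "orient c d a > 0"
    then have "t * orient c d b < 0" using eq t' by (smt (verit) mult_pos_pos)
    then show ?thesis using a t' by (simp add: mult_less_0_iff)
  next
    assume a: "orient c d a < 0"
    then have "t * orient c d b > 0" using eq t' by (smt (verit) mult_pos_neg)
    then show ?thesis using a t' by (simp add: mult_less_0_iff zero_less_mult_iff)
  qed
qed

lemma opposite_sides_segments_intersect:
  assumes "orient a b c * orient a b d < 0" "orient c d a * orient c d b < 0"
  shows "closed_segment a b \<inter> closed_segment c d \<noteq> {}"
proof -
  define \<alpha> where "\<alpha> = orient a b c"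
  define \<beta> where "\<beta> = orient a b d"
  define \<gamma> where "\<gamma> = orient c d a"
  define \<delta> where "\<delta> = orient c d b"
  \<comment> \<open>The affine dependence of four points in the plane has orientations as
    coefficients. It makes the points with parameters \<open>u'\<close> and \<open>v'\<close>
    coincide.\<close>
  have rel: "\<beta> - \<alpha> = - (\<delta> - \<gamma>)" by (simp add: \<alpha>_def \<beta>_def \<gamma>_def \<delta>_def orient_def algebra_simps)
  have id: "\<beta> * c $ i - \<alpha> * d $ i = \<gamma> * b $ i - \<delta> * a $ i" for i
  proof -
    have "i = 1 \<or> i = 2" using exhaust_2 by auto
    then show ?thesis
      by (auto simp: \<alpha>_def \<beta>_def \<gamma>_def \<delta>_def orient_def algebra_simps)
  qed
  have u: "0 \<le> \<alpha> / (\<alpha> - \<beta>)" "\<alpha> / (\<alpha> - \<beta>) \<le> 1" "\<alpha> - \<beta> \<noteq> 0"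
    using assms(1) unfolding \<alpha>_def[symmetric] \<beta>_def[symmetric]
    by (auto simp: mult_less_0_iff field_simps divide_le_eq_1 zero_le_divide_iff)
  have v: "0 \<le> \<gamma> / (\<gamma> - \<delta>)" "\<gamma> / (\<gamma> - \<delta>) \<le> 1" "\<gamma> - \<delta> \<noteq> 0"
    using assms(2) unfolding \<gamma>_def[symmetric] \<delta>_def[symmetric]
    by (auto simp: mult_less_0_iff field_simps divide_le_eq_1 zero_le_divide_iff)
  define u' where "u' = \<alpha> / (\<alpha> - \<beta>)"
  define v' where "v' = \<gamma> / (\<gamma> - \<delta>)"
  have "(1 - u') *\<^sub>R c + u' *\<^sub>R d = (1 - v') *\<^sub>R a + v' *\<^sub>R b"
  proof (simp add: vec_eq_iff, intro allI)
    fix i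
    have "1 - u' = - \<beta> / (\<alpha> - \<beta>)" "1 - v' = - \<delta> / (\<gamma> - \<delta>)" using u(3) v(3) by (simp_all add: u'_def v'_def field_simps)
    then have "(1 - u') * c $ i + u' * d $ i = (\<alpha> * d $ i - \<beta> * c $ i) / (\<alpha> - \<beta>)"
      "(1 - v') * a $ i + v' * b $ i = (\<gamma> * b $ i - \<delta> * a $ i) / (\<gamma> - \<delta>)"
      by (simp_all add: u'_def v'_def diff_divide_distrib)
    moreover have "\<gamma> * b $ i - \<delta> * a $ i = - (\<alpha> * d $ i - \<beta> * c $ i)" "\<gamma> - \<delta> = - (\<alpha> - \<beta>)"
      using rel id[of i] by simp_all
    ultimately show "(1 - u') * c $ i + u' * d $ i = (1 - v') * a $ i + v' * b $ i"
      by (simp only: minus_divide_divide)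
  qed
  moreover have "(1 - u') *\<^sub>R c + u' *\<^sub>R d \<in> closed_segment c d" unfolding in_segment using u u'_def by blast
  moreover have "(1 - v') *\<^sub>R a + v' *\<^sub>R b \<in> closed_segment a b" unfolding in_segment using v v'_def by blast
  ultimately show ?thesis by auto
qed

definition same_pattern :: "nat \<Rightarrow> (nat \<Rightarrow> real ^ 2) \<Rightarrow> (nat \<Rightarrow> real ^ 2) \<Rightarrow> bool" where
  "same_pattern n p q \<longleftrightarrow>
     (\<forall>i<n. \<forall>j<n. \<forall>k<n. sgn (orient (p i) (p j) (p k)) = sgn (orient (q i) (q j) (q k))) \<and>
     (\<forall>i<n. \<forall>j<n. \<forall>c. sgn (p i $ c - p j $ c) = sgn (q i $ c - q j $ c))"

lemma same_pattern_segment: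
  assumes pq: "same_pattern n p q" and n: "a < n" "b < n" "w < n"
  shows "p w \<in> closed_segment (p a) (p b) \<longleftrightarrow> q w \<in> closed_segment (q a) (q b)"
proof -
  have o: "sgn (orient (p a) (p b) (p w)) = sgn (orient (q a) (q b) (q w))"
    using pq n by (simp add: same_pattern_def)
  have "sgn ((p w $ i - p a $ i) * (p b $ i - p w $ i)) = sgn ((q w $ i - q a $ i) * (q b $ i - q w $ i))" for i
    using pq n by (simp add: same_pattern_def sgn_mult)
  then have "0 \<le> (p w $ i - p a $ i) * (p b $ i - p w $ i) \<longleftrightarrow> 0 \<le> (q w $ i - q a $ i) * (q b $ i - q w $ i)" for i
    by (metis not_less sgn_less)
  moreover have "orient (p a) (p b) (p w) = 0 \<longleftrightarrow> orient (q a) (q b) (q w) = 0"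
    using o by (metis sgn_eq_0_iff)
  ultimately show ?thesis unfolding mem_closed_segment_iff_orient by simp
qed

text \<open>No vertex lies on a foreign edge, also for \<open>q\<close>, so a crossing of disjoint
  edges under \<open>q\<close> is proper. Proper crossings are visible in orientation signs and
  would carry over to \<open>p\<close>.\<close>

lemma disjoint_drawing_same_pattern:
  assumes pq: "same_pattern n p q" and dr: "disjoint_drawing n p E"
  shows "disjoint_drawing n q E"
  unfolding disjoint_drawing_def
proof (intro conjI ballI allI impI)
  have sym: "same_pattern n q p" using pq by (simp add: same_pattern_def)
  show "inj_on q {..<n}"
  proof (rule inj_onI)
    fix i j assume ij: "i \<in> {..<n}" "j \<in> {..<n}" "q i = q j"
    have "sgn (p i $ c - p j $ c) = sgn (q i $ c - q j $ c)" for c using pq ij by (simp add: same_pattern_def)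
    then have "p i $ c - p j $ c = 0" for c using ij(3) by (simp add: sgn_eq_0_iff)
    then have "p i = p j" by (simp add: vec_eq_iff)
    then show "i = j" using dr ij by (auto simp: disjoint_drawing_def inj_on_def)
  qed
  have vert: "q w \<notin> convex hull (q ` e)" if e: "e \<in> E" and w: "w < n" "w \<notin> e" for e w
  proof -
    have "card e = 2" "e \<subseteq> {..<n}" and "p w \<notin> convex hull (p ` e)" using dr e w by (auto simp: disjoint_drawing_def)
    then obtain a b where "e = {a, b}" "a < n" "b < n" by (auto simp: card_2_iff)
    then show ?thesis using same_pattern_segment[OF pq, of a b w] w \<open>p w \<notin> convex hull (p ` e)\<close>
      by (simp add: segment_convex_hull)
  qed
  fix e assume e: "e \<in> E"
  show "card e = 2" "e \<subseteq> {..<n}" using dr e by (auto simp: disjoint_drawing_def)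
  show "q w \<notin> convex hull (q ` e)" if "w < n" "w \<notin> e" for w by (rule vert[OF e that])
  fix f assume f: "f \<in> E" "e \<inter> f = {}"
  show "convex hull (q ` e) \<inter> convex hull (q ` f) = {}"
  proof (rule ccontr)
    assume int: "convex hull (q ` e) \<inter> convex hull (q ` f) \<noteq> {}"
    have "card e = 2" "e \<subseteq> {..<n}" "card f = 2" "f \<subseteq> {..<n}" using dr e f by (auto simp: disjoint_drawing_def)
    then obtain a b c d where ab: "e = {a, b}" "a < n" "b < n" and cd: "f = {c, d}" "c < n" "d < n"
      by (auto simp: card_2_iff)
    have ne: "a \<notin> f" "b \<notin> f" "c \<notin> e" "d \<notin> e" using f(2) ab cd by auto
    obtain r where r: "r \<in> closed_segment (q a) (q b)" "r \<in> closed_segment (q c) (q d)"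
      using int ab cd by (auto simp: segment_convex_hull)
    have n: "q a \<notin> closed_segment (q c) (q d)" "q b \<notin> closed_segment (q c) (q d)"
      "q c \<notin> closed_segment (q a) (q b)" "q d \<notin> closed_segment (q a) (q b)"
      using vert[OF f(1) ab(2) ne(1)] vert[OF f(1) ab(3) ne(2)] vert[OF e cd(2) ne(3)] vert[OF e cd(3) ne(4)]
      by (simp_all add: ab cd segment_convex_hull)
    have "orient (q c) (q d) (q a) * orient (q c) (q d) (q b) < 0"
      by (rule segment_sides_opposite[OF r n(1-3)])
    moreover have "orient (q a) (q b) (q c) * orient (q a) (q b) (q d) < 0"
      by (rule segment_sides_opposite[OF r(2,1) n(3,4,1)])
    moreover have "sgn (orient (p i) (p j) (p k)) = sgn (orient (q i) (q j) (q k))" if "i < n" "j < n" "k < n" for i j k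
      using pq that by (simp add: same_pattern_def)
    then have "sgn (orient (p c) (p d) (p a) * orient (p c) (p d) (p b))
        = sgn (orient (q c) (q d) (q a) * orient (q c) (q d) (q b))"
      "sgn (orient (p a) (p b) (p c) * orient (p a) (p b) (p d))
        = sgn (orient (q a) (q b) (q c) * orient (q a) (q b) (q d))"
      using ab cd by (simp_all add: sgn_mult)
    ultimately have "orient (p c) (p d) (p a) * orient (p c) (p d) (p b) < 0"
      "orient (p a) (p b) (p c) * orient (p a) (p b) (p d) < 0"
      by (metis sgn_less)+
    then have "closed_segment (p a) (p b) \<inter> closed_segment (p c) (p d) \<noteq> {}"
      by (intro opposite_sides_segments_intersect)
    then have "convex hull (p ` e) \<inter> convex hull (p ` f) \<noteq> {}"
      by (simp add: ab cd segment_convex_hull)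
    then show False using dr e f by (auto simp: disjoint_drawing_def)
  qed
qed

section \<open>Sign patterns of labelled points and their number\<close>

fun pattern_fun :: "(nat \<Rightarrow> real ^ 2) \<Rightarrow> (nat \<times> nat \<times> nat) + (nat \<times> nat \<times> 2) \<Rightarrow> real" where
  "pattern_fun p (Inl (i, j, k)) = orient (p i) (p j) (p k)"
| "pattern_fun p (Inr (i, j, c)) = p i $ c - p j $ c"

definition pattern_index :: "nat \<Rightarrow> ((nat \<times> nat \<times> nat) + (nat \<times> nat \<times> 2)) set" where
  "pattern_index n = ({..<n} \<times> {..<n} \<times> {..<n}) <+> ({..<n} \<times> {..<n} \<times> UNIV)"

definition pattern :: "nat \<Rightarrow> (nat \<Rightarrow> real ^ 2) \<Rightarrow> (nat \<times> nat \<times> nat) + (nat \<times> nat \<times> 2) \<Rightarrow> real" where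
  "pattern n p = (\<lambda>t\<in>pattern_index n. sgn (pattern_fun p t))"

lemma same_pattern_of_pattern_eq:
  assumes "pattern n p = pattern n q" shows "same_pattern n p q"
proof -
  have eq: "sgn (pattern_fun p t) = sgn (pattern_fun q t)" if "t \<in> pattern_index n" for t
    using fun_cong[OF assms, of t] that by (simp add: pattern_def)
  have "sgn (orient (p i) (p j) (p k)) = sgn (orient (q i) (q j) (q k))" if "i < n" "j < n" "k < n" for i j k
  proof -
    have "Inl (i, j, k) \<in> pattern_index n" using that by (auto simp: pattern_index_def)
    from eq[OF this] show ?thesis by simp
  qed
  moreover have "sgn (p i $ c - p j $ c) = sgn (q i $ c - q j $ c)" if "i < n" "j < n" for i j c
  proof -
    have "Inr (i, j, c) \<in> pattern_index n" using that by (auto simp: pattern_index_def)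
    from eq[OF this] show ?thesis by simp
  qed
  ultimately show ?thesis by (simp add: same_pattern_def)
qed

lemma card_pattern_index: "card (pattern_index n) = n ^ 3 + 2 * n ^ 2" "finite (pattern_index n)"
  by (simp_all add: pattern_index_def card_Plus card_cartesian_product power3_eq_cube power2_eq_square)

lemma finite_patterns: "finite (range (pattern n))"
  unfolding pattern_def by (rule finite_sgn_patterns[OF card_pattern_index(2)])

text \<open>There are \<open>2 * n\<close> variables and, with both shifts,
  \<open>2 * (n^3 + 2 * n^2)\<close> polynomials. Their quotient is at most \<open>3 * n^2\<close>,
  and the power \<open>2 * n\<close> of it gives the exponent \<open>4 * n\<close> of
  \<open>n\<close>.\<close>

lemma card_patterns_le:
  assumes "0 < n" shows "real (card (range (pattern n))) \<le> (128 * real n ^ 2) ^ (2 * n)"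
proof -
  define I where "I = {..<n} \<times> (UNIV :: 2 set)"
  define pt where "pt = (\<lambda>(x :: nat \<times> 2 \<Rightarrow> real) i. (\<chi> c. x (i, c)) :: real ^ 2)"
  define f where "f = (\<lambda>t x. pattern_fun (pt x) t)"
  have I: "finite I" "card I = 2 * n" by (simp_all add: I_def card_cartesian_product)
  have poly: "polyfun I 2 (f t)" if t: "t \<in> pattern_index n" for t
  proof -
    have v: "polyfun I 1 (\<lambda>x. x (i, c))" if "i < n" for i c using that by (intro polyfun_var) (simp add: I_def)
    have d: "polyfun I 1 (\<lambda>x. x (i, c) - x (j, c'))" if "i < n" "j < n" for i j c c'
      using that by (intro polyfun_diff v)
    from t consider i j k where "t = Inl (i, j, k)" "i < n" "j < n" "k < n"
      | i j c where "t = Inr (i, j, c)" "i < n" "j < n" by (auto simp: pattern_index_def)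
    then show ?thesis
    proof cases
      case (1 i j k)
      have "polyfun I (1 + 1) (\<lambda>x. (x (j, 1) - x (i, 1)) * (x (k, 2) - x (i, 2)) -
          (x (j, 2) - x (i, 2)) * (x (k, 1) - x (i, 1)))"
        using 1 by (intro polyfun_diff[of I "1 + 1"] polyfun_mult d)
      then show ?thesis using 1 by (simp add: f_def pt_def orient_def numeral_2_eq_2)
    next
      case (2 i j c)
      then show ?thesis using polyfun_mono[OF d[of i j c c], of 2] by (simp add: f_def pt_def)
    qed
  qed
  have "range (pattern n) \<subseteq> (\<lambda>x. \<lambda>t\<in>pattern_index n. sgn (f t x)) ` supported_on I"
  proof
    fix \<tau> assume "\<tau> \<in> range (pattern n)"
    then obtain p where p: "\<tau> = pattern n p" by auto
    define x where "x = (\<lambda>(i, c). if i < n then p i $ c else 0)"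
    have "x \<in> supported_on I" by (auto simp: supported_on_def x_def I_def)
    moreover have "pt x i = p i" if "i < n" for i using that by (simp add: pt_def x_def vec_eq_iff)
    then have "\<tau> = (\<lambda>t\<in>pattern_index n. sgn (f t x))"
      unfolding p pattern_def f_def by (intro restrict_ext) (auto simp: pattern_index_def x_def pt_def)
    ultimately show "\<tau> \<in> (\<lambda>x. \<lambda>t\<in>pattern_index n. sgn (f t x)) ` supported_on I" by blast
  qed
  moreover have "finite ((\<lambda>x. \<lambda>t\<in>pattern_index n. sgn (f t x)) ` supported_on I)"
    by (rule finite_sgn_patterns[OF card_pattern_index(2)])
  ultimately have "card (range (pattern n)) \<le> card ((\<lambda>x. \<lambda>t\<in>pattern_index n. sgn (f t x)) ` supported_on I)"
    by (intro card_mono)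
  also have "\<dots> \<le> 9 ^ card I * card {S. S \<subseteq> pattern_index n \<times> (UNIV :: bool set) \<and> card S \<le> card I}"
    by (rule card_sgn_patterns_le[OF I(1) card_pattern_index(2) poly])
  finally have "real (card (range (pattern n)))
      \<le> real (9 ^ (2 * n) * card {S. S \<subseteq> pattern_index n \<times> (UNIV :: bool set) \<and> card S \<le> 2 * n})"
    unfolding I(2) by (rule of_nat_mono)
  also have "\<dots> \<le> 9 ^ (2 * n) * (3 * exp 1 * real n ^ 2) ^ (2 * n)"
  proof -
    have c: "card (pattern_index n \<times> (UNIV :: bool set)) = 2 * (n ^ 3 + 2 * n ^ 2)"
      by (simp add: card_cartesian_product card_pattern_index)
    have n1: "1 \<le> n" using assms by simp
    have le: "2 * n \<le> card (pattern_index n \<times> (UNIV :: bool set))"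
      unfolding c using self_le_power[OF n1, of 2] by simp
    have "real (card {S. S \<subseteq> pattern_index n \<times> (UNIV :: bool set) \<and> card S \<le> 2 * n})
        \<le> (exp 1 * real (2 * (n ^ 3 + 2 * n ^ 2)) / real (2 * n)) ^ (2 * n)"
      using card_small_subsets_le[OF _ _ le] assms card_pattern_index(2) unfolding c by simp
    also have "\<dots> \<le> (3 * exp 1 * real n ^ 2) ^ (2 * n)"
    proof (rule power_mono)
      have "real (2 * (n ^ 3 + 2 * n ^ 2)) / real (2 * n) = real n ^ 2 + 2 * real n"
        using assms by (simp add: field_simps power3_eq_cube power2_eq_square)
      also have "\<dots> \<le> 3 * real n ^ 2" using n1 by (simp add: power2_eq_square)
      finally have "exp 1 * (real (2 * (n ^ 3 + 2 * n ^ 2)) / real (2 * n)) \<le> exp 1 * (3 * real n ^ 2)"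
        by (intro mult_left_mono) auto
      then show "exp 1 * real (2 * (n ^ 3 + 2 * n ^ 2)) / real (2 * n) \<le> 3 * exp 1 * real n ^ 2"
        by (simp add: algebra_simps)
    qed auto
    finally show ?thesis by simp
  qed
  also have "\<dots> = (9 * (3 * exp 1 * real n ^ 2)) ^ (2 * n)" by (rule power_mult_distrib[symmetric])
  also have "\<dots> \<le> (128 * real n ^ 2) ^ (2 * n)"
  proof (rule power_mono)
    \<comment> \<open>From \<open>exp 1 \<le> 3\<close> one gets 81, rounded up to the power of two
      \<open>2^7\<close> to keep later logarithms exact.\<close>
    have "27 * exp (1::real) \<le> 128" using exp_le by simp
    then have "27 * exp 1 * real n ^ 2 \<le> 128 * real n ^ 2" by (intro mult_right_mono) auto
    then show "9 * (3 * exp 1 * real n ^ 2) \<le> 128 * real n ^ 2" by simp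
  qed auto
  finally show ?thesis .
qed

lemma same_pattern_comp:
  assumes "same_pattern n p q" "\<And>i. i < n \<Longrightarrow> \<pi> i < n"
  shows "same_pattern n (p \<circ> \<pi>) (q \<circ> \<pi>)"
  using assms by (simp add: same_pattern_def)

lemma disjoint_drawing_cong:
  assumes "disjoint_drawing n p E" "\<And>i. i < n \<Longrightarrow> q i = p i"
  shows "disjoint_drawing n q E"
proof -
  have "same_pattern n p q" using assms(2) by (simp add: same_pattern_def)
  then show ?thesis using disjoint_drawing_same_pattern assms(1) by blast
qed

lemma sgn_eqD:
  fixes a b :: real assumes "sgn a = sgn b"
  shows "a < 0 \<longleftrightarrow> b < 0" "a = 0 \<longleftrightarrow> b = 0"
  using assms by (auto simp: sgn_if split: if_splits)

text \<open>
  The order type alone may have symmetries; the signs of the coordinate differences determine the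
  lexicographic order of the points, which makes the action of permutations on patterns free.
\<close>
lemma pattern_permute_inject:
  assumes h: "inj_on h {..<n}" and \<theta>: "\<theta> permutes {..<n}" and \<rho>: "\<rho> permutes {..<n}"
    and eq: "pattern n (h \<circ> \<theta>) = pattern n (h \<circ> \<rho>)"
  shows "\<theta> = \<rho>"
proof -
  define lt where "lt = (\<lambda>(u :: real ^ 2) (v :: real ^ 2). u $ 1 < v $ 1 \<or> u $ 1 = v $ 1 \<and> u $ 2 < v $ 2)"
  have trans: "lt u v \<Longrightarrow> lt v w \<Longrightarrow> lt u w" for u v w by (auto simp: lt_def)
  have irr: "\<not> lt u u" for u by (auto simp: lt_def)
  have total: "lt u v \<or> u = v \<or> lt v u" for u v by (auto simp: lt_def vec_eq_iff forall_2)
  \<comment> \<open>The lexicographic rank identifies a point of the set, and the rank of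
    \<open>h (\<theta> i)\<close> can be computed from the pattern of
    \<open>h \<circ> \<theta>\<close> alone.\<close>
  define rank where "rank = (\<lambda>a. card {b \<in> {..<n}. lt (h b) (h a)})"
  have mono: "rank a < rank b" if "a < n" "lt (h a) (h b)" for a b
    unfolding rank_def
  proof (rule psubset_card_mono)
    show "{c \<in> {..<n}. lt (h c) (h a)} \<subset> {c \<in> {..<n}. lt (h c) (h b)}"
      using that irr trans by blast
  qed simp
  have rank_inj: "a = b" if "a < n" "b < n" "rank a = rank b" for a b
  proof (rule ccontr)
    assume "a \<noteq> b"
    then have "h a \<noteq> h b" using h that by (auto simp: inj_on_def)
    then show False using total[of "h a" "h b"] mono[of a b] mono[of b a] that by auto
  qed
  have s: "same_pattern n (h \<circ> \<theta>) (h \<circ> \<rho>)" by (rule same_pattern_of_pattern_eq[OF eq])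
  have lteq: "lt (h (\<theta> i)) (h (\<theta> j)) \<longleftrightarrow> lt (h (\<rho> i)) (h (\<rho> j))" if "i < n" "j < n" for i j
  proof -
    have "sgn (h (\<theta> i) $ c - h (\<theta> j) $ c) = sgn (h (\<rho> i) $ c - h (\<rho> j) $ c)" for c
      using s that by (simp add: same_pattern_def)
    then have "h (\<theta> i) $ c < h (\<theta> j) $ c \<longleftrightarrow> h (\<rho> i) $ c < h (\<rho> j) $ c"
      "h (\<theta> i) $ c = h (\<theta> j) $ c \<longleftrightarrow> h (\<rho> i) $ c = h (\<rho> j) $ c" for c
      using sgn_eqD[of "h (\<theta> i) $ c - h (\<theta> j) $ c" "h (\<rho> i) $ c - h (\<rho> j) $ c"] by simp_all
    then show ?thesis by (simp add: lt_def)
  qed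
  have rank_perm: "rank (\<pi> i) = card {j \<in> {..<n}. lt (h (\<pi> j)) (h (\<pi> i))}" if \<pi>: "\<pi> permutes {..<n}" for \<pi> i
  proof -
    have "{b \<in> {..<n}. lt (h b) (h (\<pi> i))} = \<pi> ` {j \<in> {..<n}. lt (h (\<pi> j)) (h (\<pi> i))}"
    proof (intro equalityI subsetI)
      fix b assume b: "b \<in> {b \<in> {..<n}. lt (h b) (h (\<pi> i))}"
      then obtain j where "j \<in> {..<n}" "b = \<pi> j" using permutes_image[OF \<pi>] by blast
      then show "b \<in> \<pi> ` {j \<in> {..<n}. lt (h (\<pi> j)) (h (\<pi> i))}" using b by auto
    next
      fix b assume "b \<in> \<pi> ` {j \<in> {..<n}. lt (h (\<pi> j)) (h (\<pi> i))}"
      then obtain j where j: "j \<in> {..<n}" "b = \<pi> j" "lt (h (\<pi> j)) (h (\<pi> i))" by auto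
      then show "b \<in> {b \<in> {..<n}. lt (h b) (h (\<pi> i))}" using permutes_in_image[OF \<pi>, of j] by auto
    qed
    then show ?thesis unfolding rank_def
      using card_image[OF inj_on_subset[OF permutes_inj[OF \<pi>] subset_UNIV]] by simp
  qed
  show ?thesis
  proof
    fix i
    show "\<theta> i = \<rho> i"
    proof (cases "i < n")
      case True
      have "{j \<in> {..<n}. lt (h (\<theta> j)) (h (\<theta> i))} = {j \<in> {..<n}. lt (h (\<rho> j)) (h (\<rho> i))}"
        using lteq True by auto
      then have "rank (\<theta> i) = rank (\<rho> i)" by (simp add: rank_perm[OF \<theta>] rank_perm[OF \<rho>])
      moreover have "\<theta> i < n" "\<rho> i < n"
        using permutes_in_image[OF \<theta>, of i] permutes_in_image[OF \<rho>, of i] True by auto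
      ultimately show ?thesis using rank_inj by blast
    next
      case False
      then show ?thesis using permutes_not_in[OF \<theta>, of i] permutes_not_in[OF \<rho>, of i] by simp
    qed
  qed
qed

subsection \<open>Counting\<close>

text \<open>A pattern belongs to labelled points, but an embedding may assign vertices to points by
  any bijection, hence the permutation \<open>\<pi>\<close>.\<close>

definition embeddable_in :: "nat \<Rightarrow> ((nat \<times> nat \<times> nat) + (nat \<times> nat \<times> 2) \<Rightarrow> real) \<Rightarrow> nat set set set" where
  "embeddable_in m \<tau> = {C \<in> stacked m. \<exists>p \<pi>. pattern (m + 3) p = \<tau> \<and> \<pi> permutes {..<m + 3} \<and>
     disjoint_drawing (m + 3) (p \<circ> \<pi>) (edges_of C)}"

text \<open>The permutation used determines the triangulation: drawings transfer between
  realisations of the same pattern, and on a labelled placement \<open>stacked_unique\<close>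
  applies.\<close>

lemma card_embeddable_in: "card (embeddable_in m \<tau>) \<le> fact (m + 3)"
proof -
  let ?n = "m + 3"
  define w where "w = (\<lambda>C \<pi>. \<pi> permutes {..<?n} \<and>
     (\<exists>p. pattern ?n p = \<tau> \<and> disjoint_drawing ?n (p \<circ> \<pi>) (edges_of C)))"
  have "\<forall>C\<in>embeddable_in m \<tau>. \<exists>\<pi>. w C \<pi>" by (auto simp: embeddable_in_def w_def)
  then obtain P where P: "\<And>C. C \<in> embeddable_in m \<tau> \<Longrightarrow> w C (P C)" by metis
  have "inj_on P (embeddable_in m \<tau>)"
  proof (rule inj_onI)
    fix C D assume CD: "C \<in> embeddable_in m \<tau>" "D \<in> embeddable_in m \<tau>" "P C = P D"
    obtain p where p: "pattern ?n p = \<tau>" "disjoint_drawing ?n (p \<circ> P C) (edges_of C)"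
      using P[OF CD(1)] by (auto simp: w_def)
    obtain q where q: "pattern ?n q = \<tau>" "disjoint_drawing ?n (q \<circ> P C) (edges_of D)"
      using P[OF CD(2)] CD(3) by (auto simp: w_def)
    have "P C permutes {..<?n}" using P[OF CD(1)] by (simp add: w_def)
    then have "\<And>i. i < ?n \<Longrightarrow> P C i < ?n" using permutes_in_image by fastforce
    then have "same_pattern ?n (q \<circ> P C) (p \<circ> P C)"
      using same_pattern_of_pattern_eq[of ?n q p] p q by (intro same_pattern_comp) auto
    then have "disjoint_drawing ?n (p \<circ> P C) (edges_of D)"
      using disjoint_drawing_same_pattern q(2) by blast
    then show "C = D" using stacked_unique[of C m D ?n "p \<circ> P C"] p(2) CD by (auto simp: embeddable_in_def)
  qed
  then have "card (embeddable_in m \<tau>) \<le> card {\<pi>. \<pi> permutes {..<?n}}"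
    by (rule card_inj_on_le) (use P in \<open>auto simp: w_def finite_permutations\<close>)
  then show ?thesis using card_permutations[of "{..<?n}" ?n] by simp
qed

text \<open>All \<open>n!\<close> labellings \<open>h \<circ> \<theta>\<close> of the point set have
  different patterns, and the embeddings of \<open>A\<close> survive relabelling.\<close>

lemma many_patterns_if_embeddable:
  assumes A: "A \<subseteq> stacked m" and emb: "simultaneously_embeddable (m + 3) (graph_of (m + 3) ` A)"
  shows "fact (m + 3) \<le> card {\<tau> \<in> range (pattern (m + 3)). A \<subseteq> embeddable_in m \<tau>}"
proof -
  let ?n = "m + 3"
  obtain P where P: "finite P" "card P = ?n" "\<And>C. C \<in> A \<Longrightarrow> \<exists>p. straight_line_embedding (graph_of ?n C) P p"
    using emb by (auto simp: simultaneously_embeddable_def)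
  obtain h where h: "bij_betw h {..<?n} P"
    using ex_bij_betw_nat_finite[OF P(1)] P(2) by (auto simp: atLeast0LessThan)
  have injh: "inj_on h {..<?n}" and imh: "h ` {..<?n} = P" using h by (auto simp: bij_betw_def)
  have "card {\<theta>. \<theta> permutes {..<?n}} \<le> card {\<tau> \<in> range (pattern ?n). A \<subseteq> embeddable_in m \<tau>}"
  proof (rule card_inj_on_le[where f = "\<lambda>\<theta>. pattern ?n (h \<circ> \<theta>)"])
    show "inj_on (\<lambda>\<theta>. pattern ?n (h \<circ> \<theta>)) {\<theta>. \<theta> permutes {..<?n}}"
      using pattern_permute_inject[OF injh] by (auto intro: inj_onI)
    show "finite {\<tau> \<in> range (pattern ?n). A \<subseteq> embeddable_in m \<tau>}" using finite_patterns by simp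
    have "C \<in> embeddable_in m (pattern ?n (h \<circ> \<theta>))" if \<theta>: "\<theta> permutes {..<?n}" and C: "C \<in> A" for \<theta> C
    proof -
      obtain \<phi> where \<phi>: "straight_line_embedding (graph_of ?n C) P \<phi>" using P(3)[OF C] by blast
      have Cs: "C \<in> stacked m" using A C by blast
      have dr: "disjoint_drawing ?n \<phi> (edges_of C)"
        using \<phi> by (intro crossing_free_disjoint_drawing[OF Cs]) (simp add: straight_line_embedding_def)
      have im\<phi>: "\<phi> ` {..<?n} \<subseteq> P" using \<phi> by (simp add: straight_line_embedding_def graph_of_def)
      have inj\<phi>: "inj_on \<phi> {..<?n}" using dr by (simp add: disjoint_drawing_def)
      define \<rho> where "\<rho> = (\<lambda>i. if i < ?n then inv_into {..<?n} h (\<phi> i) else i)"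
      have h\<rho>: "h (\<rho> i) = \<phi> i" if "i < ?n" for i
        unfolding \<rho>_def using that im\<phi> imh by (auto intro!: f_inv_into_f)
      have "\<rho> ` {..<?n} \<subseteq> {..<?n}"
      proof
        fix j assume "j \<in> \<rho> ` {..<?n}"
        then obtain i where i: "i < ?n" "j = inv_into {..<?n} h (\<phi> i)" by (auto simp: \<rho>_def)
        have "\<phi> i \<in> h ` {..<?n}" using im\<phi> imh i by auto
        then show "j \<in> {..<?n}" unfolding i(2) by (rule inv_into_into)
      qed
      moreover have "inj_on \<rho> {..<?n}"
      proof (rule inj_onI)
        fix i j assume ij: "i \<in> {..<?n}" "j \<in> {..<?n}" "\<rho> i = \<rho> j"
        then have "\<phi> i = \<phi> j" using h\<rho>[of i] h\<rho>[of j] by simp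
        then show "i = j" using inj\<phi> ij by (auto dest: inj_onD)
      qed
      ultimately have "bij_betw \<rho> {..<?n} {..<?n}"
        by (simp add: bij_betw_def endo_inj_surj)
      then have "\<rho> permutes {..<?n}" by (rule bij_imp_permutes) (simp add: \<rho>_def)
      then have perm: "inv \<theta> \<circ> \<rho> permutes {..<?n}" using permutes_inv[OF \<theta>] by (rule permutes_compose)
      \<comment> \<open>The permutation \<open>inv \<theta> \<circ> \<rho>\<close> undoes the
        relabelling: the composition agrees with the embedding \<open>\<phi>\<close> on all
        vertices.\<close>
      have "disjoint_drawing ?n ((h \<circ> \<theta>) \<circ> (inv \<theta> \<circ> \<rho>)) (edges_of C)"
        using dr by (rule disjoint_drawing_cong) (simp add: h\<rho> permutes_inverses[OF \<theta>])
      then show ?thesis using Cs perm unfolding embeddable_in_def by blast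
    qed
    then show "(\<lambda>\<theta>. pattern ?n (h \<circ> \<theta>)) ` {\<theta>. \<theta> permutes {..<?n}}
        \<subseteq> {\<tau> \<in> range (pattern ?n). A \<subseteq> embeddable_in m \<tau>}" by blast
  qed
  then show ?thesis using card_permutations[of "{..<?n}" ?n] by simp
qed

text \<open>Double counting of the pairs in \<open>W\<close>. Lists with repetitions make the counts
  exact powers; this is why the collection has at most, not exactly, \<open>k\<close>
  members.\<close>

lemma conflict_collection_exists:
  assumes lt: "card (range (pattern (m + 3))) * fact (m + 3) ^ k < fact (m + 3) * card (stacked m) ^ k"
  shows "\<exists>\<G>. conflict_collection (m + 3) \<G> \<and> card \<G> \<le> k"
proof -
  let ?n = "m + 3"
  define L where "L = range (pattern ?n)"
  define T where "T = {xs. set xs \<subseteq> stacked m \<and> length xs = k}"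
  define W where "W = (SIGMA xs:T. {\<tau> \<in> L. set xs \<subseteq> embeddable_in m \<tau>})"
  have finL: "finite L" unfolding L_def by (rule finite_patterns)
  have finS: "finite (stacked m)" using card_stacked by simp
  have finT: "finite T" unfolding T_def by (rule finite_lists_length_eq[OF finS])
  have cT: "card T = card (stacked m) ^ k" unfolding T_def by (rule card_lists_length_eq[OF finS])
  have finE: "finite (embeddable_in m \<tau>)" for \<tau> using finS by (rule rev_finite_subset) (auto simp: embeddable_in_def)
  have "card W \<le> card (SIGMA \<tau>:L. {xs. set xs \<subseteq> embeddable_in m \<tau> \<and> length xs = k})"
    by (rule card_inj_on_le[where f = prod.swap])
       (auto simp: W_def T_def finL finE finite_lists_length_eq intro!: finite_SigmaI)
  also have "\<dots> = (\<Sum>\<tau>\<in>L. card {xs. set xs \<subseteq> embeddable_in m \<tau> \<and> length xs = k})"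
    by (intro card_SigmaI finL ballI finite_lists_length_eq finE)
  also have "\<dots> = (\<Sum>\<tau>\<in>L. card (embeddable_in m \<tau>) ^ k)"
    by (intro sum.cong card_lists_length_eq finE) auto
  also have "\<dots> \<le> (\<Sum>\<tau>\<in>L. fact ?n ^ k)" by (intro sum_mono power_mono card_embeddable_in) auto
  also have "\<dots> = card L * fact ?n ^ k" by simp
  also have "\<dots> < fact ?n * card (stacked m) ^ k" using lt by (simp add: L_def)
  finally have W_less: "card W < fact ?n * card T" unfolding cT .
  have "\<exists>xs\<in>T. \<not> simultaneously_embeddable ?n (graph_of ?n ` set xs)"
  proof (rule ccontr)
    assume neg: "\<not> ?thesis"
    have "fact ?n * card T = (\<Sum>xs\<in>T. fact ?n)" by simp
    also have "\<dots> \<le> (\<Sum>xs\<in>T. card {\<tau> \<in> L. set xs \<subseteq> embeddable_in m \<tau>})"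
    proof (rule sum_mono)
      fix xs assume "xs \<in> T"
      then show "fact ?n \<le> card {\<tau> \<in> L. set xs \<subseteq> embeddable_in m \<tau>}"
        unfolding L_def using neg by (intro many_patterns_if_embeddable) (auto simp: T_def)
    qed
    also have "\<dots> = card W" unfolding W_def using finT finL by (intro card_SigmaI[symmetric]) auto
    finally show False using W_less by simp
  qed
  then obtain xs where xs: "set xs \<subseteq> stacked m" "length xs = k"
    "\<not> simultaneously_embeddable ?n (graph_of ?n ` set xs)" by (auto simp: T_def)
  have "conflict_collection ?n (graph_of ?n ` set xs)"
    unfolding conflict_collection_def using xs planar_graph_of by (auto simp: graph_of_def)
  moreover have "card (graph_of ?n ` set xs) \<le> k"
    using card_image_le[of "set xs" "graph_of ?n"] card_length[of xs] xs(2) by simp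
  ultimately show ?thesis by blast
qed

section \<open>Numerical estimates\<close>

lemma card_stacked_ge: "2 ^ a * fact a \<le> card (stacked (Suc a))"
proof -
  \<comment> \<open>Factorwise comparison of \<open>1 * 3 * ... * (2a + 1)\<close> with the even
    product \<open>2 * 4 * ... * 2a\<close>.\<close>
  have "2 ^ a * fact a \<le> (\<Prod>j<Suc a. 2 * j + 1 :: nat)"
  proof (induction a)
    case (Suc a)
    have "2 ^ Suc a * fact (Suc a) = (2 ^ a * fact a) * (2 * Suc a)" by (simp add: algebra_simps)
    also have "\<dots> \<le> (\<Prod>j<Suc a. 2 * j + 1) * (2 * Suc a + 1)" by (rule mult_mono[OF Suc.IH]) auto
    finally show ?case by (simp only: prod.lessThan_Suc)
  qed simp
  then show ?thesis using card_stacked[of "Suc a"] by simp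
qed

lemma fact_add_4_le: "fact (a + 4) \<le> (a + 4) ^ 4 * (fact a :: nat)"
proof -
  have "fact (a + 4) = (a + 4) * ((a + 3) * ((a + 2) * ((a + 1) * fact a)))"
    by (simp add: fact_Suc eval_nat_numeral)
  also have "\<dots> \<le> (a + 4) * ((a + 4) * ((a + 4) * ((a + 4) * fact a)))"
    by (intro mult_mono) auto
  also have "\<dots> = (a + 4) ^ 4 * fact a" by (simp add: eval_nat_numeral algebra_simps)
  finally show ?thesis .
qed

text \<open>The left side over \<open>n!\<close> is one term of the series of \<open>exp n\<close>;
  4 replaces \<open>exp 1\<close> as a power of two.\<close>

lemma power_self_le_fact: "real n ^ n \<le> 4 ^ n * fact n"
proof -
  have "real n ^ n / fact n \<le> (\<Sum>k\<le>n. real n ^ k / fact k)"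
    by (rule member_le_sum[of n "{..n}" "\<lambda>k. real n ^ k / fact k"]) auto
  also have "\<dots> \<le> exp (real n)" by (rule sum_power_fact_le_exp) simp
  also have "\<dots> = exp 1 ^ n" using exp_of_nat_mult[of n "1::real"] by simp
  also have "\<dots> \<le> 4 ^ n" using exp_le by (intro power_mono) auto
  finally show ?thesis by (simp add: field_simps)
qed

text \<open>The binary logarithm of the counting condition, after removing factorials. Writing
  \<open>n = a + 4\<close>, the ratio of triangulations to \<open>n!\<close> is at least
  \<open>2^a / n^4\<close>, whose logarithm is the factor of \<open>k\<close>. On the left, the
  number of patterns over \<open>n!\<close> contributes \<open>16 * n\<close>, namely
  \<open>14 * n\<close> from \<open>128^(2n)\<close> and \<open>2 * n\<close> from
  \<open>4^n\<close>.\<close>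

lemma conflict_collection_of_card:
  assumes n: "4 \<le> n"
    and k: "3 * real n * log 2 n + 16 * n < (real n - 4 - 4 * log 2 n) * k"
  shows "\<exists>\<G>. conflict_collection n \<G> \<and> card \<G> \<le> k"
proof -
  obtain a where a: "n = a + 4" using n by (metis add.commute le_Suc_ex)
  define N where "N = card (stacked (Suc a))"
  define L where "L = card (range (pattern n))"
  define D where "D = real n - 4 - 4 * log 2 n"
  define A where "A = 3 * real n * log 2 n + 16 * n"
  have n0: "0 < real n" using n by simp
  have D: "2 powr D * fact n \<le> real N"
  proof -
    have "2 powr D = 2 powr (real a) / 2 powr (4 * log 2 n)" by (simp add: D_def a powr_diff)
    also have "2 powr (4 * log 2 n) = (2 powr log 2 n) powr 4" by (simp add: powr_powr mult.commute)
    also have "\<dots> = real n ^ 4" using n0 powr_realpow[of "real n" 4] by simp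
    finally have "2 powr D = 2 ^ a / real n ^ 4" by (simp add: powr_realpow)
    moreover have "(fact n :: real) \<le> real n ^ 4 * fact a"
    proof -
      have "real (fact n) \<le> real (n ^ 4 * fact a)" using fact_add_4_le[of a] unfolding a by (rule of_nat_mono)
      then show ?thesis by simp
    qed
    ultimately have "2 powr D * fact n \<le> 2 ^ a / real n ^ 4 * (real n ^ 4 * fact a)"
      by (intro mult_mono) auto
    also have "\<dots> = 2 ^ a * fact a" using n0 by simp
    also have "\<dots> \<le> real N"
    proof -
      have "real (2 ^ a * fact a) \<le> real N" unfolding N_def using card_stacked_ge[of a] by (rule of_nat_mono)
      then show ?thesis by simp
    qed
    finally show ?thesis .
  qed
  have L: "real L \<le> 2 powr A * fact n"
  proof -
    have "real L \<le> (128 * real n ^ 2) ^ (2 * n)" unfolding L_def using n by (intro card_patterns_le) simp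
    also have "\<dots> = 2 ^ (14 * n) * (real n ^ (3 * n) * real n ^ n)"
    proof -
      have "(128::real) = 2 ^ 7" by simp
      then have "(128 * real n ^ 2) ^ (2 * n) = 2 ^ (7 * (2 * n)) * real n ^ (2 * (2 * n))"
        by (simp only: power_mult_distrib power_mult)
      also have "\<dots> = 2 ^ (14 * n) * real n ^ (3 * n + n)" by (simp add: mult.assoc[symmetric])
      finally show ?thesis by (simp only: power_add)
    qed
    also have "\<dots> \<le> 2 ^ (14 * n) * (real n ^ (3 * n) * (4 ^ n * fact n))"
      by (intro mult_left_mono power_self_le_fact) auto
    also have "\<dots> = 2 ^ (16 * n) * real n ^ (3 * n) * fact n"
    proof -
      have "(4::real) ^ n = 2 ^ (2 * n)" by (simp add: power_mult)
      moreover have "(2::real) ^ (16 * n) = 2 ^ (14 * n) * 2 ^ (2 * n)" by (simp flip: power_add)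
      ultimately show ?thesis by simp
    qed
    also have "2 ^ (16 * n) * real n ^ (3 * n) = 2 powr A"
    proof -
      have "2 powr A = 2 powr (log 2 n * real (3 * n)) * 2 powr real (16 * n)"
        by (simp add: A_def powr_add algebra_simps)
      also have "2 powr (log 2 n * real (3 * n)) = (2 powr log 2 n) powr real (3 * n)" by (simp only: powr_powr)
      also have "\<dots> = real n ^ (3 * n)" using n0 by (simp add: powr_realpow del: of_nat_mult)
      also have "2 powr real (16 * n) = 2 ^ (16 * n)" by (rule powr_realpow) simp
      finally show ?thesis by simp
    qed
    finally show ?thesis .
  qed
  have "real L * fact n ^ k \<le> 2 powr A * fact n * fact n ^ k" using L by (intro mult_right_mono) auto
  also have "\<dots> < 2 powr (D * k) * fact n * fact n ^ k"
    using k by (intro mult_strict_right_mono powr_less_mono) (auto simp: A_def D_def)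
  also have "\<dots> = fact n * (2 powr D * fact n) ^ k"
    by (simp add: power_mult_distrib powr_powr[symmetric] powr_realpow)
  also have "\<dots> \<le> fact n * real N ^ k" using D by (intro mult_left_mono power_mono) auto
  finally have "real (L * fact n ^ k) < real (fact n * N ^ k)" by simp
  then have "L * fact n ^ k < fact n * N ^ k" by (simp only: of_nat_less_iff)
  moreover have "Suc a + 3 = n" using a by simp
  ultimately show ?thesis using conflict_collection_exists[of "Suc a" k] unfolding L_def N_def by (simp only:)
qed

theorem theorem1:
  shows "\<exists>\<epsilon> :: nat \<Rightarrow> real. \<epsilon> \<in> o(\<lambda>_. 1) \<and>
    (\<forall>\<^sub>F n in sequentially.
       ereal_of_enat (\<sigma> n) \<le> ereal ((3 + \<epsilon> n) * log 2 (real n)) \<and>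
       (\<exists>\<G>. conflict_collection n \<G> \<and> enat (card \<G>) = \<sigma> n))"
proof -
  define A where "A = (\<lambda>n::nat. 3 * real n * log 2 n + 16 * n)"
  define D where "D = (\<lambda>n::nat. real n - 4 - 4 * log 2 n)"
  \<comment> \<open>Chosen so that \<open>(3 + \<epsilon> n) * log 2 n\<close> is exactly
    \<open>A n / D n + 1\<close>; the 1 pays for rounding up to an integer.\<close>
  define \<epsilon> where "\<epsilon> = (\<lambda>n::nat. (A n / D n + 1) / log 2 n - 3)"
  have "\<epsilon> \<in> o(\<lambda>_. 1)" unfolding \<epsilon>_def A_def D_def by real_asymp
  moreover have "\<forall>\<^sub>F n in sequentially. 4 \<le> n \<and> 0 < D n \<and> 0 < log 2 (real n)"
    unfolding D_def by (intro eventually_conj eventually_ge_at_top) real_asymp+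
  then have "\<forall>\<^sub>F n in sequentially. ereal_of_enat (\<sigma> n) \<le> ereal ((3 + \<epsilon> n) * log 2 (real n)) \<and>
       (\<exists>\<G>. conflict_collection n \<G> \<and> enat (card \<G>) = \<sigma> n)"
  proof eventually_elim
    case (elim n)
    then have n: "4 \<le> n" "0 < D n" "0 < log 2 (real n)" by auto
    \<comment> \<open>The least natural number strictly above \<open>A n / D n\<close>, as the
      condition on \<open>k\<close> is strict.\<close>
    define k where "k = nat \<lfloor>A n / D n\<rfloor> + 1"
    have A0: "0 \<le> A n / D n" using n by (auto simp: A_def)
    have k: "real k = \<lfloor>A n / D n\<rfloor> + 1" using A0 by (simp add: k_def)
    then have "A n / D n < k" by linarith
    then have "A n < D n * k" using n(2) by (simp add: field_simps)
    then obtain \<G> where \<G>: "conflict_collection n \<G>" "card \<G> \<le> k"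
      using conflict_collection_of_card[OF n(1), of k] unfolding A_def D_def by auto
    let ?S = "(\<lambda>\<G>. enat (card \<G>)) ` {\<G>. conflict_collection n \<G>}"
    have mem: "enat (card \<G>) \<in> ?S" using \<G>(1) by blast
    \<comment> \<open>Extended naturals are well-ordered, so the infimum of a nonempty set is
      attained.\<close>
    have "\<sigma> n \<in> ?S" unfolding \<sigma>_def using mem by (rule wellorder_InfI)
    then have att: "\<exists>\<G>. conflict_collection n \<G> \<and> enat (card \<G>) = \<sigma> n" by auto
    have "\<sigma> n \<le> enat (card \<G>)" unfolding \<sigma>_def using mem by (rule Inf_lower)
    also have "\<dots> \<le> enat k" using \<G>(2) by simp
    finally have "ereal_of_enat (\<sigma> n) \<le> ereal (real k)"
      by (metis ereal_of_enat_le_iff ereal_of_enat_simps(1))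
    also have "real k \<le> (3 + \<epsilon> n) * log 2 (real n)"
    proof -
      have "real k \<le> A n / D n + 1" unfolding k by linarith
      also have "\<dots> = (3 + \<epsilon> n) * log 2 (real n)" using n(3) by (simp add: \<epsilon>_def)
      finally show ?thesis .
    qed
    finally show ?case using att by simp
  qed
  ultimately show ?thesis by blast
qed

end
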